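(* Let \begin{align*} \beta&=\arctan\left[\tfrac12\left(\sqrt[3]{\sqrt2+1}-\sqrt[3]{\sqrt2-1}\right)\right],\qquad a_1=e_1=\frac{1}{4\sin\beta}=\tfrac14\sqrt{4+\sqrt[3]{71+8\sqrt2}+\sqrt[3]{71-8\sqrt2}},\\ a_2&=e_2=0,\qquad \kappa_{1,2}=\kappa_{6,2}=\kappa_{5,2}=\tfrac12,\\ \kappa_{1,1}&=1-a_1,\qquad \kappa_{6,1}=1-\tfrac43a_1,\qquad \kappa_{5,1}=1-\tfrac53a_1,\\ f_1&=\frac{\left(83+\sqrt[3]{420619+15104\sqrt2}+\sqrt[3]{420619-15104\sqrt2}\right)^{1/4}}{3\sqrt{2(2-\sqrt2)}},\qquad f_2=-(\sqrt2-1)f_1, \end{align*} and let $\mathbf{x}:[0,\pi/2]\to\mathbb{R}^2$ be the rotation path $$\mathbf{x}(t)=\begin{cases}\mathbf{x}_1(t)&0\le t<\beta,\\ \mathbf{x}_6(t)&\beta\le t\le\pi/2-\beta,\\ \mathbf{x}_5(t)&\pi/2-\beta<t\le\pi/2,\end{cases}$$ where, with $\boldsymbol{\kappa}_j=(\kappa_{j,1},\kappa_{j,2})^\top$, \begin{align*} \mathbf{x}_1(t)&=R_t\begin{pmatrix}a_1\cos t+a_2\sin t-1\\-a_2\cos t+a_1\sin t-1/2\end{pmatrix}+\boldsymbol{\kappa}_1,\\ \mathbf{x}_6(t)&=R_t\begin{pmatrix}f_1\cos(t/2)+f_2\sin(t/2)-1\\-f_2\cos(t/2)+f_1\sin(t/2)-1\end{pmatrix}+\boldsymbol{\kappa}_6,\\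 \mathbf{x}_5(t)&=R_t\begin{pmatrix}e_1\cos t+e_2\sin t-1/2\\-e_2\cos t+e_1\sin t-1\end{pmatrix}+\boldsymbol{\kappa}_5. \end{align*} Let $\Sigma=S_{\mathbf{x}}\cap\rho(S_{\mathbf{x}})$, where $\rho$ is the reflection of the plane across the line $y=1/2$. Then: (i) $\Sigma$ is a shape that can move around corners both to the left and to the right. (ii) $\mathbf{x}$ is the unique rotation path satisfying the assumptions (P1)–(P5) of the context and satisfying the necessary area-maximization conditions (N) of the context at all $t\in(0,\pi/2)\setminus\{\beta,\pi/2-\beta\}$ (where $\beta\in(0,\pi/4)$ denotes the critical angle occurring in (P4)). (iii) The area $\Delta$ of $\Sigma$ is $$\Delta=\sqrt[3]{3+2\sqrt2}+\sqrt[3]{3-2\sqrt2}-1+\arctan\left[\tfrac12\left(\sqrt[3]{\sqrt2+1}-\sqrt[3]{\sqrt2-1}\right)\right].$$ (iv) The distance $\lambda$ between the left and right endpoints of $\Sigma$ is $$\lambda=\tfrac23\sqrt{4+\sqrt[3]{71+8\sqrt2}+\sqrt[3]{71-8\sqrt2}}.$$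
   Context: Vectors in $\mathbb{R}^2$ are column vectors and $\langle\cdot,\cdot\rangle$ is the standard inner product. Put $$L_{\mathrm{horiz}}=\{(x,y): x\le 1,\ 0\le y\le 1\},\quad L_{\mathrm{vert}}=\{(x,y): y\le 1,\ 0\le x\le 1\},\quad L=L_{\mathrm{horiz}}\cup L_{\mathrm{vert}}$$ (the $L$-shaped hallway of unit width, with inner corner $(0,0)$ and outer corner $(1,1)$). Let $$R_t=\begin{pmatrix}\cos t&-\sin t\\ \sin t&\cos t\end{pmatrix},\qquad \boldsymbol{\mu}_t=\begin{pmatrix}\cos t\\ \sin t\end{pmatrix},\qquad \boldsymbol{\nu}_t=\begin{pmatrix}-\sin t\\ \cos t\end{pmatrix}.$$ Moving around corners: a shape lying in $L_{\mathrm{horiz}}$ can move around the corner to the right if there is a continuous rigid motion (rotations and translations) carrying it from $L_{\mathrm{horiz}}$ into $L_{\mathrm{vert}}$ while it stays within $L$; it can move around the corner to the left if the same holds with $L,L_{\mathrm{horiz}},L_{\mathrm{vert}}$ replaced by their mirror images under reflection across the line $y=1/2$. A rotation path is a continuous path $\mathbf{x}:[0,\pi/2]\to\mathbb{R}^2$ with $\mathbf{x}(0)=(0,0)^\top$. The shape associated with $\mathbf{x}$ is $$S_{\mathbf{x}} = L_{\mathrm{horiz}} \cap \bigcap_{0\le t\le \pi/2} \big(\mathbf{x}(t)+R_t(L)\big)\cap \big(\mathbf{x}(\pi/2)+R_{\pi/2}(L_{\mathrm{vert}})\big).$$ Contact points. At time $t$ the moved hallway $\mathbf{x}(t)+R_t(L)$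 has its inner corner at $\mathbf{x}(t)$ and four walls (images of the four half-lines bounding $L$): the outer wall on the line $\langle \mathbf{p},\boldsymbol{\mu}_t\rangle=\langle\mathbf{x}(t),\boldsymbol{\mu}_t\rangle+1$; the inner wall $\{\mathbf{p}:\langle \mathbf{p},\boldsymbol{\mu}_t\rangle=\langle\mathbf{x}(t),\boldsymbol{\mu}_t\rangle,\ \langle \mathbf{p},\boldsymbol{\nu}_t\rangle\le\langle\mathbf{x}(t),\boldsymbol{\nu}_t\rangle\}$; the outer wall on the line $\langle \mathbf{p},\boldsymbol{\nu}_t\rangle=\langle\mathbf{x}(t),\boldsymbol{\nu}_t\rangle+1$; the inner wall $\{\mathbf{p}:\langle \mathbf{p},\boldsymbol{\nu}_t\rangle=\langle\mathbf{x}(t),\boldsymbol{\nu}_t\rangle,\ \langle \mathbf{p},\boldsymbol{\mu}_t\rangle\le\langle\mathbf{x}(t),\boldsymbol{\mu}_t\rangle\}$. The tangency points of these walls with $S_{\mathbf{x}}$ are denoted, in this order, $\mathbf{A}(t),\mathbf{B}(t),\mathbf{C}(t),\mathbf{D}(t)$; $\mathbf{B}(t)$ and/or $\mathbf{D}(t)$ may be undefined. The corner $\mathbf{x}(t)$ is also considered a contact point if it touches $S_{\mathbf{x}}$ (recorded separately; it does not by itself count as a tangency point of an inner wall, although at a transition time a contact path $\mathbf{B}$ or $\mathbf{D}$ may start or end at the corner). It is a standing assumption that no wall has more than one tangency point with the shape. $\Gamma_{\mathbf{x}}(t)\subseteq\{\mathbf{x},\mathbf{A},\mathbf{B},\mathbf{C},\mathbf{D}\}$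 denotes the set of contact points present at time $t$. The contact paths are given (where defined, continuous, and $\mathbf{x}$ differentiable) by $\mathbf{A}(t) = \mathbf{x}(t) + \langle \mathbf{x}'(t),\boldsymbol{\mu}_t\rangle\boldsymbol{\nu}_t + \boldsymbol{\mu}_t$, $\mathbf{B}(t) = \mathbf{x}(t) + \langle \mathbf{x}'(t),\boldsymbol{\mu}_t\rangle\boldsymbol{\nu}_t$, $\mathbf{C}(t) = \mathbf{x}(t) - \langle \mathbf{x}'(t),\boldsymbol{\nu}_t\rangle\boldsymbol{\mu}_t + \boldsymbol{\nu}_t$, $\mathbf{D}(t) = \mathbf{x}(t) - \langle \mathbf{x}'(t),\boldsymbol{\nu}_t\rangle\boldsymbol{\mu}_t$; these formulas, with one-sided derivatives, also define $\mathbf{A}(0)$ and $\mathbf{C}(\pi/2)$. Well-behaved. For $0<t<\pi/2$, $\mathbf{x}$ is well-behaved at $t$ if it is twice continuously differentiable at $t$ and: (1) if $\mathbf{x}(t)$ is a contact point then $\langle \mathbf{x}'(t),\boldsymbol{\nu}_t\rangle\ge0$ and $\langle \mathbf{x}'(t),\boldsymbol{\mu}_t\rangle\le0$; (2) if $\mathbf{A}(t)$ is defined then $\langle \mathbf{A}'(t),\boldsymbol{\nu}_t\rangle\ge0$; (3) if $\mathbf{B}(t)$ is defined then $\langle \mathbf{B}'(t),\boldsymbol{\nu}_t\rangle\le0$; (4) if $\mathbf{C}(t)$ is defined then $\langle \mathbf{C}'(t),\boldsymbol{\mu}_t\rangle\le0$; (5) if $\mathbf{D}(t)$ is defined then $\langle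 \mathbf{D}'(t),\boldsymbol{\mu}_t\rangle\ge0$. Assumptions on a rotation path $\mathbf{x}$: (P1) $\mathbf{x}$ is continuously differentiable. (P2) $\mathbf{x}$ has a left-to-right symmetry around the vertical axis passing through $\mathbf{x}(\pi/4)$, i.e. $\mathbf{x}'(\pi/2-t)=\begin{pmatrix}1&0\\0&-1\end{pmatrix}\mathbf{x}'(t)$ for all $t$. (P3) $\mathbf{A}(0)=(1,1/2)^\top$. (P4) For some angle $0<\beta<\pi/4$: $\Gamma_{\mathbf{x}}(t)=\{\mathbf{A},\mathbf{C},\mathbf{D}\}$ if $0<t<\beta$; $\Gamma_{\mathbf{x}}(t)=\{\mathbf{x},\mathbf{A},\mathbf{B},\mathbf{C},\mathbf{D}\}$ if $\beta\le t\le\pi/2-\beta$; $\Gamma_{\mathbf{x}}(t)=\{\mathbf{A},\mathbf{B},\mathbf{C}\}$ if $\pi/2-\beta<t<\pi/2$. (P5) During each of the three phases in (P4) (away from the transition times $\beta,\pi/2-\beta$) the rotation path is well-behaved. Necessary conditions (N): for $0<t<\beta$, $$\mathbf{x}''(t)=R_t\left(\begin{pmatrix}-1\\-1/2\end{pmatrix}+\begin{pmatrix}2\sin t&-2\cos t\\2\cos t&2\sin t\end{pmatrix}\mathbf{x}'(t)\right);$$ for $\beta<t<\pi/2-\beta$, $$\mathbf{x}''(t)=R_t\left(\begin{pmatrix}-1/2\\-1/2\end{pmatrix}+\begin{pmatrix}\frac32\sin t&-\frac32\cos t\\ \frac32\cos t&\frac32\sin t\end{pmatrix}\mathbf{x}'(t)\right);$$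 for $\pi/2-\beta<t<\pi/2$, $$\mathbf{x}''(t)=R_t\left(\begin{pmatrix}-1/2\\-1\end{pmatrix}+\begin{pmatrix}2\sin t&-2\cos t\\2\cos t&2\sin t\end{pmatrix}\mathbf{x}'(t)\right).$$ The right and left endpoints of $\Sigma$ are its rightmost and leftmost points $\mathbf{A}(0)$ and $\mathbf{C}(\pi/2)$. *)

theory Defs
  imports "HOL-Analysis.Analysis"
begin

type_synonym plane = "real^2"

section \<open>The hallway and the moving frame\<close>

definition L_horiz :: "plane set" where
  "L_horiz = {p. p$1 \<le> 1 \<and> 0 \<le> p$2 \<and> p$2 \<le> 1}"

definition L_vert :: "plane set" where
  "L_vert = {p. p$2 \<le> 1 \<and> 0 \<le> p$1 \<and> p$1 \<le> 1}"

definition L_hall :: "plane set" where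
  "L_hall = L_horiz \<union> L_vert"

definition rot :: "real \<Rightarrow> real^2^2" where
  "rot t = vector [vector [cos t, - sin t], vector [sin t, cos t]]"

definition mu :: "real \<Rightarrow> plane" where
  "mu t = vector [cos t, sin t]"

definition nu :: "real \<Rightarrow> plane" where
  "nu t = vector [- sin t, cos t]"

definition rigid :: "real \<Rightarrow> plane \<Rightarrow> plane \<Rightarrow> plane" where
  "rigid \<theta> c p = c + rot \<theta> *v p"

text \<open>Reflection across the line \<open>y = 1/2\<close>.\<close>

definition refl_half :: "plane \<Rightarrow> plane" where
  "refl_half p = vector [p$1, 1 - p$2]"


section \<open>Shapes and moving around corners\<close>

definition planar_shape :: "plane set \<Rightarrow> bool" where
  "planar_shape K \<longleftrightarrow> K \<noteq> {} \<and> compact K \<and> connected K"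

text \<open>\<open>K\<close> lies in \<open>H\<close>, and a continuous rigid motion, parametrized by \<open>[0,1]\<close> and starting
  at the identity, carries it into \<open>V\<close> while it stays inside \<open>W\<close>.\<close>

definition moves_within :: "plane set \<Rightarrow> plane set \<Rightarrow> plane set \<Rightarrow> plane set \<Rightarrow> bool" where
  "moves_within W H V K \<longleftrightarrow>
     K \<subseteq> H \<and>
     (\<exists>(\<theta> :: real \<Rightarrow> real) (c :: real \<Rightarrow> plane).
        continuous_on {0..1} \<theta> \<and> continuous_on {0..1} c \<and>
        \<theta> 0 = 0 \<and> c 0 = 0 \<and>
        (\<forall>s\<in>{0..1}. rigid (\<theta> s) (c s) ` K \<subseteq> W) \<and>
        rigid (\<theta> 1) (c 1) ` K \<subseteq> V)"

definition moves_around_right :: "plane set \<Rightarrow> bool" where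
  "moves_around_right K \<longleftrightarrow> moves_within L_hall L_horiz L_vert K"

definition moves_around_left :: "plane set \<Rightarrow> bool" where
  "moves_around_left K \<longleftrightarrow>
     moves_within (refl_half ` L_hall) (refl_half ` L_horiz) (refl_half ` L_vert) K"


section \<open>Rotation paths and their shapes\<close>

text \<open>Paths are total functions on the reals of which only the values on \<open>[0,\<pi>/2]\<close> matter.\<close>

definition rotation_path :: "(real \<Rightarrow> plane) \<Rightarrow> bool" where
  "rotation_path x \<longleftrightarrow> continuous_on {0..pi/2} x \<and> x 0 = 0"

definition shape_of :: "(real \<Rightarrow> plane) \<Rightarrow> plane set" where
  "shape_of x =
     L_horiz \<inter> (\<Inter>t\<in>{0..pi/2}. rigid t (x t) ` L_hall) \<inter> rigid (pi/2) (x (pi/2)) ` L_vert"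

text \<open>Derivative on \<open>[0,\<pi>/2]\<close>, hence one-sided at the endpoints.\<close>

definition vel :: "(real \<Rightarrow> plane) \<Rightarrow> real \<Rightarrow> plane" where
  "vel x t = vector_derivative x (at t within {0..pi/2})"


section \<open>Contact points\<close>

definition wall_A :: "(real \<Rightarrow> plane) \<Rightarrow> real \<Rightarrow> plane set" where
  "wall_A x t = {p. p \<bullet> mu t = x t \<bullet> mu t + 1 \<and> p \<bullet> nu t \<le> x t \<bullet> nu t + 1}"

definition wall_B :: "(real \<Rightarrow> plane) \<Rightarrow> real \<Rightarrow> plane set" where
  "wall_B x t = {p. p \<bullet> mu t = x t \<bullet> mu t \<and> p \<bullet> nu t \<le> x t \<bullet> nu t}"

definition wall_C :: "(real \<Rightarrow> plane) \<Rightarrow> real \<Rightarrow> plane set" where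
  "wall_C x t = {p. p \<bullet> nu t = x t \<bullet> nu t + 1 \<and> p \<bullet> mu t \<le> x t \<bullet> mu t + 1}"

definition wall_D :: "(real \<Rightarrow> plane) \<Rightarrow> real \<Rightarrow> plane set" where
  "wall_D x t = {p. p \<bullet> nu t = x t \<bullet> nu t \<and> p \<bullet> mu t \<le> x t \<bullet> mu t}"

text \<open>Tangency points with an inner wall \<open>W\<close>. The corner \<open>x t\<close> lies on both inner walls and is
  recorded separately as a contact point, so it is removed; it counts as a tangency point only if
  a path of tangency points away from the corner starts or ends at it at time \<open>t\<close>.\<close>

definition inner_off_corner ::
    "((real \<Rightarrow> plane) \<Rightarrow> real \<Rightarrow> plane set) \<Rightarrow> (real \<Rightarrow> plane) \<Rightarrow> real \<Rightarrow> plane set" where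
  "inner_off_corner W x t = shape_of x \<inter> W x t - {x t}"

definition path_meets_corner ::
    "((real \<Rightarrow> plane) \<Rightarrow> real \<Rightarrow> plane set) \<Rightarrow> (real \<Rightarrow> plane) \<Rightarrow> real \<Rightarrow> bool" where
  "path_meets_corner W x t \<longleftrightarrow>
     (\<exists>F\<in>{at_left t, at_right t}. \<exists>q.
        (\<forall>\<^sub>F s in F. q s \<in> inner_off_corner W x s) \<and> (q \<longlongrightarrow> x t) F)"

definition inner_tangency ::
    "((real \<Rightarrow> plane) \<Rightarrow> real \<Rightarrow> plane set) \<Rightarrow> (real \<Rightarrow> plane) \<Rightarrow> real \<Rightarrow> plane set" where
  "inner_tangency W x t =
     inner_off_corner W x t \<union> {p \<in> shape_of x. p = x t \<and> path_meets_corner W x t}"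

datatype contact = Pt_x | Pt_A | Pt_B | Pt_C | Pt_D

fun contact_points :: "(real \<Rightarrow> plane) \<Rightarrow> real \<Rightarrow> contact \<Rightarrow> plane set" where
  "contact_points x t Pt_x = shape_of x \<inter> {x t}"
| "contact_points x t Pt_A = shape_of x \<inter> wall_A x t"
| "contact_points x t Pt_B = inner_tangency wall_B x t"
| "contact_points x t Pt_C = shape_of x \<inter> wall_C x t"
| "contact_points x t Pt_D = inner_tangency wall_D x t"

definition Gamma :: "(real \<Rightarrow> plane) \<Rightarrow> real \<Rightarrow> contact set" where
  "Gamma x t = {k. contact_points x t k \<noteq> {}}"

text \<open>Uniqueness of tangency points is required for \<open>0 < t < \<pi>/2\<close> only: at \<open>t = 0\<close> and
  \<open>t = \<pi>/2\<close> the shape may touch a wall along a whole segment.\<close>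

definition unique_tangency :: "(real \<Rightarrow> plane) \<Rightarrow> bool" where
  "unique_tangency x \<longleftrightarrow>
     (\<forall>t\<in>{0<..<pi/2}. \<forall>k\<in>{Pt_A, Pt_B, Pt_C, Pt_D}.
        \<forall>p\<in>contact_points x t k. \<forall>q\<in>contact_points x t k. p = q)"

text \<open>The contact paths. If \<open>x\<close> is differentiable, a tangency point with the respective wall at a
  time \<open>0 < t < \<pi>/2\<close> is necessarily given by these formulas, which follow from stationarity at
  \<open>s = t\<close> of \<open>(p - x s) \<bullet> mu s\<close> (for \<open>A\<close>, \<open>B\<close>) or \<open>(p - x s) \<bullet> nu s\<close> (for \<open>C\<close>, \<open>D\<close>).\<close>

definition path_A :: "(real \<Rightarrow> plane) \<Rightarrow> real \<Rightarrow> plane" where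
  "path_A x t = x t + (vel x t \<bullet> mu t) *\<^sub>R nu t + mu t"

definition path_B :: "(real \<Rightarrow> plane) \<Rightarrow> real \<Rightarrow> plane" where
  "path_B x t = x t + (vel x t \<bullet> mu t) *\<^sub>R nu t"

definition path_C :: "(real \<Rightarrow> plane) \<Rightarrow> real \<Rightarrow> plane" where
  "path_C x t = x t - (vel x t \<bullet> nu t) *\<^sub>R mu t + nu t"

definition path_D :: "(real \<Rightarrow> plane) \<Rightarrow> real \<Rightarrow> plane" where
  "path_D x t = x t - (vel x t \<bullet> nu t) *\<^sub>R mu t"


section \<open>Assumptions on rotation paths\<close>

definition C2_at :: "(real \<Rightarrow> plane) \<Rightarrow> real \<Rightarrow> bool" where
  "C2_at x t \<longleftrightarrow>
     (\<forall>\<^sub>F s in nhds t. x differentiable (at s) \<and> vel x differentiable (at s)) \<and>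
     isCont (\<lambda>s. vector_derivative (vel x) (at s)) t"

definition well_behaved_at :: "(real \<Rightarrow> plane) \<Rightarrow> real \<Rightarrow> bool" where
  "well_behaved_at x t \<longleftrightarrow>
     C2_at x t \<and>
     (Pt_x \<in> Gamma x t \<longrightarrow> vel x t \<bullet> nu t \<ge> 0 \<and> vel x t \<bullet> mu t \<le> 0) \<and>
     (Pt_A \<in> Gamma x t \<longrightarrow> vector_derivative (path_A x) (at t) \<bullet> nu t \<ge> 0) \<and>
     (Pt_B \<in> Gamma x t \<longrightarrow> vector_derivative (path_B x) (at t) \<bullet> nu t \<le> 0) \<and>
     (Pt_C \<in> Gamma x t \<longrightarrow> vector_derivative (path_C x) (at t) \<bullet> mu t \<le> 0) \<and>
     (Pt_D \<in> Gamma x t \<longrightarrow> vector_derivative (path_D x) (at t) \<bullet> mu t \<ge> 0)"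

definition P1 :: "(real \<Rightarrow> plane) \<Rightarrow> bool" where
  "P1 x \<longleftrightarrow>
     (\<forall>t\<in>{0..pi/2}. x differentiable (at t within {0..pi/2})) \<and>
     continuous_on {0..pi/2} (vel x)"

definition P2 :: "(real \<Rightarrow> plane) \<Rightarrow> bool" where
  "P2 x \<longleftrightarrow>
     (\<forall>t\<in>{0..pi/2}.
        vel x (pi/2 - t) = (vector [vector [1, 0], vector [0, -1]] :: real^2^2) *v vel x t)"

definition P3 :: "(real \<Rightarrow> plane) \<Rightarrow> bool" where
  "P3 x \<longleftrightarrow> path_A x 0 = vector [1, 1/2]"

definition P4 :: "real \<Rightarrow> (real \<Rightarrow> plane) \<Rightarrow> bool" where
  "P4 \<beta> x \<longleftrightarrow>
     0 < \<beta> \<and> \<beta> < pi/4 \<and>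
     (\<forall>t. 0 < t \<and> t < \<beta> \<longrightarrow> Gamma x t = {Pt_A, Pt_C, Pt_D}) \<and>
     (\<forall>t. \<beta> \<le> t \<and> t \<le> pi/2 - \<beta> \<longrightarrow> Gamma x t = {Pt_x, Pt_A, Pt_B, Pt_C, Pt_D}) \<and>
     (\<forall>t. pi/2 - \<beta> < t \<and> t < pi/2 \<longrightarrow> Gamma x t = {Pt_A, Pt_B, Pt_C})"

definition P5 :: "real \<Rightarrow> (real \<Rightarrow> plane) \<Rightarrow> bool" where
  "P5 \<beta> x \<longleftrightarrow> (\<forall>t\<in>{0<..<pi/2} - {\<beta>, pi/2 - \<beta>}. well_behaved_at x t)"

definition path_assumptions :: "real \<Rightarrow> (real \<Rightarrow> plane) \<Rightarrow> bool" where
  "path_assumptions \<beta> x \<longleftrightarrow>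
     rotation_path x \<and> unique_tangency x \<and> P1 x \<and> P2 x \<and> P3 x \<and> P4 \<beta> x \<and> P5 \<beta> x"

definition necessary_conditions :: "real \<Rightarrow> (real \<Rightarrow> plane) \<Rightarrow> bool" where
  "necessary_conditions \<beta> x \<longleftrightarrow>
     (\<forall>t. 0 < t \<and> t < \<beta> \<longrightarrow>
        (vel x has_vector_derivative
          rot t *v (vector [-1, -1/2] +
            (vector [vector [2 * sin t, - 2 * cos t],
                     vector [2 * cos t, 2 * sin t]] :: real^2^2) *v vel x t)) (at t)) \<and>
     (\<forall>t. \<beta> < t \<and> t < pi/2 - \<beta> \<longrightarrow>
        (vel x has_vector_derivative
          rot t *v (vector [-1/2, -1/2] +
            (vector [vector [3/2 * sin t, - 3/2 * cos t],
                     vector [3/2 * cos t, 3/2 * sin t]] :: real^2^2) *v vel x t)) (at t)) \<and>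
     (\<forall>t. pi/2 - \<beta> < t \<and> t < pi/2 \<longrightarrow>
        (vel x has_vector_derivative
          rot t *v (vector [-1/2, -1] +
            (vector [vector [2 * sin t, - 2 * cos t],
                     vector [2 * cos t, 2 * sin t]] :: real^2^2) *v vel x t)) (at t))"


section \<open>The explicit path and the ambidextrous shape\<close>

definition beta0 :: real where
  "beta0 = arctan (1/2 * (root 3 (sqrt 2 + 1) - root 3 (sqrt 2 - 1)))"

definition coef_a1 :: real where "coef_a1 = 1 / (4 * sin beta0)"
definition coef_a2 :: real where "coef_a2 = 0"
definition coef_e1 :: real where "coef_e1 = coef_a1"
definition coef_e2 :: real where "coef_e2 = coef_a2"

definition coef_f1 :: real where
  "coef_f1 =
     root 4 (83 + root 3 (420619 + 15104 * sqrt 2) + root 3 (420619 - 15104 * sqrt 2))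
       / (3 * sqrt (2 * (2 - sqrt 2)))"

definition coef_f2 :: real where "coef_f2 = - (sqrt 2 - 1) * coef_f1"

definition kappa1 :: plane where "kappa1 = vector [1 - coef_a1, 1/2]"
definition kappa6 :: plane where "kappa6 = vector [1 - 4/3 * coef_a1, 1/2]"
definition kappa5 :: plane where "kappa5 = vector [1 - 5/3 * coef_a1, 1/2]"

definition x1 :: "real \<Rightarrow> plane" where
  "x1 t = rot t *v vector [coef_a1 * cos t + coef_a2 * sin t - 1,
                           - coef_a2 * cos t + coef_a1 * sin t - 1/2] + kappa1"

definition x6 :: "real \<Rightarrow> plane" where
  "x6 t = rot t *v vector [coef_f1 * cos (t/2) + coef_f2 * sin (t/2) - 1,
                           - coef_f2 * cos (t/2) + coef_f1 * sin (t/2) - 1] + kappa6"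

definition x5 :: "real \<Rightarrow> plane" where
  "x5 t = rot t *v vector [coef_e1 * cos t + coef_e2 * sin t - 1/2,
                           - coef_e2 * cos t + coef_e1 * sin t - 1] + kappa5"

definition sofa_path :: "real \<Rightarrow> plane" where
  "sofa_path t = (if t < beta0 then x1 t else if t \<le> pi/2 - beta0 then x6 t else x5 t)"

definition sofa :: "plane set" where
  "sofa = shape_of sofa_path \<inter> refl_half ` shape_of sofa_path"

definition is_right_endpoint :: "plane set \<Rightarrow> plane \<Rightarrow> bool" where
  "is_right_endpoint K p \<longleftrightarrow> p \<in> K \<and> (\<forall>q\<in>K. q \<noteq> p \<longrightarrow> q$1 < p$1)"

definition is_left_endpoint :: "plane set \<Rightarrow> plane \<Rightarrow> bool" where
  "is_left_endpoint K p \<longleftrightarrow> p \<in> K \<and> (\<forall>q\<in>K. q \<noteq> p \<longrightarrow> p$1 < q$1)"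

end

theory Submission
  imports Defs
begin

text \<open>
  Let \<open>p\<close> and \<open>q\<close> be the components of the velocity of a path along \<open>mu t\<close> and \<open>nu t\<close>. A point \<open>P\<close> belongs to the
  shape iff at each time \<open>t\<close> its coordinates \<open>(P - x t) \<bullet> mu t\<close> and \<open>(P - x t) \<bullet> nu t\<close> are at most \<open>1\<close> and not
  both negative. A contact point with a wall makes one of these coordinates stationary, which
  yields the formulas for the contact paths and shows that a wall never has two tangency points
  (\<open>P1_unique_tangency\<close>).

  In the moving frame the necessary conditions say that \<open>B\<close> moves with velocity \<open>rate_B nu\<close> and \<open>D\<close> with
  velocity \<open>rate_D mu\<close>, whereas \<open>A\<close> and \<open>C\<close> have velocities \<open>(1 + rate_B) nu\<close> and \<open>(rate_D - 1) mu\<close>. The rates have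
  the signs that the good behaviour of the path demands. The geometry rests on one consequence
  (\<open>nu_curve_support\<close>): for fixed \<open>s\<close> the function \<open>t \<mapsto> B t \<bullet> mu s\<close> has derivative \<open>rate_B * sin (s - t)\<close>, so that it
  is least at \<open>t = s\<close>. Hence \<open>B\<close> never passes behind an inner wall of any moved hallway, and similarly \<open>A\<close>
  never passes an outer wall. The mirror symmetry of the path gives the same for \<open>C\<close> and \<open>D\<close>. The corner in
  the middle phase lies beyond \<open>B\<close> as seen from later times and beyond \<open>D\<close> as seen from earlier times
  (\<open>above_corner_in_shape\<close>). Thus all contact points that the phases require belong to the shape. The
  other contacts are excluded by the signs of \<open>p\<close> and \<open>q\<close>.

  For the uniqueness, \<open>(p, q)\<close> is a harmonic oscillator in each phase, and the initial conditions and
  the mirror symmetry leave one parameter. It is fixed by \<open>p \<beta> = 0\<close> at the critical angle. A positive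
  value contradicts the good behaviour in the middle phase. If the value were negative, then \<open>B\<close>
  would touch the shape already before \<open>\<beta>\<close> (\<open>candidate_p_not_neg\<close>). The condition \<open>p \<beta> = 0\<close> amounts to
  \<open>4 T^3 + 3 T = 1\<close> for \<open>T = tan \<beta>\<close>.

  The removed quadrants, and the half-planes under the outer walls, are closed under moving
  downwards. So every vertical line meets the ambidextrous shape in a segment centred on the line
  \<open>y = 1/2\<close>, and its length can be read off from the curve on the line: \<open>A\<close> in the lobes, \<open>B\<close> or the corner in
  the middle. This shows connectedness and the endpoints. The area is the integral of the column
  length, computed by substitution along these curves. Its value, and all other constants, are
  expressed by \<open>z0 = 1 / T\<close>, where \<open>z0^3 = 3 z0^2 + 4\<close>, and the radicals arise by solving cubics.

  The three pieces of the path are numbered as in \<open>x1\<close>, \<open>x6\<close>, \<open>x5\<close>, and phases \<open>1\<close>, \<open>6\<close>, \<open>5\<close> refer to them.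
\<close>

section \<open>The moving frame and the points of the shape\<close>

lemma inner_plane: "P \<bullet> Q = P$1 * Q$1 + P$2 * Q$2" for P Q :: plane
  by (simp add: inner_vec_def sum_2)

lemma plane_eq_iff: "P = Q \<longleftrightarrow> P$1 = Q$1 \<and> P$2 = Q$2" for P Q :: plane
  by (auto simp: vec_eq_iff forall_2)

lemma mu_nth [simp]: "mu t $ 1 = cos t" "mu t $ 2 = sin t"
  by (simp_all add: mu_def)

lemma nu_nth [simp]: "nu t $ 1 = - sin t" "nu t $ 2 = cos t"
  by (simp_all add: nu_def)

lemma rot_mult: "rot t *v P = P$1 *\<^sub>R mu t + P$2 *\<^sub>R nu t"
  by (simp add: rot_def plane_eq_iff matrix_vector_mult_def sum_2 algebra_simps)

lemma frame_inner:
  "mu s \<bullet> mu t = cos (s - t)" "nu s \<bullet> nu t = cos (s - t)"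
  "nu s \<bullet> mu t = sin (t - s)" "mu s \<bullet> nu t = sin (s - t)"
  by (simp_all add: inner_plane cos_diff sin_diff algebra_simps)

lemma rot_mult_inner: "(rot t *v P) \<bullet> mu t = P$1" "(rot t *v P) \<bullet> nu t = P$2"
  by (simp_all add: rot_mult inner_add_left frame_inner)

lemma matrix2_mult:
  "(vector [vector [a, b], vector [c, d]] :: real^2^2) *v P = vector [a * P$1 + b * P$2, c * P$1 + d * P$2]"
  by (simp add: plane_eq_iff matrix_vector_mult_def sum_2)

lemma frame_expand: "P = (P \<bullet> mu t) *\<^sub>R mu t + (P \<bullet> nu t) *\<^sub>R nu t"
proof -
  have "cos t * (cos t * c) + sin t * (sin t * c) = c" for c
    using sin_cos_squared_add2[of t] by (simp flip: distrib_right mult.assoc)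
  from this[of "P$1"] this[of "P$2"] show ?thesis
    by (simp add: plane_eq_iff inner_plane algebra_simps)
qed

lemma frame_eqI: "P \<bullet> mu t = Q \<bullet> mu t \<Longrightarrow> P \<bullet> nu t = Q \<bullet> nu t \<Longrightarrow> P = Q"
  by (metis frame_expand)

lemma frame_flip: "mu (pi/2 - t) = vector [sin t, cos t]" "nu (pi/2 - t) = vector [- cos t, sin t]"
  by (simp_all add: plane_eq_iff sin_diff cos_diff)

lemma has_vector_derivative_mu [derivative_intros]: "(mu has_vector_derivative nu t) (at t within S)"
proof -
  have mu: "mu = (\<lambda>t. cos t *\<^sub>R axis 1 1 + sin t *\<^sub>R axis 2 1)"
    by (rule ext) (simp add: plane_eq_iff axis_def)
  have nu: "nu t = (- sin t) *\<^sub>R axis 1 1 + cos t *\<^sub>R axis 2 1"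
    by (simp add: plane_eq_iff axis_def)
  show ?thesis unfolding mu nu
    by (auto intro!: derivative_eq_intros)
qed

lemma has_vector_derivative_nu [derivative_intros]: "(nu has_vector_derivative - mu t) (at t within S)"
proof -
  have nu: "nu = (\<lambda>t. (- sin t) *\<^sub>R axis 1 1 + cos t *\<^sub>R axis 2 1)"
    by (rule ext) (simp add: plane_eq_iff axis_def)
  have mu: "- mu t = (- cos t) *\<^sub>R axis 1 1 + (- sin t) *\<^sub>R axis 2 1"
    by (simp add: plane_eq_iff axis_def)
  show ?thesis unfolding mu nu
    by (auto intro!: derivative_eq_intros)
qed

lemma continuous_on_mu [continuous_intros]: "continuous_on S mu"
  by (meson continuous_on_eq_continuous_within has_vector_derivative_continuous has_vector_derivative_mu)

lemma continuous_on_nu [continuous_intros]: "continuous_on S nu"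
  by (meson continuous_on_eq_continuous_within has_vector_derivative_continuous has_vector_derivative_nu)

lemma continuous_on_vector2 [continuous_intros]:
  assumes "continuous_on S f" "continuous_on S g"
  shows "continuous_on S (\<lambda>s. vector [f s, g s] :: plane)"
proof -
  have "(vector [f s, g s] :: plane) = f s *\<^sub>R axis 1 1 + g s *\<^sub>R axis 2 1" for s
    by (simp add: plane_eq_iff axis_def)
  then show ?thesis by (simp add: assms continuous_on_add continuous_on_scaleR)
qed

lemma has_field_derivative_inner:
  fixes f g :: "real \<Rightarrow> plane"
  assumes "(f has_vector_derivative f') (at t within S)" "(g has_vector_derivative g') (at t within S)"
  shows "((\<lambda>s. f s \<bullet> g s) has_field_derivative (f' \<bullet> g t + f t \<bullet> g')) (at t within S)"
  using bounded_bilinear.has_vector_derivative[OF bounded_bilinear_inner assms]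
  by (simp add: has_real_derivative_iff_has_vector_derivative add.commute)

lemma has_real_derivative_nth:
  assumes "(Z has_vector_derivative (v :: plane)) (at t within S)"
  shows "((\<lambda>s. Z s $ i) has_real_derivative v $ i) (at t within S)"
  using bounded_linear.has_vector_derivative[OF bounded_linear_vec_nth assms, of i]
  by (simp add: has_real_derivative_iff_has_vector_derivative)

lemma has_vector_derivative_frame:
  assumes "(f has_field_derivative f') (at t within S)" "(g has_field_derivative g') (at t within S)"
  shows "((\<lambda>s. f s *\<^sub>R mu s + g s *\<^sub>R nu s) has_vector_derivative
     ((f' - g t) *\<^sub>R mu t + (g' + f t) *\<^sub>R nu t)) (at t within S)"
  by (rule derivative_eq_intros assms refl | simp add: algebra_simps)+

lemma rigid_image_iff: "P \<in> rigid t c ` W \<longleftrightarrow> vector [(P - c) \<bullet> mu t, (P - c) \<bullet> nu t] \<in> W"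
proof
  assume "P \<in> rigid t c ` W"
  then obtain Q where Q: "Q \<in> W" "P - c = Q$1 *\<^sub>R mu t + Q$2 *\<^sub>R nu t"
    by (auto simp: rigid_def rot_mult)
  have "vector [(P - c) \<bullet> mu t, (P - c) \<bullet> nu t] = Q"
    unfolding Q(2) by (simp add: plane_eq_iff inner_add_left frame_inner)
  with Q show "vector [(P - c) \<bullet> mu t, (P - c) \<bullet> nu t] \<in> W" by simp
next
  assume W: "vector [(P - c) \<bullet> mu t, (P - c) \<bullet> nu t] \<in> W"
  have "P = rigid t c (vector [(P - c) \<bullet> mu t, (P - c) \<bullet> nu t])"
    using frame_expand[of "P - c" t] by (simp add: rigid_def rot_mult algebra_simps)
  with W show "P \<in> rigid t c ` W" by blast
qed

text \<open>The hallway is the quadrant bounded by the outer walls with the open quadrant behind the inner corner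
  removed. This form separates the convex outer conditions from the single non-convex inner one.\<close>

definition in_hall :: "(real \<Rightarrow> plane) \<Rightarrow> real \<Rightarrow> plane \<Rightarrow> bool" where
  "in_hall x t P \<longleftrightarrow> (P - x t) \<bullet> mu t \<le> 1 \<and> (P - x t) \<bullet> nu t \<le> 1
     \<and> ((P - x t) \<bullet> mu t \<ge> 0 \<or> (P - x t) \<bullet> nu t \<ge> 0)"

lemma in_hall_iff: "P \<in> rigid t (x t) ` L_hall \<longleftrightarrow> in_hall x t P"
  by (auto simp: rigid_image_iff L_hall_def L_horiz_def L_vert_def in_hall_def)

lemma mem_shape_of:
  "P \<in> shape_of x \<longleftrightarrow> P$1 \<le> 1 \<and> 0 \<le> P$2 \<and> P$2 \<le> 1 \<and> (\<forall>t\<in>{0..pi/2}. in_hall x t P)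
     \<and> P$1 \<ge> x (pi/2) $ 1 - 1 \<and> x (pi/2) $ 2 \<le> P$2 \<and> P$2 \<le> x (pi/2) $ 2 + 1"
proof -
  have "P \<in> rigid (pi/2) (x (pi/2)) ` L_vert \<longleftrightarrow>
      P$1 \<ge> x (pi/2) $ 1 - 1 \<and> x (pi/2) $ 2 \<le> P$2 \<and> P$2 \<le> x (pi/2) $ 2 + 1"
    unfolding rigid_image_iff by (auto simp: L_vert_def inner_plane)
  moreover have "P \<in> (\<Inter>t\<in>{0..pi/2}. rigid t (x t) ` L_hall) \<longleftrightarrow> (\<forall>t\<in>{0..pi/2}. in_hall x t P)"
    by (simp add: in_hall_iff)
  ultimately show ?thesis
    unfolding shape_of_def by (simp add: L_horiz_def conj_assoc)
qed

lemma shape_hall: "P \<in> shape_of x \<Longrightarrow> s \<in> {0..pi/2} \<Longrightarrow> in_hall x s P"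
  by (simp add: mem_shape_of)

lemma vel_eq:
  assumes "(x has_vector_derivative v) (at t within {0..pi/2})" "t \<in> {0..pi/2}"
  shows "vel x t = v"
  using vector_derivative_within_cbox[where a=0 and b="pi/2" and f=x and f'=v and x=t] assms pi_gt_zero
  by (simp add: vel_def cbox_interval)

lemma P1_has_vel_within:
  assumes "P1 x" "t \<in> {0..pi/2}"
  shows "(x has_vector_derivative vel x t) (at t within {0..pi/2})"
  using assms unfolding P1_def vel_def by (simp add: vector_derivative_works)

lemma P1_has_vel:
  assumes "P1 x" "t \<in> {0<..<pi/2}"
  shows "(x has_vector_derivative vel x t) (at t)"
  using P1_has_vel_within[OF assms(1), of t] assms(2)
  by (simp add: at_within_Icc_at)

lemma path_inner:
  "(path_A x t - x t) \<bullet> mu t = 1" "(path_A x t - x t) \<bullet> nu t = vel x t \<bullet> mu t"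
  "(path_B x t - x t) \<bullet> mu t = 0" "(path_B x t - x t) \<bullet> nu t = vel x t \<bullet> mu t"
  "(path_C x t - x t) \<bullet> mu t = - (vel x t \<bullet> nu t)" "(path_C x t - x t) \<bullet> nu t = 1"
  "(path_D x t - x t) \<bullet> mu t = - (vel x t \<bullet> nu t)" "(path_D x t - x t) \<bullet> nu t = 0"
  by (simp_all add: path_A_def path_B_def path_C_def path_D_def inner_add_left inner_diff_left frame_inner)

lemma P1_continuous:
  assumes "P1 x"
  shows "continuous_on {0..pi/2} x"
  using P1_has_vel_within[OF assms] has_vector_derivative_continuous continuous_on_eq_continuous_within
  by blast

lemma P1_continuous_vel: "P1 x \<Longrightarrow> continuous_on {0..pi/2} (vel x)"
  by (simp add: P1_def)

lemma P1_continuous_path_A: "P1 x \<Longrightarrow> continuous_on {0..pi/2} (path_A x)"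
  unfolding path_A_def[abs_def]
  by (intro continuous_intros P1_continuous P1_continuous_vel)

lemma P1_continuous_path_B: "P1 x \<Longrightarrow> continuous_on {0..pi/2} (path_B x)"
  unfolding path_B_def[abs_def]
  by (intro continuous_intros P1_continuous P1_continuous_vel)

lemma P1_continuous_path_D: "P1 x \<Longrightarrow> continuous_on {0..pi/2} (path_D x)"
  unfolding path_D_def[abs_def]
  by (intro continuous_intros P1_continuous P1_continuous_vel)

section \<open>Contact points are stationary points\<close>

text \<open>A fixed point has these velocities in the coordinates of the moving hallway; all statements about
  walls below are statements about the extrema of these two functions.\<close>

lemma corner_coord_deriv:
  assumes "(x has_vector_derivative v) (at t)"
  shows "((\<lambda>s. (P - x s) \<bullet> mu s) has_field_derivative ((P - x t) \<bullet> nu t - v \<bullet> mu t)) (at t)"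
    and "((\<lambda>s. (P - x s) \<bullet> nu s) has_field_derivative (- ((P - x t) \<bullet> mu t) - v \<bullet> nu t)) (at t)"
proof -
  have d: "((\<lambda>s. P - x s) has_vector_derivative - v) (at t)"
    using assms by (auto intro!: derivative_eq_intros)
  show "((\<lambda>s. (P - x s) \<bullet> mu s) has_field_derivative ((P - x t) \<bullet> nu t - v \<bullet> mu t)) (at t)"
    using has_field_derivative_inner[OF d has_vector_derivative_mu] by simp
  show "((\<lambda>s. (P - x s) \<bullet> nu s) has_field_derivative (- ((P - x t) \<bullet> mu t) - v \<bullet> nu t)) (at t)"
    using has_field_derivative_inner[OF d has_vector_derivative_nu] by (simp add: algebra_simps)
qed

text \<open>As \<open>n t < 0\<close>, the point stays behind the other inner wall for nearby times, so membership in the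
  hallways forces \<open>m \<ge> 0\<close> there, and \<open>m\<close> has a local minimum at \<open>t\<close>.\<close>

lemma inner_wall_stationary:
  fixes m n :: "real \<Rightarrow> real"
  assumes m: "(m has_field_derivative m') (at t)" and n: "(n has_field_derivative n') (at t)"
    and out: "\<forall>s\<in>{a<..<b}. m s \<ge> 0 \<or> n s \<ge> 0" and t: "t \<in> {a<..<b}"
    and mt: "m t = 0" and nt: "n t < 0"
  shows "m' = 0"
proof -
  have "isCont n t" using n by (rule DERIV_isCont)
  then have "\<forall>\<^sub>F s in nhds t. n s < 0"
    using nt by (auto simp: isCont_def tendsto_at_iff_tendsto_nhds dest: order_tendstoD(2))
  moreover have "\<forall>\<^sub>F s in nhds t. s \<in> {a<..<b}"
    using t by (intro eventually_nhds_in_open) auto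
  ultimately have "\<forall>\<^sub>F s in nhds t. m s \<ge> 0"
    by eventually_elim (use out in force)
  then obtain d where "d > 0" "\<forall>s. dist s t < d \<longrightarrow> m s \<ge> 0"
    by (auto simp: eventually_nhds_metric)
  then show ?thesis
    using DERIV_local_min[OF m, of d] mt by (simp add: dist_real_def abs_minus_commute)
qed

lemma outer_wall_stationary:
  fixes m :: "real \<Rightarrow> real"
  assumes m: "(m has_field_derivative m') (at t)"
    and le: "\<forall>s\<in>{a<..<b}. m s \<le> c" and t: "t \<in> {a<..<b}" and mt: "m t = c"
  shows "m' = 0"
proof -
  have "\<forall>\<^sub>F s in nhds t. s \<in> {a<..<b}"
    using t by (intro eventually_nhds_in_open) auto
  then have "\<forall>\<^sub>F s in nhds t. m s \<le> c"
    by eventually_elim (use le in force)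
  then obtain d where "d > 0" "\<forall>s. dist s t < d \<longrightarrow> m s \<le> c"
    by (auto simp: eventually_nhds_metric)
  then show ?thesis
    using DERIV_local_max[OF m, of d] mt by (simp add: dist_real_def abs_minus_commute)
qed

context
  fixes x :: "real \<Rightarrow> plane" and t :: real
  assumes P1: "P1 x" and t: "t \<in> {0<..<pi/2}"
begin

text \<open>The coordinate \<open>(P - x s) \<bullet> mu s\<close> is maximal at \<open>s = t\<close>, and the vanishing of its derivative there is the
  formula for the contact path \<open>A\<close>. The three lemmas after this one treat the other walls alike.\<close>

lemma contact_A_eq:
  assumes "P \<in> shape_of x \<inter> wall_A x t"
  shows "P = path_A x t"
proof -
  note d = corner_coord_deriv[OF P1_has_vel[OF P1 t], of P]
  have 1: "(P - x t) \<bullet> mu t = 1" using assms by (simp add: wall_A_def inner_diff_left)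
  have "\<forall>s\<in>{0<..<pi/2}. (P - x s) \<bullet> mu s \<le> 1"
    using shape_hall[of P] assms by (auto simp: in_hall_def)
  from outer_wall_stationary[OF d(1) this t 1]
  have "(P - x t) \<bullet> nu t = vel x t \<bullet> mu t" by simp
  then show ?thesis
    using 1 by (intro frame_eqI[of _ t]) (use path_inner[of x t] in \<open>simp_all add: inner_diff_left\<close>)
qed

lemma contact_C_eq:
  assumes "P \<in> shape_of x \<inter> wall_C x t"
  shows "P = path_C x t"
proof -
  note d = corner_coord_deriv[OF P1_has_vel[OF P1 t], of P]
  have 1: "(P - x t) \<bullet> nu t = 1" using assms by (simp add: wall_C_def inner_diff_left)
  have "\<forall>s\<in>{0<..<pi/2}. (P - x s) \<bullet> nu s \<le> 1"
    using shape_hall[of P] assms by (auto simp: in_hall_def)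
  from outer_wall_stationary[OF d(2) this t 1]
  have "(P - x t) \<bullet> mu t = - (vel x t \<bullet> nu t)" by simp
  then show ?thesis
    using 1 by (intro frame_eqI[of _ t]) (use path_inner[of x t] in \<open>simp_all add: inner_diff_left\<close>)
qed

lemma off_corner_B:
  assumes "P \<in> inner_off_corner wall_B x t"
  shows "P = path_B x t \<and> vel x t \<bullet> mu t < 0"
proof -
  note d = corner_coord_deriv[OF P1_has_vel[OF P1 t], of P]
  have P: "P \<in> shape_of x" "P \<noteq> x t" and 1: "(P - x t) \<bullet> mu t = 0" and 2: "(P - x t) \<bullet> nu t \<le> 0"
    using assms by (auto simp: inner_off_corner_def wall_B_def inner_diff_left)
  have 3: "(P - x t) \<bullet> nu t < 0"
  proof (rule ccontr)
    assume "\<not> ?thesis"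
    with 1 2 have "P - x t = 0" by (intro frame_eqI[of _ t]) auto
    with P show False by simp
  qed
  have "\<forall>s\<in>{0<..<pi/2}. (P - x s) \<bullet> mu s \<ge> 0 \<or> (P - x s) \<bullet> nu s \<ge> 0"
    using shape_hall[of P] P by (auto simp: in_hall_def)
  from inner_wall_stationary[OF d this t 1 3]
  have "(P - x t) \<bullet> nu t = vel x t \<bullet> mu t" by simp
  then show ?thesis
    using 1 3 by (auto intro!: frame_eqI[of _ t]) (use path_inner[of x t] in \<open>simp_all add: inner_diff_left\<close>)
qed

lemma off_corner_D:
  assumes "P \<in> inner_off_corner wall_D x t"
  shows "P = path_D x t \<and> vel x t \<bullet> nu t > 0"
proof -
  note d = corner_coord_deriv[OF P1_has_vel[OF P1 t], of P]
  have P: "P \<in> shape_of x" "P \<noteq> x t" and 1: "(P - x t) \<bullet> nu t = 0" and 2: "(P - x t) \<bullet> mu t \<le> 0"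
    using assms by (auto simp: inner_off_corner_def wall_D_def inner_diff_left)
  have 3: "(P - x t) \<bullet> mu t < 0"
  proof (rule ccontr)
    assume "\<not> ?thesis"
    with 1 2 have "P - x t = 0" by (intro frame_eqI[of _ t]) auto
    with P show False by simp
  qed
  have "\<forall>s\<in>{0<..<pi/2}. (P - x s) \<bullet> nu s \<ge> 0 \<or> (P - x s) \<bullet> mu s \<ge> 0"
    using shape_hall[of P] P unfolding in_hall_def
    by (metis atLeastAtMost_iff greaterThanLessThan_iff less_imp_le)
  from inner_wall_stationary[OF d(2,1) this t 1 3]
  have "(P - x t) \<bullet> mu t = - (vel x t \<bullet> nu t)" by simp
  then show ?thesis
    using 1 3 by (auto intro!: frame_eqI[of _ t]) (use path_inner[of x t] in \<open>simp_all add: inner_diff_left\<close>)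
qed

text \<open>If every tangency point off the corner lies on the continuous curve \<open>Z\<close>, then a family of them that
  converges to the corner also converges to \<open>Z t\<close>.\<close>

lemma path_meets_corner_eq:
  assumes meet: "path_meets_corner W x t"
    and off: "\<And>s P. s \<in> {0<..<pi/2} \<Longrightarrow> P \<in> inner_off_corner W x s \<Longrightarrow> P = Z s"
    and Z: "continuous_on {0..pi/2} Z"
  shows "Z t = x t"
proof -
  obtain F q where F: "F \<in> {at_left t, at_right t}"
    and q: "\<forall>\<^sub>F s in F. q s \<in> inner_off_corner W x s" "(q \<longlongrightarrow> x t) F"
    using meet unfolding path_meets_corner_def by blast
  have "continuous_on {0<..<pi/2} Z"
    using Z by (rule continuous_on_subset) auto
  then have "isCont Z t"
    using t by (simp add: continuous_on_eq_continuous_at)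
  then have "(Z \<longlongrightarrow> Z t) (at t)"
    by (simp add: isCont_def)
  have le: "F \<le> at t" using F by (auto intro: at_le)
  have Zt: "(Z \<longlongrightarrow> Z t) F"
    by (rule tendsto_mono[OF le]) fact
  have "\<forall>\<^sub>F s in at t. s \<in> {0<..<pi/2}"
    using t by (intro eventually_at_in_open') auto
  then have "\<forall>\<^sub>F s in F. s \<in> {0<..<pi/2}"
    using le by (meson filter_leD)
  with q(1) have "\<forall>\<^sub>F s in F. q s = Z s"
    by eventually_elim (use off in blast)
  with q(2) have "(Z \<longlongrightarrow> x t) F"
    by (rule Lim_transform_eventually)
  moreover have "F \<noteq> bot"
    using F by (metis trivial_limit_at_left_real trivial_limit_at_right_real empty_iff insert_iff)
  ultimately show ?thesis using Zt tendsto_unique by blast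
qed

end

lemma tangency_B:
  assumes "P1 x" "t \<in> {0<..<pi/2}" "P \<in> inner_tangency wall_B x t"
  shows "P = path_B x t \<and> vel x t \<bullet> mu t \<le> 0"
proof (cases "P \<in> inner_off_corner wall_B x t")
  case True
  then show ?thesis using off_corner_B[OF assms(1,2)] by force
next
  case False
  then have P: "P = x t" and meet: "path_meets_corner wall_B x t"
    using assms(3) by (auto simp: inner_tangency_def)
  have "path_B x t = x t"
    by (rule path_meets_corner_eq[OF assms(1,2) meet])
       (use off_corner_B[OF assms(1)] P1_continuous_path_B[OF assms(1)] in blast)+
  then show ?thesis using P path_inner(4)[of x t] by simp
qed

lemma tangency_D:
  assumes "P1 x" "t \<in> {0<..<pi/2}" "P \<in> inner_tangency wall_D x t"
  shows "P = path_D x t \<and> vel x t \<bullet> nu t \<ge> 0"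
proof (cases "P \<in> inner_off_corner wall_D x t")
  case True
  then show ?thesis using off_corner_D[OF assms(1,2)] by force
next
  case False
  then have P: "P = x t" and meet: "path_meets_corner wall_D x t"
    using assms(3) by (auto simp: inner_tangency_def)
  have "path_D x t = x t"
    by (rule path_meets_corner_eq[OF assms(1,2) meet])
       (use off_corner_D[OF assms(1)] P1_continuous_path_D[OF assms(1)] in blast)+
  then show ?thesis using P path_inner(7)[of x t] by simp
qed

text \<open>Stationarity leaves each wall only the point given by its contact path, so a continuously
  differentiable path can never have two tangency points on one wall.\<close>

lemma P1_unique_tangency:
  assumes "P1 x"
  shows "unique_tangency x"
  unfolding unique_tangency_def
proof (intro ballI)
  fix t k P Q
  assume t: "t \<in> {0<..<pi/2}" and k: "k \<in> {Pt_A, Pt_B, Pt_C, Pt_D}"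
    and PQ: "P \<in> contact_points x t k" "Q \<in> contact_points x t k"
  show "P = Q"
    using k PQ contact_A_eq[OF assms t] contact_C_eq[OF assms t] tangency_B[OF assms t] tangency_D[OF assms t]
    by auto blast+
qed

text \<open>When the corner advances along both axes of its frame, its old position \<open>x t\<close> falls into the
  removed quadrant of the hallways just after \<open>t\<close>; when it retreats along both, of those just before.\<close>

lemma corner_not_in_shape:
  assumes "P1 x" and t: "t \<in> {0<..<pi/2}"
    and "(vel x t \<bullet> mu t > 0 \<and> vel x t \<bullet> nu t > 0) \<or> (vel x t \<bullet> mu t < 0 \<and> vel x t \<bullet> nu t < 0)"
  shows "x t \<notin> shape_of x"
proof
  assume S: "x t \<in> shape_of x"
  note d = corner_coord_deriv[OF P1_has_vel[OF assms(1) t], of "x t"]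
  have hall: "(x t - x s) \<bullet> mu s \<ge> 0 \<or> (x t - x s) \<bullet> nu s \<ge> 0" if "s \<in> {0<..<pi/2}" for s
    using S that by (auto simp: mem_shape_of in_hall_def)
  from assms(3) show False
  proof
    assume pos: "vel x t \<bullet> mu t > 0 \<and> vel x t \<bullet> nu t > 0"
    obtain d1 where d1: "d1 > 0" "\<And>h. 0 < h \<Longrightarrow> h < d1 \<Longrightarrow> (x t - x (t + h)) \<bullet> mu (t + h) < 0"
      using DERIV_neg_dec_right[OF d(1)] pos by force
    obtain d2 where d2: "d2 > 0" "\<And>h. 0 < h \<Longrightarrow> h < d2 \<Longrightarrow> (x t - x (t + h)) \<bullet> nu (t + h) < 0"
      using DERIV_neg_dec_right[OF d(2)] pos by force
    \<comment> \<open>a time step small enough for both signs and for staying inside the time interval\<close>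
    define h where "h = min (min d1 d2) (pi/2 - t) / 2"
    have "0 < h" "h < d1" "h < d2" "h < pi/2 - t" using d1 d2 t by (auto simp: h_def min_def)
    then show False using d1(2)[of h] d2(2)[of h] hall[of "t + h"] t by force
  next
    assume neg: "vel x t \<bullet> mu t < 0 \<and> vel x t \<bullet> nu t < 0"
    obtain d1 where d1: "d1 > 0" "\<And>h. 0 < h \<Longrightarrow> h < d1 \<Longrightarrow> (x t - x (t - h)) \<bullet> mu (t - h) < 0"
      using DERIV_pos_inc_left[OF d(1)] neg by force
    obtain d2 where d2: "d2 > 0" "\<And>h. 0 < h \<Longrightarrow> h < d2 \<Longrightarrow> (x t - x (t - h)) \<bullet> nu (t - h) < 0"
      using DERIV_pos_inc_left[OF d(2)] neg by force
    define h where "h = min (min d1 d2) t / 2"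
    have "0 < h" "h < d1" "h < d2" "h < t" using d1 d2 t by (auto simp: h_def min_def)
    then show False using d1(2)[of h] d2(2)[of h] hall[of "t - h"] t by force
  qed
qed

section \<open>The motion of the contact points\<close>

text \<open>The derivatives of the contact paths are only known away from the transition times, whereas
  their continuity holds throughout.\<close>

lemma nondecreasing_off_finite:
  fixes f :: "real \<Rightarrow> real"
  assumes "finite F" "continuous_on {a..b} f" "a \<le> b"
    and "\<And>s. s \<in> {a<..<b} - F \<Longrightarrow> (f has_real_derivative f' s) (at s) \<and> f' s \<ge> 0"
  shows "f a \<le> f b"
  using assms
proof (induction F arbitrary: a b rule: finite_induct)
  case empty
  show ?case
  proof (cases "a = b")
    case False
    have "\<exists>l z. a < z \<and> z < b \<and> DERIV f z :> l \<and> f b - f a = (b - a) * l"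
      by (rule MVT) (use empty False in \<open>auto simp: real_differentiable_def intro: exI\<close>)
    then obtain l z where z: "a < z" "z < b" "DERIV f z :> l" "f b - f a = (b - a) * l" by blast
    then have "l \<ge> 0" using empty(3)[of z] DERIV_unique by fastforce
    then show ?thesis using z empty by (metis diff_ge_0_iff_ge mult_nonneg_nonneg)
  qed simp
next
  case (insert c F)
  show ?case
  proof (cases "c \<in> {a<..<b}")
    case True
    have "f a \<le> f c"
      by (rule insert.IH) (use insert.prems True in \<open>auto intro: continuous_on_subset\<close>)
    also have "f c \<le> f b"
      by (rule insert.IH) (use insert.prems True in \<open>auto intro: continuous_on_subset\<close>)
    finally show ?thesis .
  next
    case False
    show ?thesis
      by (rule insert.IH) (use insert.prems False in auto)
  qed
qed

lemma constant_off_finite: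
  fixes f :: "real \<Rightarrow> real"
  assumes "finite F" "continuous_on {a..b} f" "a \<le> b"
    and "\<And>s. s \<in> {a<..<b} - F \<Longrightarrow> (f has_real_derivative 0) (at s)"
  shows "f b = f a"
proof (rule antisym)
  show "f a \<le> f b"
    by (rule nondecreasing_off_finite[OF assms(1-3), of "\<lambda>_. 0"]) (use assms(4) in auto)
  have "- f a \<le> - f b"
    by (rule nondecreasing_off_finite[OF assms(1) _ assms(3), of _ "\<lambda>_. 0"])
       (use assms(2,4) in \<open>auto intro!: continuous_intros derivative_eq_intros\<close>)
  then show "f b \<le> f a" by simp
qed

text \<open>The function \<open>u \<mapsto> Z u \<bullet> mu s\<close> has derivative \<open>r u * sin (s - u)\<close>, hence decreases up to \<open>u = s\<close> and
  increases afterwards. For the contact path \<open>B\<close> this says that no \<open>B t\<close> lies behind the inner wall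
  at any other time \<open>s\<close>, although the two times may be far apart. This is the fact that makes
  membership in the shape provable without case distinctions between the phases.\<close>

lemma nu_curve_support:
  fixes Z :: "real \<Rightarrow> plane"
  assumes F: "finite F" and Z: "continuous_on {0..pi/2} Z"
    and d: "\<And>s. s \<in> {0<..<pi/2} - F \<Longrightarrow> (Z has_vector_derivative r s *\<^sub>R nu s) (at s) \<and> r s \<le> 0"
    and s: "s \<in> {0..pi/2}" and t: "t \<in> {0..pi/2}"
  shows "Z s \<bullet> mu s \<le> Z t \<bullet> mu s"
proof -
  have D: "((\<lambda>u. Z u \<bullet> mu s) has_real_derivative r u * sin (s - u)) (at u)"
    if "u \<in> {0<..<pi/2} - F" for u
    using has_field_derivative_inner[OF conjunct1[OF d[OF that]] has_vector_derivative_const, of "mu s"]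
    by (simp add: frame_inner)
  have C: "continuous_on {u..v} (\<lambda>u. Z u \<bullet> mu s)" if "0 \<le> u" "v \<le> pi/2" for u v
    by (intro continuous_intros continuous_on_subset[OF Z]) (use that in auto)
  show ?thesis
  proof (cases "s \<le> t")
    case True
    have sg: "r u * sin (s - u) \<ge> 0" if "u \<in> {s<..<t} - F" for u
    proof (rule mult_nonpos_nonpos)
      show "r u \<le> 0" using d[of u] that s t by auto
      have "sin (u - s) \<ge> 0" using that s t by (intro sin_ge_zero) auto
      then show "sin (s - u) \<le> 0" using sin_minus[of "u - s"] by simp
    qed
    show ?thesis
      by (rule nondecreasing_off_finite[OF F C True, of "\<lambda>u. r u * sin (s - u)"])
         (use s t in \<open>auto intro!: D sg\<close>)
  next
    case False
    have sg: "r u * sin (s - u) \<le> 0" if "u \<in> {t<..<s} - F" for u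
    proof (rule mult_nonpos_nonneg)
      show "r u \<le> 0" using d[of u] that s t by auto
      show "sin (s - u) \<ge> 0" using that s t by (intro sin_ge_zero) auto
    qed
    have "- (Z t \<bullet> mu s) \<le> - (Z s \<bullet> mu s)"
    proof (rule nondecreasing_off_finite[OF F, of t s _ "\<lambda>u. - (r u * sin (s - u))"])
      show "continuous_on {t..s} (\<lambda>u. - (Z u \<bullet> mu s))"
        using C[of t s] s t by (intro continuous_on_minus) auto
      show "t \<le> s" using False by simp
      fix u assume u: "u \<in> {t<..<s} - F"
      then have u': "u \<in> {0<..<pi/2} - F" using s t by auto
      show "((\<lambda>u. - (Z u \<bullet> mu s)) has_real_derivative - (r u * sin (s - u))) (at u)
          \<and> 0 \<le> - (r u * sin (s - u))"
        using DERIV_minus[OF D[OF u']] sg[OF u] by simp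
    qed
    then show ?thesis by simp
  qed
qed

lemma nu_curve_monotone:
  fixes Z :: "real \<Rightarrow> plane"
  assumes F: "finite F" and Z: "continuous_on {0..pi/2} Z"
    and d: "\<And>s. s \<in> {0<..<pi/2} - F \<Longrightarrow> (Z has_vector_derivative r s *\<^sub>R nu s) (at s) \<and> r s \<le> 0"
    and uv: "0 \<le> u" "u \<le> v" "v \<le> pi/2"
  shows "Z u $ 1 \<le> Z v $ 1" "Z v $ 2 \<le> Z u $ 2"
proof -
  have Zc: "continuous_on {u..v} Z" by (rule continuous_on_subset[OF Z]) (use uv in auto)
  show "Z u $ 1 \<le> Z v $ 1"
  proof (rule nondecreasing_off_finite[OF F _ uv(2), of _ "\<lambda>s. - (r s * sin s)"])
    show "continuous_on {u..v} (\<lambda>s. Z s $ 1)" by (intro continuous_intros Zc)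
    fix s assume s: "s \<in> {u<..<v} - F"
    have ds: "(Z has_vector_derivative r s *\<^sub>R nu s) (at s)" "r s \<le> 0"
      using d[of s] s uv by auto
    have "sin s \<ge> 0" using s uv by (intro sin_ge_zero) auto
    then show "((\<lambda>s. Z s $ 1) has_real_derivative - (r s * sin s)) (at s) \<and> 0 \<le> - (r s * sin s)"
      using has_real_derivative_nth[OF ds(1), of 1] ds(2) by (simp add: mult_nonpos_nonneg)
  qed
  have "- (Z u $ 2) \<le> - (Z v $ 2)"
  proof (rule nondecreasing_off_finite[OF F _ uv(2), of _ "\<lambda>s. - (r s * cos s)"])
    show "continuous_on {u..v} (\<lambda>s. - (Z s $ 2))" by (intro continuous_intros Zc)
    fix s assume s: "s \<in> {u<..<v} - F"
    have ds: "(Z has_vector_derivative r s *\<^sub>R nu s) (at s)" "r s \<le> 0"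
      using d[of s] s uv by auto
    have "cos s \<ge> 0" using s uv by (intro cos_ge_zero) auto
    then show "((\<lambda>s. - (Z s $ 2)) has_real_derivative - (r s * cos s)) (at s) \<and> 0 \<le> - (r s * cos s)"
      using DERIV_minus[OF has_real_derivative_nth[OF ds(1), of 2]] ds(2) by (simp add: mult_nonpos_nonneg)
  qed
  then show "Z v $ 2 \<le> Z u $ 2" by simp
qed

text \<open>The difference of \<open>B\<close> and \<open>x\<close> is \<open>(vel x \<bullet> mu) nu\<close>, and rotating \<open>nu\<close> into \<open>- mu\<close> cancels the \<open>mu\<close> component of
  the velocity. So \<open>B\<close> moves along its wall only; the same holds for \<open>D\<close>, and \<open>A\<close>, \<open>C\<close> differ from
  these two by a vector of the frame.\<close>

lemma contact_path_deriv:
  assumes x: "(x has_vector_derivative vel x t) (at t)" and v: "(vel x has_vector_derivative acc) (at t)"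
  shows "(path_B x has_vector_derivative (acc \<bullet> mu t + 2 * (vel x t \<bullet> nu t)) *\<^sub>R nu t) (at t)"
    and "(path_A x has_vector_derivative (1 + (acc \<bullet> mu t + 2 * (vel x t \<bullet> nu t))) *\<^sub>R nu t) (at t)"
    and "(path_D x has_vector_derivative (2 * (vel x t \<bullet> mu t) - acc \<bullet> nu t) *\<^sub>R mu t) (at t)"
    and "(path_C x has_vector_derivative (2 * (vel x t \<bullet> mu t) - acc \<bullet> nu t - 1) *\<^sub>R mu t) (at t)"
proof -
  note p = has_field_derivative_inner[OF v has_vector_derivative_mu]
  note q = has_field_derivative_inner[OF v has_vector_derivative_nu]
  have vel: "vel x t = (vel x t \<bullet> mu t) *\<^sub>R mu t + (vel x t \<bullet> nu t) *\<^sub>R nu t" by (rule frame_expand)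
  have "(path_B x has_vector_derivative vel x t + ((vel x t \<bullet> mu t) *\<^sub>R (- mu t)
       + (acc \<bullet> mu t + vel x t \<bullet> nu t) *\<^sub>R nu t)) (at t)"
    unfolding path_B_def[abs_def]
    by (intro has_vector_derivative_add x has_vector_derivative_scaleR p has_vector_derivative_nu)
  also have "vel x t + ((vel x t \<bullet> mu t) *\<^sub>R (- mu t) + (acc \<bullet> mu t + vel x t \<bullet> nu t) *\<^sub>R nu t)
      = (acc \<bullet> mu t + 2 * (vel x t \<bullet> nu t)) *\<^sub>R nu t"
    by (subst (1) vel) (simp add: plane_eq_iff algebra_simps)
  finally show B: "(path_B x has_vector_derivative (acc \<bullet> mu t + 2 * (vel x t \<bullet> nu t)) *\<^sub>R nu t) (at t)" .
  have "path_A x = (\<lambda>s. path_B x s + mu s)" by (auto simp: path_A_def path_B_def)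
  then show "(path_A x has_vector_derivative (1 + (acc \<bullet> mu t + 2 * (vel x t \<bullet> nu t))) *\<^sub>R nu t) (at t)"
    using has_vector_derivative_add[OF B has_vector_derivative_mu] by (simp add: algebra_simps)
  have "(path_D x has_vector_derivative vel x t - ((vel x t \<bullet> nu t) *\<^sub>R nu t
       + (acc \<bullet> nu t + vel x t \<bullet> - mu t) *\<^sub>R mu t)) (at t)"
    unfolding path_D_def[abs_def]
    by (intro has_vector_derivative_diff x has_vector_derivative_scaleR q has_vector_derivative_mu)
  also have "vel x t - ((vel x t \<bullet> nu t) *\<^sub>R nu t + (acc \<bullet> nu t + vel x t \<bullet> - mu t) *\<^sub>R mu t)
      = (2 * (vel x t \<bullet> mu t) - acc \<bullet> nu t) *\<^sub>R mu t"
    by (subst (1) vel) (simp add: plane_eq_iff algebra_simps)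
  finally show D: "(path_D x has_vector_derivative (2 * (vel x t \<bullet> mu t) - acc \<bullet> nu t) *\<^sub>R mu t) (at t)" .
  have "path_C x = (\<lambda>s. path_D x s + nu s)" by (auto simp: path_C_def path_D_def)
  then show "(path_C x has_vector_derivative (2 * (vel x t \<bullet> mu t) - acc \<bullet> nu t - 1) *\<^sub>R mu t) (at t)"
    using has_vector_derivative_add[OF D has_vector_derivative_nu] by (simp add: algebra_simps)
qed

text \<open>The signed speed of \<open>B\<close> along \<open>nu t\<close> that the necessary conditions prescribe. Since
  \<open>A = B + mu\<close> and \<open>mu\<close> has derivative \<open>nu\<close>, the path \<open>A\<close> moves at speed \<open>1 + rate_B\<close>.\<close>

definition rate_B :: "real \<Rightarrow> (real \<Rightarrow> plane) \<Rightarrow> real \<Rightarrow> real" where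
  "rate_B \<beta> x t = (if t < \<beta> then - 1 else if t \<le> pi/2 - \<beta> then (vel x t \<bullet> nu t - 1) / 2 else - 1/2)"

text \<open>The signed speed of \<open>D\<close> along \<open>mu t\<close>; as \<open>C = D + nu\<close>, the path \<open>C\<close> moves at speed \<open>rate_D - 1\<close>.\<close>

definition rate_D :: "real \<Rightarrow> (real \<Rightarrow> plane) \<Rightarrow> real \<Rightarrow> real" where
  "rate_D \<beta> x t = (if t < \<beta> then 1/2 else if t \<le> pi/2 - \<beta> then (vel x t \<bullet> mu t + 1) / 2 else 1)"

text \<open>In the moving frame the angle drops out of the necessary conditions, and the three second-order
  equations differ only in the two rates.\<close>

lemma necessary_conditions_acc:
  assumes N: "necessary_conditions \<beta> x" and b: "0 < \<beta>" "\<beta> < pi/4"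
    and t: "t \<in> {0<..<pi/2} - {\<beta>, pi/2 - \<beta>}"
  obtains acc where "(vel x has_vector_derivative acc) (at t)"
    "acc \<bullet> mu t = rate_B \<beta> x t - 2 * (vel x t \<bullet> nu t)"
    "acc \<bullet> nu t = 2 * (vel x t \<bullet> mu t) - rate_D \<beta> x t"
proof -
  consider "t < \<beta>" | "\<beta> < t" "t < pi/2 - \<beta>" | "pi/2 - \<beta> < t" using t by force
  then show thesis
  proof cases
    case 1
    have "(vel x has_vector_derivative
          rot t *v (vector [-1, -1/2] +
            (vector [vector [2 * sin t, - 2 * cos t],
                     vector [2 * cos t, 2 * sin t]] :: real^2^2) *v vel x t)) (at t)"
      using N 1 t unfolding necessary_conditions_def by auto
    then show thesis
      by (rule that; unfold rot_mult_inner matrix2_mult)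
         (use 1 in \<open>simp_all add: rate_B_def rate_D_def inner_plane algebra_simps\<close>)
  next
    case 2
    have "(vel x has_vector_derivative
          rot t *v (vector [-1/2, -1/2] +
            (vector [vector [3/2 * sin t, - 3/2 * cos t],
                     vector [3/2 * cos t, 3/2 * sin t]] :: real^2^2) *v vel x t)) (at t)"
      using N 2 t unfolding necessary_conditions_def by auto
    then show thesis
      by (rule that; unfold rot_mult_inner matrix2_mult)
         (use 2 in \<open>simp_all add: rate_B_def rate_D_def inner_plane field_simps\<close>)
  next
    case 3
    have "(vel x has_vector_derivative
          rot t *v (vector [-1/2, -1] +
            (vector [vector [2 * sin t, - 2 * cos t],
                     vector [2 * cos t, 2 * sin t]] :: real^2^2) *v vel x t)) (at t)"
      using N 3 t unfolding necessary_conditions_def by auto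
    then show thesis
      by (rule that; unfold rot_mult_inner matrix2_mult)
         (use 3 b in \<open>simp_all add: rate_B_def rate_D_def inner_plane algebra_simps\<close>)
  qed
qed

lemma contact_path_rates:
  assumes "P1 x" "necessary_conditions \<beta> x" "0 < \<beta>" "\<beta> < pi/4"
    and t: "t \<in> {0<..<pi/2} - {\<beta>, pi/2 - \<beta>}"
  shows "(path_A x has_vector_derivative (1 + rate_B \<beta> x t) *\<^sub>R nu t) (at t)"
    and "(path_B x has_vector_derivative rate_B \<beta> x t *\<^sub>R nu t) (at t)"
    and "(path_C x has_vector_derivative (rate_D \<beta> x t - 1) *\<^sub>R mu t) (at t)"
    and "(path_D x has_vector_derivative rate_D \<beta> x t *\<^sub>R mu t) (at t)"
proof -
  obtain acc where acc: "(vel x has_vector_derivative acc) (at t)"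
    "acc \<bullet> mu t = rate_B \<beta> x t - 2 * (vel x t \<bullet> nu t)"
    "acc \<bullet> nu t = 2 * (vel x t \<bullet> mu t) - rate_D \<beta> x t"
    using necessary_conditions_acc[OF assms(2-5)] by blast
  have x: "(x has_vector_derivative vel x t) (at t)"
    using P1_has_vel[OF assms(1)] t by simp
  show "(path_A x has_vector_derivative (1 + rate_B \<beta> x t) *\<^sub>R nu t) (at t)"
   "(path_B x has_vector_derivative rate_B \<beta> x t *\<^sub>R nu t) (at t)"
   "(path_C x has_vector_derivative (rate_D \<beta> x t - 1) *\<^sub>R mu t) (at t)"
   "(path_D x has_vector_derivative rate_D \<beta> x t *\<^sub>R mu t) (at t)"
    using contact_path_deriv[OF x acc(1)] acc(2,3) by simp_all
qed

lemma path_B_support: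
  assumes "P1 x" "necessary_conditions \<beta> x" "0 < \<beta>" "\<beta> < pi/4"
    and r: "\<And>t. t \<in> {0<..<pi/2} - {\<beta>, pi/2 - \<beta>} \<Longrightarrow> rate_B \<beta> x t \<le> 0"
    and s: "s \<in> {0..pi/2}" and t: "t \<in> {0..pi/2}"
  shows "(path_B x t - x s) \<bullet> mu s \<ge> 0"
proof -
  have "path_B x s \<bullet> mu s \<le> path_B x t \<bullet> mu s"
    by (rule nu_curve_support[where F="{\<beta>, pi/2 - \<beta>}" and r="rate_B \<beta> x"])
       (use s t r contact_path_rates(2)[OF assms(1-4)] P1_continuous_path_B[OF assms(1)] in auto)
  then show ?thesis using path_inner(3)[of x s] by (simp add: inner_diff_left)
qed

lemma frame_velocity_deriv:
  assumes "(vel x has_vector_derivative acc) (at t)"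
  shows "((\<lambda>s. vel x s \<bullet> mu s) has_real_derivative (acc \<bullet> mu t + vel x t \<bullet> nu t)) (at t)"
    and "((\<lambda>s. vel x s \<bullet> nu s) has_real_derivative (acc \<bullet> nu t - vel x t \<bullet> mu t)) (at t)"
  using has_field_derivative_inner[OF assms has_vector_derivative_mu]
    has_field_derivative_inner[OF assms has_vector_derivative_nu] by simp_all

section \<open>The constants and their radicals\<close>

lemma real_root3_cubed [simp]: "root 3 a ^ 3 = a"
  by (simp add: odd_real_root_pow)

text \<open>With \<open>u\<close>, \<open>v\<close> the two cube roots, \<open>y^3 - 3 u v y - (u^3 + v^3)\<close> is \<open>y - (u + v)\<close> times a quadratic
  form, which is positive because \<open>u \<noteq> v\<close>. The nested radicals in the closed
  forms of \<open>a1\<close> and \<open>f1\<close> are such sums.\<close>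

lemma cardano:
  fixes y d n m :: real
  assumes y: "y^3 = 3 * m * y + 2 * n" and m: "root 3 (n + d) * root 3 (n - d) = m" and d: "d \<noteq> 0"
  shows "y = root 3 (n + d) + root 3 (n - d)"
proof -
  define u where "u = root 3 (n + d)"
  define v where "v = root 3 (n - d)"
  have u3: "u^3 = n + d" and v3: "v^3 = n - d" by (simp_all add: u_def v_def)
  have uv: "u \<noteq> v" using u3 v3 d by auto
  have "(y - (u + v)) * ((y + (u + v)/2)^2 + 3/4 * (u - v)^2) = y^3 - 3 * (u * v) * y - (u^3 + v^3)"
    by (simp add: power2_eq_square power3_eq_cube field_simps)
  also have "\<dots> = 0"
    using y m unfolding u3 v3 by (simp add: u_def v_def)
  finally have "y = u + v \<or> (y + (u + v)/2)^2 + 3/4 * (u - v)^2 = 0" by auto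
  moreover have "(y + (u + v)/2)^2 + 3/4 * (u - v)^2 > 0"
    using uv by (intro add_nonneg_pos) auto
  ultimately show ?thesis by (simp add: u_def v_def)
qed

lemma root3_eqI: "u^3 = a \<Longrightarrow> root 3 a = u"
  using odd_real_root_unique[of 3 u a] by simp

definition T0 :: real where "T0 = tan beta0"

lemma T0_eq: "T0 = 1/2 * (root 3 (sqrt 2 + 1) - root 3 (sqrt 2 - 1))"
  by (simp add: T0_def beta0_def tan_arctan)

lemma root3_sqrt2_prod: "root 3 (sqrt 2 + 1) * root 3 (sqrt 2 - 1) = 1"
  by (simp flip: real_root_mult) (simp add: algebra_simps)

lemma T0_cubic: "4 * T0^3 + 3 * T0 = 1"
proof -
  define r where "r = root 3 (sqrt 2 + 1)"
  define s where "s = root 3 (sqrt 2 - 1)"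
  have "r * s = 1" "r^3 = sqrt 2 + 1" "s^3 = sqrt 2 - 1"
    by (simp_all add: r_def s_def root3_sqrt2_prod)
  moreover have "T0 = 1/2 * (r - s)" by (simp add: T0_eq r_def s_def)
  ultimately show ?thesis by algebra
qed

lemma T0_unique:
  fixes T :: real
  assumes "4 * T^3 + 3 * T = 1"
  shows "T = T0"
proof -
  have "(T - T0) * (4 * (T^2 + T * T0 + T0^2) + 3) = 0"
    using assms T0_cubic by algebra
  moreover have "T^2 + T * T0 + T0^2 = (T + T0/2)^2 + 3/4 * T0^2"
    by (simp add: power2_eq_square field_simps)
  then have "4 * (T^2 + T * T0 + T0^2) + 3 > 0"
    by (simp add: add_nonneg_pos)
  ultimately show ?thesis by auto
qed

lemma T0_bounds: "29/100 < T0" "T0 < 3/10"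
proof -
  have mono: "4 * S^3 + 3 * S \<le> 4 * U^3 + 3 * U" if "S \<le> U" for S U :: real
    using that power_mono_odd[of 3 S U] by simp
  show "29/100 < T0"
    using mono[of T0 "29/100"] T0_cubic by (intro not_le_imp_less notI) (simp add: power3_eq_cube)
  show "T0 < 3/10"
    using mono[of "3/10" T0] T0_cubic by (intro not_le_imp_less notI) (simp add: power3_eq_cube)
qed

lemma beta0_pos: "0 < beta0" and beta0_less: "beta0 < pi/4"
proof -
  have b: "beta0 = arctan T0" by (simp add: beta0_def T0_eq)
  show "0 < beta0" using T0_bounds by (simp add: b)
  have "arctan T0 < arctan 1" using T0_bounds by (intro arctan_monotone) auto
  then show "beta0 < pi/4" by (simp add: b arctan_one)
qed

lemma beta0_facts: "0 < beta0" "beta0 < pi/4" "cos beta0 > 0" "sin beta0 > 0" "sin beta0 = T0 * cos beta0"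
proof -
  show "0 < beta0" "beta0 < pi/4" by (fact beta0_pos beta0_less)+
  show c: "cos beta0 > 0" using beta0_pos beta0_less by (intro cos_gt_zero) auto
  show "sin beta0 > 0" using beta0_pos beta0_less by (intro sin_gt_zero) auto
  show "sin beta0 = T0 * cos beta0" using c by (simp add: T0_def tan_def)
qed

text \<open>The squares of \<open>coef_a1\<close> and \<open>coef_F\<close> are polynomials in \<open>z0\<close>; so identities between
  radicals turn into identities modulo \<open>z0^3 = 3 z0^2 + 4\<close>.\<close>

definition z0 :: real where "z0 = 1 / T0"

lemma z0_facts: "z0 > 0" "T0 * z0 = 1" "T0 = 1 / z0" "z0^3 = 3 * z0^2 + 4" "10/3 < z0" "z0 < 100/29"
proof -
  show "z0 > 0" using T0_bounds by (simp add: z0_def)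
  show "T0 * z0 = 1" "T0 = 1/z0" using T0_bounds by (simp_all add: z0_def)
  then show "z0^3 = 3 * z0^2 + 4" using T0_cubic by algebra
  show "10/3 < z0" "z0 < 100/29" using T0_bounds by (simp_all add: z0_def field_simps)
qed

lemma sin_cos_beta0: "sin beta0 = 1 / sqrt (1 + z0^2)" "cos beta0 = z0 / sqrt (1 + z0^2)"
proof -
  have c: "cos beta0 = z0 * sin beta0"
    using beta0_facts(5) z0_facts(2) by algebra
  have "(sin beta0)^2 * (1 + z0^2) = (sin beta0)^2 + (cos beta0)^2"
    by (simp add: c power_mult_distrib algebra_simps)
  then have "(sin beta0)^2 = 1 / (1 + z0^2)"
    by (metis add_pos_nonneg eq_divide_eq less_irrefl sin_cos_squared_add zero_le_power2 zero_less_one)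
  then have "sin beta0 = sqrt (1 / (1 + z0^2))"
    using beta0_facts by (intro real_sqrt_unique[symmetric]) auto
  then show "sin beta0 = 1 / sqrt (1 + z0^2)" by (simp add: real_sqrt_divide)
  then show "cos beta0 = z0 / sqrt (1 + z0^2)" using c by simp
qed

lemma coef_a1_sqrt: "coef_a1 = sqrt (1 + z0^2) / 4"
  by (simp add: coef_a1_def sin_cos_beta0)

lemma coef_a1_facts: "coef_a1 * sin beta0 = 1/4" "coef_a1 > 0" "coef_a1 * cos beta0 = z0/4"
    "16 * coef_a1^2 = 1 + z0^2" "4/5 < coef_a1" "coef_a1 < 1"
proof -
  have s: "sqrt (1 + z0^2) > 0" by (simp add: add_pos_nonneg)
  show "coef_a1 * sin beta0 = 1/4" using beta0_facts(4) by (simp add: coef_a1_def)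
  show pos: "coef_a1 > 0" using beta0_facts(4) by (simp add: coef_a1_def)
  show "coef_a1 * cos beta0 = z0/4" using s by (simp add: coef_a1_sqrt sin_cos_beta0 field_simps)
  show sq: "16 * coef_a1^2 = 1 + z0^2"
    using s by (simp add: coef_a1_sqrt power_divide)
  have "(10/3)^2 < z0^2" "z0^2 < (100/29)^2" using z0_facts by (auto intro!: power_strict_mono)
  then have "(4/5)^2 < coef_a1^2" "coef_a1^2 < 1^2" using sq by (simp_all add: power2_eq_square)
  then show "4/5 < coef_a1" "coef_a1 < 1"
    using pos power2_less_imp_less[of "4/5" coef_a1] power2_less_imp_less[of coef_a1 1] by simp_all
qed

text \<open>The number \<open>z0^2 - 3\<close> is a root of \<open>y^3 = 51 y + 142\<close>, and \<open>71^2 - 2 * 8^2 = 17^3\<close>.\<close>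

lemma coef_a1_closed_form:
  "coef_a1 = 1/4 * sqrt (4 + root 3 (71 + 8 * sqrt 2) + root 3 (71 - 8 * sqrt 2))"
proof -
  have "z0^2 - 3 = root 3 (71 + 8 * sqrt 2) + root 3 (71 - 8 * sqrt 2)"
  proof (rule cardano)
    show "(z0^2 - 3)^3 = 3 * 17 * (z0^2 - 3) + 2 * 71"
      using z0_facts(4) by algebra
    have "(71 + 8 * sqrt 2) * (71 - 8 * sqrt 2) = (17::real)^3"
      by (simp add: algebra_simps)
    then show "root 3 (71 + 8 * sqrt 2) * root 3 (71 - 8 * sqrt 2) = 17"
      by (simp add: real_root_power_cancel odd_real_root_power_cancel flip: real_root_mult)
  qed auto
  then show ?thesis by (simp add: coef_a1_sqrt add.assoc flip: \<open>z0^2 - 3 = _\<close>)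
qed

text \<open>As \<open>f2 = - f1 tan (pi/8)\<close>, the trigonometric sums in the middle piece combine into multiples of
  \<open>cos (t/2 + pi/8)\<close> and \<open>sin (t/2 + pi/8)\<close> with this common amplitude.\<close>

definition coef_F :: real where "coef_F = coef_f1 / cos (pi/8)"

lemma sin_pi_8: "sin (pi/8) = (sqrt 2 - 1) * cos (pi/8)" and cos_pi_8_sq: "(cos (pi/8))^2 = (2 + sqrt 2) / 4"
  and cos_pi_8_pos: "cos (pi/8) > 0"
proof -
  show pos: "cos (pi/8) > 0" by (rule cos_gt_zero) auto
  have c: "cos (2 * (pi/8)) = sqrt 2 / 2" and s: "sin (2 * (pi/8)) = sqrt 2 / 2"
    using cos_45 sin_45 by (simp_all add: field_simps)
  show c2: "(cos (pi/8))^2 = (2 + sqrt 2) / 4"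
    using c unfolding cos_double_cos by (simp add: field_simps)
  have "2 * sin (pi/8) * cos (pi/8) = sqrt 2 / 2"
    using s unfolding sin_double .
  then have "sin (pi/8) * cos (pi/8) = (sqrt 2 - 1) * (cos (pi/8))^2"
    unfolding c2 by (simp add: field_simps)
  then show "sin (pi/8) = (sqrt 2 - 1) * cos (pi/8)"
    using pos by (simp add: power2_eq_square)
qed

lemma coef_f_eq: "coef_f1 = coef_F * cos (pi/8)" "coef_f2 = - (coef_F * sin (pi/8))"
  using cos_pi_8_pos by (simp_all add: coef_F_def coef_f2_def sin_pi_8 algebra_simps)

text \<open>Modulo the cubic of \<open>z0\<close>, the number \<open>(4 + z0^2)^2 - 83\<close> equals \<open>17 z0^2 + 4 z0 - 55\<close>, a root of
  \<open>y^3 = 3 * 5609 y + 2 * 420619\<close>, and \<open>420619^2 - 2 * 15104^2 = 5609^3\<close>.\<close>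

lemma coef_f1_radicand:
  "83 + root 3 (420619 + 15104 * sqrt 2) + root 3 (420619 - 15104 * sqrt 2) = (4 + z0^2)^2"
proof -
  have "(4 + z0^2)^2 - 83 = root 3 (420619 + 15104 * sqrt 2) + root 3 (420619 - 15104 * sqrt 2)"
  proof (rule cardano)
    have "(4 + z0^2)^2 - 83 = 17 * z0^2 + 4 * z0 - 55"
      using z0_facts(4) by algebra
    moreover have "(17 * z0^2 + 4 * z0 - 55)^3 = 3 * 5609 * (17 * z0^2 + 4 * z0 - 55) + 2 * 420619"
      using z0_facts(4) by algebra
    ultimately show "((4 + z0^2)^2 - 83)^3 = 3 * 5609 * ((4 + z0^2)^2 - 83) + 2 * 420619"
      by simp
    have "(420619 + 15104 * sqrt 2) * (420619 - 15104 * sqrt 2) = (5609::real)^3"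
      by (simp add: algebra_simps)
    then show "root 3 (420619 + 15104 * sqrt 2) * root 3 (420619 - 15104 * sqrt 2) = 5609"
      by (simp add: odd_real_root_power_cancel flip: real_root_mult)
  qed auto
  then show ?thesis by linarith
qed

lemma coef_F_pos: "coef_F > 0" and coef_F_sq: "coef_F^2 = (4 + z0^2) / 9"
proof -
  have r: "root 4 ((4 + z0^2)^2) = sqrt (4 + z0^2)"
  proof (rule real_root_pos_unique)
    show "sqrt (4 + z0^2) ^ 4 = (4 + z0^2)^2"
      by (simp add: power4_eq_xxxx power2_eq_square)
  qed auto
  have s2: "sqrt 2 < 2" using real_sqrt_less_mono[of 2 4] by simp
  have f1: "coef_f1 = sqrt (4 + z0^2) / (3 * sqrt (2 * (2 - sqrt 2)))"
    by (simp add: coef_f1_def coef_f1_radicand r)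
  have pos: "coef_f1 > 0"
    using s2 by (auto simp: f1 add_pos_nonneg intro!: divide_pos_pos)
  then show "coef_F > 0" using cos_pi_8_pos by (simp add: coef_F_def)
  have "coef_f1^2 = (4 + z0^2) / (9 * (2 * (2 - sqrt 2)))"
    using s2 by (simp add: f1 power_divide power_mult_distrib add_nonneg_nonneg)
  moreover have "a / (9 * (2 * u)) / (v / 4) = 4 * a / (18 * (u * v))" for a u v :: real
    by simp
  ultimately have "coef_F^2 = 4 * (4 + z0^2) / (18 * ((2 - sqrt 2) * (2 + sqrt 2)))"
    by (simp only: coef_F_def power_divide cos_pi_8_sq)
  also have "(2 - sqrt 2) * (2 + sqrt 2) = 2" by (simp add: algebra_simps)
  finally show "coef_F^2 = (4 + z0^2) / 9" by simp
qed

abbreviation mid_angle :: "real \<Rightarrow> real" where "mid_angle t \<equiv> t/2 + pi/8"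

text \<open>The double angle of \<open>w\<close> is \<open>b + pi/4\<close>, whose tangent is \<open>(1 + tan b) / (1 - tan b)\<close>. The statement
  is the double-angle formula cleared of denominators.\<close>

lemma tan_half_step:
  fixes b :: real
  assumes b: "0 < b" "b < pi/4"
  defines "w \<equiv> b/2 + pi/8"
  shows "2 * tan w * (1 - tan b) = (1 + tan b) * (1 - (tan w)^2)" and "cos w > 0" and "sin w > 0"
proof -
  show cw: "cos w > 0" and "sin w > 0"
    using b unfolding w_def by (auto intro!: cos_gt_zero sin_gt_zero)
  have cb: "cos b > 0" using b by (intro cos_gt_zero) auto
  have s: "2 * sin w * cos w = (sin b + cos b) * (sqrt 2 / 2)"
    using sin_double[of w] by (simp add: w_def sin_add sin_45 cos_45 algebra_simps)
  have c: "(cos w)^2 - (sin w)^2 = (cos b - sin b) * (sqrt 2 / 2)"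
    using cos_double[of w] by (simp add: w_def cos_add sin_45 cos_45 algebra_simps)
  have "2 * sin w * cos w * (cos b - sin b) = (cos b + sin b) * ((cos w)^2 - (sin w)^2)"
    unfolding s c by simp
  then show "2 * tan w * (1 - tan b) = (1 + tan b) * (1 - (tan w)^2)"
    using cw cb by (simp add: tan_def divide_simps) algebra
qed

text \<open>The tangent of this angle is the positive root of a quadratic equation, which \<open>2 T0\<close> solves.\<close>

lemma tan_mid_angle: "tan (mid_angle beta0) = 2 * T0"
proof -
  define \<tau> where "\<tau> = tan (mid_angle beta0)"
  have pos: "\<tau> > 0" using tan_half_step(2,3)[OF beta0_pos beta0_less] by (simp add: \<tau>_def tan_def)
  have "2 * \<tau> * (1 - T0) = (1 + T0) * (1 - \<tau>^2)"
    using tan_half_step(1)[OF beta0_pos beta0_less] by (simp add: \<tau>_def T0_def)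
  then have "(\<tau> - 2 * T0) * ((1 + T0) * (\<tau> + 2 * T0) + 2 * (1 - T0)) = 0"
    using T0_cubic by algebra
  moreover have "(1 + T0) * (\<tau> + 2 * T0) + 2 * (1 - T0) > 0"
    using pos T0_bounds by (intro add_pos_pos mult_pos_pos) auto
  ultimately show ?thesis by (simp add: \<tau>_def)
qed

text \<open>These two values are what makes the pieces \<open>x1\<close> and \<open>x6\<close> of the path fit together at \<open>beta0\<close>, in
  position and in velocity.\<close>

lemma coef_F_mid_angle: "coef_F * sin (mid_angle beta0) = 2/3" "coef_F * cos (mid_angle beta0) = z0/3"
proof -
  define w where "w = beta0/2 + pi/8"
  have cw: "cos w > 0" using tan_half_step(2)[OF beta0_pos beta0_less] by (simp add: w_def)
  have sw: "sin w = 2 * T0 * cos w" using tan_mid_angle cw by (simp add: w_def tan_def field_simps)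
  have "(cos w)^2 * (1 + 4 * T0^2) = 1"
    using sin_cos_squared_add[of w] by (simp add: sw power_mult_distrib algebra_simps)
  then have c2: "(cos w)^2 * (z0^2 + 4) = z0^2"
    using z0_facts(2) by algebra
  have "(coef_F * cos w)^2 = (z0/3)^2"
    using c2 by (simp add: power_mult_distrib coef_F_sq power_divide field_simps)
  then have F: "coef_F * cos w = z0/3"
    using cw coef_F_pos z0_facts(1) by (simp add: power2_eq_iff_nonneg)
  then show "coef_F * cos (mid_angle beta0) = z0/3" by (simp add: w_def)
  have "coef_F * sin w = 2 * T0 * (coef_F * cos w)" by (simp add: sw)
  then show "coef_F * sin (mid_angle beta0) = 2/3"
    unfolding F using z0_facts(2) by (simp add: w_def algebra_simps)
qed

lemma coef_F_le: "coef_F \<le> sqrt 2"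
proof (rule real_le_rsqrt)
  have "z0^2 < (100/29)^2" using z0_facts by (auto intro!: power_strict_mono)
  then show "coef_F^2 \<le> 2" unfolding coef_F_sq by (simp add: power2_eq_square)
qed

section \<open>Derivatives and symmetry of the explicit path\<close>

text \<open>If \<open>t\<close> lies outside a closed piece, the filter of points of the piece near \<open>t\<close> is trivial; so only the
  pieces that contain \<open>t\<close> matter.\<close>

lemma has_vector_derivative_closed_Un:
  assumes "closed S" "closed T"
    and "t \<in> S \<Longrightarrow> (f has_vector_derivative v) (at t within S)"
    and "t \<in> T \<Longrightarrow> (f has_vector_derivative v) (at t within T)"
  shows "(f has_vector_derivative v) (at t within S \<union> T)"
proof -
  have triv: "(f has_vector_derivative v) (at t within U)" if "closed U" "t \<notin> U" for U
  proof -
    have "at t within U = bot"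
      using that by (intro not_in_closure_trivial_limitI) (simp add: closure_closed)
    then show ?thesis
      unfolding has_vector_derivative_def has_derivative_within by (simp add: bounded_linear_scaleR_left)
  qed
  have "(f has_vector_derivative v) (at t within S)" "(f has_vector_derivative v) (at t within T)"
    using assms triv by blast+
  then show ?thesis
    unfolding has_vector_derivative_def has_derivative_within
    by (auto simp: at_within_union intro: filterlim_sup)
qed

definition vel1 :: "real \<Rightarrow> plane" where
  "vel1 t = (1/2 - 2 * coef_a1 * sin t) *\<^sub>R mu t + (2 * coef_a1 * cos t - 1) *\<^sub>R nu t"

definition vel6 :: "real \<Rightarrow> plane" where
  "vel6 t = (1 - 3/2 * (coef_F * sin (mid_angle t))) *\<^sub>R mu t + (3/2 * (coef_F * cos (mid_angle t)) - 1) *\<^sub>R nu t"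

definition vel5 :: "real \<Rightarrow> plane" where
  "vel5 t = (1 - 2 * coef_a1 * sin t) *\<^sub>R mu t + (2 * coef_a1 * cos t - 1/2) *\<^sub>R nu t"

lemma x1_frame: "x1 = (\<lambda>t. (coef_a1 * cos t - 1) *\<^sub>R mu t + (coef_a1 * sin t - 1/2) *\<^sub>R nu t + kappa1)"
  by (simp add: fun_eq_iff x1_def rot_mult coef_a2_def)

lemma x5_frame: "x5 = (\<lambda>t. (coef_a1 * cos t - 1/2) *\<^sub>R mu t + (coef_a1 * sin t - 1) *\<^sub>R nu t + kappa5)"
  by (simp add: fun_eq_iff x5_def rot_mult coef_e1_def coef_e2_def coef_a2_def)

lemma x6_frame: "x6 = (\<lambda>t. (coef_F * cos (mid_angle t) - 1) *\<^sub>R mu t + (coef_F * sin (mid_angle t) - 1) *\<^sub>R nu t + kappa6)"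
  by (simp add: fun_eq_iff x6_def rot_mult coef_f_eq cos_add sin_add algebra_simps)

lemma x1_deriv: "(x1 has_vector_derivative vel1 t) (at t within S)"
proof -
  have "((\<lambda>t. (coef_a1 * cos t - 1) *\<^sub>R mu t + (coef_a1 * sin t - 1/2) *\<^sub>R nu t) has_vector_derivative
      ((coef_a1 * - sin t) - (coef_a1 * sin t - 1/2)) *\<^sub>R mu t + ((coef_a1 * cos t) + (coef_a1 * cos t - 1)) *\<^sub>R nu t) (at t within S)"
    by (rule has_vector_derivative_frame) (auto intro!: derivative_eq_intros)
  then have "((\<lambda>t. (coef_a1 * cos t - 1) *\<^sub>R mu t + (coef_a1 * sin t - 1/2) *\<^sub>R nu t) has_vector_derivative vel1 t) (at t within S)"
    by (simp add: vel1_def algebra_simps)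
  then show ?thesis unfolding x1_frame by (simp add: has_vector_derivative_add_const)
qed

lemma x5_deriv: "(x5 has_vector_derivative vel5 t) (at t within S)"
proof -
  have "((\<lambda>t. (coef_a1 * cos t - 1/2) *\<^sub>R mu t + (coef_a1 * sin t - 1) *\<^sub>R nu t) has_vector_derivative
      ((coef_a1 * - sin t) - (coef_a1 * sin t - 1)) *\<^sub>R mu t + ((coef_a1 * cos t) + (coef_a1 * cos t - 1/2)) *\<^sub>R nu t) (at t within S)"
    by (rule has_vector_derivative_frame) (auto intro!: derivative_eq_intros)
  then have "((\<lambda>t. (coef_a1 * cos t - 1/2) *\<^sub>R mu t + (coef_a1 * sin t - 1) *\<^sub>R nu t) has_vector_derivative vel5 t) (at t within S)"
    by (simp add: vel5_def algebra_simps)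
  then show ?thesis unfolding x5_frame by (simp add: has_vector_derivative_add_const)
qed

lemma x6_deriv: "(x6 has_vector_derivative vel6 t) (at t within S)"
proof -
  have "((\<lambda>t. (coef_F * cos (mid_angle t) - 1) *\<^sub>R mu t + (coef_F * sin (mid_angle t) - 1) *\<^sub>R nu t) has_vector_derivative
      ((coef_F * (- sin (mid_angle t) * (1/2))) - (coef_F * sin (mid_angle t) - 1)) *\<^sub>R mu t
      + ((coef_F * (cos (mid_angle t) * (1/2))) + (coef_F * cos (mid_angle t) - 1)) *\<^sub>R nu t) (at t within S)"
    by (rule has_vector_derivative_frame) (auto intro!: derivative_eq_intros)
  also have "((coef_F * (- sin (mid_angle t) * (1/2))) - (coef_F * sin (mid_angle t) - 1)) *\<^sub>R mu t
      + ((coef_F * (cos (mid_angle t) * (1/2))) + (coef_F * cos (mid_angle t) - 1)) *\<^sub>R nu t = vel6 t"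
    unfolding vel6_def by (intro arg_cong2[of _ _ _ _ "(+)"] arg_cong2[of _ _ _ _ scaleR] refl) auto
  finally show ?thesis unfolding x6_frame by (simp add: has_vector_derivative_add_const)
qed

text \<open>The reflection in the vertical axis through the corner at time \<open>pi/4\<close>. It exchanges the roles of
  \<open>mu\<close> and \<open>nu\<close>, of \<open>A\<close> and \<open>C\<close>, and of \<open>B\<close> and \<open>D\<close>, while time runs backwards.\<close>

definition flip :: "plane \<Rightarrow> plane" where
  "flip P = vector [2 * (1 - 4/3 * coef_a1) - P$1, P$2]"

lemma flip_nth [simp]: "flip P $ 1 = 2 * (1 - 4/3 * coef_a1) - P$1" "flip P $ 2 = P$2"
  by (simp_all add: flip_def)

lemma flip_flip [simp]: "flip (flip P) = P"
  by (simp add: plane_eq_iff)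

lemma flip_x1: "x5 (pi/2 - t) = flip (x1 t)"
  by (simp add: x1_frame x5_frame plane_eq_iff frame_flip sin_diff cos_diff kappa1_def kappa5_def algebra_simps)

lemma mid_angle_flip:
  "sin ((pi/2 - t)/2 + pi/8) = cos (mid_angle t)" "cos ((pi/2 - t)/2 + pi/8) = sin (mid_angle t)"
proof -
  have "(pi/2 - t)/2 + pi/8 = pi/2 - (mid_angle t)" by (simp add: field_simps)
  then show "sin ((pi/2 - t)/2 + pi/8) = cos (mid_angle t)" "cos ((pi/2 - t)/2 + pi/8) = sin (mid_angle t)"
    by (simp_all only: sin_diff cos_diff) simp_all
qed

lemma flip_x6: "x6 (pi/2 - t) = flip (x6 t)"
  unfolding x6_frame mid_angle_flip
  by (simp add: plane_eq_iff frame_flip kappa6_def algebra_simps)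

lemma x1_beta0: "x1 beta0 = x6 beta0"
proof -
  define a c s where "a = coef_a1" "c = cos beta0" "s = sin beta0"
  have as: "a * s = 1/4" and z: "z0 = 4 * (a * c)" and cs: "c * c + s * s = 1"
    using coef_a1_facts(1,3) by (simp_all add: a_c_s_def)
  have m: "a * (s * s) = s/4" "a * (c * s) = c/4" "a * (c * c) = a - s/4"
    using as cs by algebra+
  show ?thesis
    unfolding x1_frame x6_frame coef_F_mid_angle unfolding z
    by (simp add: plane_eq_iff kappa1_def kappa6_def algebra_simps flip: a_c_s_def)
       (use m in \<open>intro conjI; linarith\<close>)
qed

lemma vel1_beta0: "vel1 beta0 = vel6 beta0"
proof -
  have e: "2 * coef_a1 * sin beta0 = 1/2" "2 * coef_a1 * cos beta0 = z0/2"
    using coef_a1_facts(1,3) by simp_all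
  show ?thesis unfolding vel1_def vel6_def coef_F_mid_angle e by simp
qed

lemma vel5_beta0: "vel5 (pi/2 - beta0) = vel6 (pi/2 - beta0)"
proof -
  have e: "2 * coef_a1 * cos (pi/2 - beta0) = 1/2" "2 * coef_a1 * sin (pi/2 - beta0) = z0/2"
    using coef_a1_facts(1,3) by (simp_all add: sin_diff cos_diff)
  show ?thesis unfolding vel5_def vel6_def mid_angle_flip coef_F_mid_angle e by simp
qed

lemma x5_beta0: "x5 (pi/2 - beta0) = x6 (pi/2 - beta0)"
  by (simp add: flip_x1 flip_x6 x1_beta0)

lemma phases: "{0..pi/2} = {0..beta0} \<union> ({beta0..pi/2 - beta0} \<union> {pi/2 - beta0..pi/2})"
  using beta0_pos beta0_less by auto

lemma phase_cases:
  assumes "t \<in> {0..pi/2}"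
  obtains "t \<in> {0..beta0}" | "t \<in> {beta0..pi/2 - beta0}" | "t \<in> {pi/2 - beta0..pi/2}"
  using assms phases by auto

lemma sofa_path_phase:
  "t \<in> {0..beta0} \<Longrightarrow> sofa_path t = x1 t"
  "t \<in> {beta0..pi/2 - beta0} \<Longrightarrow> sofa_path t = x6 t"
  "t \<in> {pi/2 - beta0..pi/2} \<Longrightarrow> sofa_path t = x5 t"
proof -
  have "beta0 < pi/2 - beta0" using beta0_less by simp
  then show "t \<in> {0..beta0} \<Longrightarrow> sofa_path t = x1 t" "t \<in> {beta0..pi/2 - beta0} \<Longrightarrow> sofa_path t = x6 t"
  "t \<in> {pi/2 - beta0..pi/2} \<Longrightarrow> sofa_path t = x5 t"
    using x1_beta0 x5_beta0
    by (auto simp: sofa_path_def)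
qed

definition sofa_vel :: "real \<Rightarrow> plane" where
  "sofa_vel t = (if t < beta0 then vel1 t else if t \<le> pi/2 - beta0 then vel6 t else vel5 t)"

lemma sofa_vel_phase:
  "t \<in> {0..beta0} \<Longrightarrow> sofa_vel t = vel1 t"
  "t \<in> {beta0..pi/2 - beta0} \<Longrightarrow> sofa_vel t = vel6 t"
  "t \<in> {pi/2 - beta0..pi/2} \<Longrightarrow> sofa_vel t = vel5 t"
proof -
  have "beta0 < pi/2 - beta0" using beta0_less by simp
  then show "t \<in> {0..beta0} \<Longrightarrow> sofa_vel t = vel1 t" "t \<in> {beta0..pi/2 - beta0} \<Longrightarrow> sofa_vel t = vel6 t"
  "t \<in> {pi/2 - beta0..pi/2} \<Longrightarrow> sofa_vel t = vel5 t"
    using vel1_beta0 vel5_beta0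
    by (auto simp: sofa_vel_def)
qed

lemma sofa_path_deriv:
  assumes "t \<in> {0..pi/2}"
  shows "(sofa_path has_vector_derivative sofa_vel t) (at t within {0..pi/2})"
  unfolding phases
proof (intro has_vector_derivative_closed_Un closed_Un closed_atLeastAtMost)
  assume t: "t \<in> {0..beta0}"
  show "(sofa_path has_vector_derivative sofa_vel t) (at t within {0..beta0})"
    unfolding sofa_vel_phase(1)[OF t]
    by (rule has_vector_derivative_transform[OF t _ x1_deriv]) (simp add: sofa_path_phase)
next
  assume t: "t \<in> {beta0..pi/2 - beta0}"
  show "(sofa_path has_vector_derivative sofa_vel t) (at t within {beta0..pi/2 - beta0})"
    unfolding sofa_vel_phase(2)[OF t]
    by (rule has_vector_derivative_transform[OF t _ x6_deriv]) (simp add: sofa_path_phase)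
next
  assume t: "t \<in> {pi/2 - beta0..pi/2}"
  show "(sofa_path has_vector_derivative sofa_vel t) (at t within {pi/2 - beta0..pi/2})"
    unfolding sofa_vel_phase(3)[OF t]
    by (rule has_vector_derivative_transform[OF t _ x5_deriv]) (simp add: sofa_path_phase)
qed

lemma vel_sofa: "t \<in> {0..pi/2} \<Longrightarrow> vel sofa_path t = sofa_vel t"
  by (rule vel_eq[OF sofa_path_deriv])

lemma vel_phase_deriv:
  "(vel1 has_vector_derivative (1 - 4 * coef_a1 * cos t) *\<^sub>R mu t + (1/2 - 4 * coef_a1 * sin t) *\<^sub>R nu t) (at t)"
  "(vel6 has_vector_derivative (1 - 9/4 * (coef_F * cos (mid_angle t))) *\<^sub>R mu t + (1 - 9/4 * (coef_F * sin (mid_angle t))) *\<^sub>R nu t) (at t)"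
  "(vel5 has_vector_derivative (1/2 - 4 * coef_a1 * cos t) *\<^sub>R mu t + (1 - 4 * coef_a1 * sin t) *\<^sub>R nu t) (at t)"
proof -
  have "(vel1 has_vector_derivative (0 - 2 * coef_a1 * cos t - (2 * coef_a1 * cos t - 1)) *\<^sub>R mu t
      + (2 * coef_a1 * - sin t - 0 + (1/2 - 2 * coef_a1 * sin t)) *\<^sub>R nu t) (at t)"
    unfolding vel1_def[abs_def] by (rule has_vector_derivative_frame) (auto intro!: derivative_eq_intros)
  then show "(vel1 has_vector_derivative (1 - 4 * coef_a1 * cos t) *\<^sub>R mu t + (1/2 - 4 * coef_a1 * sin t) *\<^sub>R nu t) (at t)"
    by (simp add: algebra_simps)
  have "(vel5 has_vector_derivative (0 - 2 * coef_a1 * cos t - (2 * coef_a1 * cos t - 1/2)) *\<^sub>R mu t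
      + (2 * coef_a1 * - sin t - 0 + (1 - 2 * coef_a1 * sin t)) *\<^sub>R nu t) (at t)"
    unfolding vel5_def[abs_def] by (rule has_vector_derivative_frame) (auto intro!: derivative_eq_intros)
  then show "(vel5 has_vector_derivative (1/2 - 4 * coef_a1 * cos t) *\<^sub>R mu t + (1 - 4 * coef_a1 * sin t) *\<^sub>R nu t) (at t)"
    by (simp add: algebra_simps)
  have "(vel6 has_vector_derivative (0 - 3/2 * (coef_F * (cos (mid_angle t) * (1/2))) - (3/2 * (coef_F * cos (mid_angle t)) - 1)) *\<^sub>R mu t
      + (3/2 * (coef_F * (- sin (mid_angle t) * (1/2))) - 0 + (1 - 3/2 * (coef_F * sin (mid_angle t)))) *\<^sub>R nu t) (at t)"
    unfolding vel6_def[abs_def] by (rule has_vector_derivative_frame) (auto intro!: derivative_eq_intros)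
  also have "0 - 3/2 * (coef_F * (cos (mid_angle t) * (1/2))) - (3/2 * (coef_F * cos (mid_angle t)) - 1)
     = 1 - 9/4 * (coef_F * cos (mid_angle t))" by (simp add: field_simps)
  also have "3/2 * (coef_F * (- sin (mid_angle t) * (1/2))) - 0 + (1 - 3/2 * (coef_F * sin (mid_angle t)))
     = 1 - 9/4 * (coef_F * sin (mid_angle t))" by (simp add: field_simps)
  finally show "(vel6 has_vector_derivative (1 - 9/4 * (coef_F * cos (mid_angle t))) *\<^sub>R mu t
      + (1 - 9/4 * (coef_F * sin (mid_angle t))) *\<^sub>R nu t) (at t)" .
qed

lemma vel_phase_inner:
  "vel1 t \<bullet> mu t = 1/2 - 2 * coef_a1 * sin t" "vel1 t \<bullet> nu t = 2 * coef_a1 * cos t - 1"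
  "vel6 t \<bullet> mu t = 1 - 3/2 * (coef_F * sin (mid_angle t))" "vel6 t \<bullet> nu t = 3/2 * (coef_F * cos (mid_angle t)) - 1"
  "vel5 t \<bullet> mu t = 1 - 2 * coef_a1 * sin t" "vel5 t \<bullet> nu t = 2 * coef_a1 * cos t - 1/2"
  by (simp_all add: vel1_def vel5_def vel6_def inner_add_left frame_inner)

lemma sofa_P1: "P1 sofa_path"
  unfolding P1_def
proof
  show "\<forall>t\<in>{0..pi/2}. sofa_path differentiable at t within {0..pi/2}"
    using sofa_path_deriv differentiableI_vector by blast
  have c: "continuous_on {0..beta0} vel1" "continuous_on {beta0..pi/2 - beta0} vel6" "continuous_on {pi/2 - beta0..pi/2} vel5"
    unfolding vel1_def[abs_def] vel6_def[abs_def] vel5_def[abs_def] by (intro continuous_intros; simp)+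
  have "continuous_on {0..pi/2} sofa_vel"
    unfolding phases
    by (intro continuous_on_closed_Un closed_Un closed_atLeastAtMost
          continuous_on_eq[OF c(1)] continuous_on_eq[OF c(2)] continuous_on_eq[OF c(3)])
       (simp_all add: sofa_vel_phase)
  then show "continuous_on {0..pi/2} (vel sofa_path)"
    by (rule continuous_on_eq) (simp add: vel_sofa)
qed

lemma vel_deriv_in_frame:
  assumes v: "\<And>s. s \<in> {a<..<b} \<Longrightarrow> vel x s = v s" and t: "t \<in> {a<..<b}"
    and d: "(v has_vector_derivative A *\<^sub>R mu t + B *\<^sub>R nu t) (at t)"
    and AB: "A = c1 - k * (v t \<bullet> nu t)" "B = c2 + k * (v t \<bullet> mu t)"
  shows "(vel x has_vector_derivative rot t *v (vector [c1, c2] +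
            (vector [vector [k * sin t, - k * cos t],
                     vector [k * cos t, k * sin t]] :: real^2^2) *v vel x t)) (at t)"
proof -
  have "(vel x has_vector_derivative A *\<^sub>R mu t + B *\<^sub>R nu t) (at t)"
    by (rule has_vector_derivative_transform_within_open[OF d, of "{a<..<b}"]) (use t v in auto)
  then show ?thesis
    unfolding AB rot_mult matrix2_mult v[OF t] by (simp add: inner_plane algebra_simps)
qed

lemma sofa_necessary_conditions: "necessary_conditions beta0 sofa_path"
  unfolding necessary_conditions_def
proof (intro conjI allI impI)
  fix t
  show "0 < t \<and> t < beta0 \<Longrightarrow> (vel sofa_path has_vector_derivative rot t *v (vector [-1, -1/2] +
            (vector [vector [2 * sin t, - 2 * cos t],
                     vector [2 * cos t, 2 * sin t]] :: real^2^2) *v vel sofa_path t)) (at t)"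
    by (rule vel_deriv_in_frame[OF _ _ vel_phase_deriv(1), where a=0 and b=beta0])
       (use beta0_pos beta0_less in \<open>auto simp: vel_sofa sofa_vel_phase vel_phase_inner\<close>)
  show "beta0 < t \<and> t < pi/2 - beta0 \<Longrightarrow> (vel sofa_path has_vector_derivative rot t *v (vector [-1/2, -1/2] +
            (vector [vector [3/2 * sin t, - 3/2 * cos t],
                     vector [3/2 * cos t, 3/2 * sin t]] :: real^2^2) *v vel sofa_path t)) (at t)"
    \<comment> \<open>matches the entry \<open>- 3/2 * cos t\<close> with \<open>- k * cos t\<close>\<close>
    unfolding minus_divide_left[symmetric]
    by (rule vel_deriv_in_frame[OF _ _ vel_phase_deriv(2), where a=beta0 and b="pi/2 - beta0"])
       (use beta0_pos beta0_less in \<open>auto simp: vel_sofa sofa_vel_phase vel_phase_inner diff_divide_distrib\<close>)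
  show "pi/2 - beta0 < t \<and> t < pi/2 \<Longrightarrow> (vel sofa_path has_vector_derivative rot t *v (vector [-1/2, -1] +
            (vector [vector [2 * sin t, - 2 * cos t],
                     vector [2 * cos t, 2 * sin t]] :: real^2^2) *v vel sofa_path t)) (at t)"
    by (rule vel_deriv_in_frame[OF _ _ vel_phase_deriv(3), where a="pi/2 - beta0" and b="pi/2"])
       (use beta0_pos beta0_less in \<open>auto simp: vel_sofa sofa_vel_phase vel_phase_inner\<close>)
qed

lemma sofa_vel_flip:
  assumes "t \<in> {0..pi/2}"
  shows "vel sofa_path (pi/2 - t) \<bullet> mu (pi/2 - t) = - (vel sofa_path t \<bullet> nu t)"
    and "vel sofa_path (pi/2 - t) \<bullet> nu (pi/2 - t) = - (vel sofa_path t \<bullet> mu t)"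
proof -
  have t': "pi/2 - t \<in> {0..pi/2}" using assms by simp
  have "vel sofa_path (pi/2 - t) \<bullet> mu (pi/2 - t) = - (vel sofa_path t \<bullet> nu t)
     \<and> vel sofa_path (pi/2 - t) \<bullet> nu (pi/2 - t) = - (vel sofa_path t \<bullet> mu t)"
    using assms
  proof (cases rule: phase_cases)
    case 1
    then have "pi/2 - t \<in> {pi/2 - beta0..pi/2}" by auto
    then show ?thesis
      unfolding vel_sofa[OF assms] vel_sofa[OF t'] using 1 by (simp add: sofa_vel_phase vel_phase_inner sin_diff cos_diff)
  next
    case 2
    then have "pi/2 - t \<in> {beta0..pi/2 - beta0}" by auto
    then show ?thesis
      unfolding vel_sofa[OF assms] vel_sofa[OF t'] using 2 by (simp only: sofa_vel_phase vel_phase_inner mid_angle_flip) simp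
  next
    case 3
    then have "pi/2 - t \<in> {0..beta0}" by auto
    then show ?thesis
      unfolding vel_sofa[OF assms] vel_sofa[OF t'] using 3 by (simp add: sofa_vel_phase vel_phase_inner sin_diff cos_diff)
  qed
  then show "vel sofa_path (pi/2 - t) \<bullet> mu (pi/2 - t) = - (vel sofa_path t \<bullet> nu t)"
    "vel sofa_path (pi/2 - t) \<bullet> nu (pi/2 - t) = - (vel sofa_path t \<bullet> mu t)" by auto
qed

lemma sofa_path_flip:
  assumes "t \<in> {0..pi/2}"
  shows "sofa_path (pi/2 - t) = flip (sofa_path t)"
  using assms
proof (cases rule: phase_cases)
  case 1
  then have "pi/2 - t \<in> {pi/2 - beta0..pi/2}" by auto
  then show ?thesis using 1 by (simp add: sofa_path_phase flip_x1)
next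
  case 2
  then have "pi/2 - t \<in> {beta0..pi/2 - beta0}" by auto
  then show ?thesis using 2 by (simp add: sofa_path_phase flip_x6)
next
  case 3
  then have "pi/2 - t \<in> {0..beta0}" by auto
  then show ?thesis using 3 flip_x1[of "pi/2 - t"] by (simp add: sofa_path_phase)
qed

lemma sofa_P2: "P2 sofa_path"
  unfolding P2_def
proof
  fix t :: real assume t: "t \<in> {0..pi/2}"
  show "vel sofa_path (pi/2 - t) = (vector [vector [1, 0], vector [0, -1]] :: real^2^2) *v vel sofa_path t"
    unfolding matrix2_mult
    by (rule frame_eqI[of _ "pi/2 - t"])
       (simp_all only: sofa_vel_flip[OF t], simp_all add: inner_plane[of "vector _"] inner_plane[of "vel _ _"] frame_flip)
qed

lemma sofa_path_0: "sofa_path 0 = 0"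
proof -
  have "sofa_path 0 = x1 0" using beta0_pos by (simp add: sofa_path_phase)
  then show ?thesis by (simp add: x1_frame plane_eq_iff kappa1_def)
qed

abbreviation "sofa_A \<equiv> path_A sofa_path"
abbreviation "sofa_B \<equiv> path_B sofa_path"
abbreviation "sofa_C \<equiv> path_C sofa_path"
abbreviation "sofa_D \<equiv> path_D sofa_path"

text \<open>In the first phase the outer wall pivots around a fixed point, which becomes the right endpoint of
  the ambidextrous shape.\<close>

lemma sofa_A_phase1:
  assumes "t \<in> {0..beta0}"
  shows "sofa_A t = vector [1, 1/2]"
proof -
  have t: "t \<in> {0..pi/2}" using assms beta0_less by auto
  have "cos t * (cos t * coef_a1) + sin t * (sin t * coef_a1) = coef_a1"
    by (simp flip: distrib_right mult.assoc)
  then show ?thesis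
    unfolding path_A_def vel_sofa[OF t] sofa_vel_phase(1)[OF assms] sofa_path_phase(1)[OF assms] vel_phase_inner x1_frame
    by (simp add: plane_eq_iff kappa1_def algebra_simps)
qed

lemma sofa_A_phase6:
  assumes "t \<in> {beta0..pi/2 - beta0}"
  shows "sofa_A t = (coef_F * cos (mid_angle t)) *\<^sub>R mu t - (coef_F * sin (mid_angle t) / 2) *\<^sub>R nu t + kappa6"
proof -
  have t: "t \<in> {0..pi/2}" using assms beta0_pos by auto
  show ?thesis
    unfolding path_A_def vel_sofa[OF t] sofa_vel_phase(2)[OF assms] sofa_path_phase(2)[OF assms] vel_phase_inner x6_frame
    by (simp add: plane_eq_iff algebra_simps)
qed

text \<open>In the last phase \<open>A\<close> runs through a circular arc of radius \<open>1/2\<close>.\<close>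

lemma sofa_A_phase5:
  assumes "t \<in> {pi/2 - beta0..pi/2}"
  shows "sofa_A t = (1/2) *\<^sub>R mu t + vector [1 - 2/3 * coef_a1, 1/2]"
proof -
  have t: "t \<in> {0..pi/2}" using assms beta0_less by auto
  have "cos t * (cos t * coef_a1) + sin t * (sin t * coef_a1) = coef_a1"
    by (simp flip: distrib_right mult.assoc)
  then show ?thesis
    unfolding path_A_def vel_sofa[OF t] sofa_vel_phase(3)[OF assms] sofa_path_phase(3)[OF assms] vel_phase_inner x5_frame
    by (simp add: plane_eq_iff kappa5_def algebra_simps)
qed

lemma sofa_P3: "P3 sofa_path"
  using beta0_pos by (simp add: P3_def sofa_A_phase1)

lemma path_B_A: "path_B x t = path_A x t - mu t"
  by (simp add: path_A_def path_B_def)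

lemma sofa_contact_flip:
  assumes "t \<in> {0..pi/2}"
  shows "sofa_C (pi/2 - t) = flip (sofa_A t)"
    and "sofa_D (pi/2 - t) = flip (sofa_B t)"
  unfolding path_C_def path_A_def path_B_def path_D_def sofa_path_flip[OF assms] sofa_vel_flip[OF assms]
  by (simp_all add: plane_eq_iff frame_flip algebra_simps)

abbreviation "sofa_p t \<equiv> vel sofa_path t \<bullet> mu t"
abbreviation "sofa_q t \<equiv> vel sofa_path t \<bullet> nu t"

section \<open>Points that belong to the shape\<close>

lemma sofa_pq:
  "t \<in> {0..beta0} \<Longrightarrow> sofa_p t = 1/2 - 2 * coef_a1 * sin t"
  "t \<in> {beta0..pi/2 - beta0} \<Longrightarrow> sofa_p t = 1 - 3/2 * (coef_F * sin (mid_angle t))"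
  "t \<in> {pi/2 - beta0..pi/2} \<Longrightarrow> sofa_p t = 1 - 2 * coef_a1 * sin t"
  "t \<in> {0..beta0} \<Longrightarrow> sofa_q t = 2 * coef_a1 * cos t - 1"
  "t \<in> {beta0..pi/2 - beta0} \<Longrightarrow> sofa_q t = 3/2 * (coef_F * cos (mid_angle t)) - 1"
  using beta0_pos beta0_less
  by (simp_all add: vel_sofa sofa_vel_phase vel_phase_inner del: times_divide_eq_left times_divide_eq_right)

text \<open>Both components of the velocity are positive before \<open>beta0\<close>; this keeps the corner and the wall of
  \<open>B\<close> away from the shape in the first phase.\<close>

lemma sofa_pq_phase1:
  assumes "0 \<le> t" "t < beta0"
  shows "0 < sofa_p t" "sofa_p t \<le> 1/2" "0 < sofa_q t"
proof -
  have t: "t \<in> {0..beta0}" using assms by simp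
  have "sin t < sin beta0" "sin t \<ge> 0"
    using assms beta0_less by (auto intro!: sin_monotone_2pi sin_ge_zero)
  then have "coef_a1 * sin t < coef_a1 * sin beta0" "coef_a1 * sin t \<ge> 0"
    using coef_a1_facts(2) by simp_all
  then show "0 < sofa_p t" "sofa_p t \<le> 1/2"
    using coef_a1_facts(1) by (simp_all add: sofa_pq(1)[OF t] mult.assoc)
  have "cos beta0 < cos t" using assms beta0_less by (intro cos_monotone_0_pi) auto
  then have "coef_a1 * cos beta0 < coef_a1 * cos t" using coef_a1_facts(2) by simp
  then have "2 * (coef_a1 * cos t) > 1" using coef_a1_facts(3) z0_facts(5) by simp
  then show "0 < sofa_q t" by (simp add: sofa_pq(4)[OF t] mult.assoc)
qed

text \<open>Here \<open>sofa_p\<close> decreases with the sine of an angle that grows from its value at \<open>beta0\<close>, where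
  \<open>sofa_p = 0\<close>, to the complementary angle.\<close>

lemma sofa_p_mid:
  assumes t: "t \<in> {beta0..pi/2 - beta0}"
  shows "-1 \<le> sofa_p t" "sofa_p t \<le> 0" "beta0 < t \<Longrightarrow> sofa_p t < 0"
proof -
  define w where "w = t/2 + pi/8"
  have w: "beta0/2 + pi/8 \<le> w" "w \<le> (pi/2 - beta0)/2 + pi/8" "-(pi/2) \<le> beta0/2 + pi/8"
    "(pi/2 - beta0)/2 + pi/8 \<le> pi/2"
    using t beta0_pos by (auto simp: w_def field_simps)
  have "sin (mid_angle beta0) \<le> sin w" "sin w \<le> sin ((pi/2 - beta0)/2 + pi/8)"
    by (rule sin_monotone_2pi_le; use w in linarith)+
  then have "coef_F * sin (mid_angle beta0) \<le> coef_F * sin w" "coef_F * sin w \<le> coef_F * sin ((pi/2 - beta0)/2 + pi/8)"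
    using coef_F_pos by simp_all
  then show "-1 \<le> sofa_p t" "sofa_p t \<le> 0"
    unfolding mid_angle_flip coef_F_mid_angle sofa_pq(2)[OF t] w_def[symmetric] using z0_facts(6) by simp_all
  assume "beta0 < t"
  then have "beta0/2 + pi/8 < w" by (simp add: w_def)
  then have "sin (mid_angle beta0) < sin w" by (rule sin_monotone_2pi[rotated]; use w in linarith)
  then have "coef_F * sin (mid_angle beta0) < coef_F * sin w" using coef_F_pos by simp
  then show "sofa_p t < 0" unfolding coef_F_mid_angle sofa_pq(2)[OF t] w_def[symmetric] by simp
qed

lemma sofa_q_flip: "t \<in> {0..pi/2} \<Longrightarrow> sofa_q t = - sofa_p (pi/2 - t)"
  by (simp add: sofa_vel_flip)

lemma sofa_p_flip: "t \<in> {0..pi/2} \<Longrightarrow> sofa_p t = - sofa_q (pi/2 - t)"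
  by (simp add: sofa_vel_flip)

lemma sofa_q_mid:
  assumes t: "t \<in> {beta0..pi/2 - beta0}"
  shows "0 \<le> sofa_q t" "sofa_q t \<le> 1" "t < pi/2 - beta0 \<Longrightarrow> 0 < sofa_q t"
proof -
  have t': "pi/2 - t \<in> {beta0..pi/2 - beta0}" "t \<in> {0..pi/2}" using t beta0_pos by auto
  show "0 \<le> sofa_q t" "sofa_q t \<le> 1" "t < pi/2 - beta0 \<Longrightarrow> 0 < sofa_q t"
    using sofa_p_mid[OF t'(1)] sofa_q_flip[OF t'(2)] by auto
qed

lemma sofa_pq_phase5:
  assumes "pi/2 - beta0 < t" "t \<le> pi/2"
  shows "sofa_p t < 0" "sofa_q t < 0" "-1/2 \<le> sofa_q t"
proof -
  have t: "t \<in> {0..pi/2}" "0 \<le> pi/2 - t" "pi/2 - t < beta0" using assms beta0_less by auto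
  show "sofa_p t < 0" "sofa_q t < 0" "-1/2 \<le> sofa_q t"
    using sofa_pq_phase1[OF t(2,3)] sofa_q_flip[OF t(1)] sofa_p_flip[OF t(1)] by auto
qed

lemma sofa_p_beta0: "sofa_p beta0 = 0"
  using sofa_pq(2)[of beta0] beta0_less coef_F_mid_angle by simp

lemma sofa_q_flip_beta0: "sofa_q (pi/2 - beta0) = 0"
  using sofa_q_flip[of "pi/2 - beta0"] sofa_p_beta0 beta0_pos beta0_less by simp

lemma sofa_p_le: "t \<in> {0..pi/2} \<Longrightarrow> sofa_p t \<le> 1/2"
  using sofa_pq_phase1(2)[of t] sofa_p_mid(2)[of t] sofa_pq_phase5(1)[of t] by fastforce

lemma sofa_p_neg: "beta0 < t \<Longrightarrow> t \<le> pi/2 \<Longrightarrow> sofa_p t < 0"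
  using sofa_p_mid(3)[of t] sofa_pq_phase5(1)[of t] by fastforce

lemma sofa_q_pos: "0 \<le> t \<Longrightarrow> t < pi/2 - beta0 \<Longrightarrow> 0 < sofa_q t"
  using sofa_q_mid(3)[of t] sofa_pq_phase1(3)[of t] by fastforce

lemma sofa_rates:
  assumes "t \<in> {0..pi/2}"
  shows "-1 \<le> rate_B beta0 sofa_path t" "rate_B beta0 sofa_path t \<le> 0"
    "0 \<le> rate_D beta0 sofa_path t" "rate_D beta0 sofa_path t \<le> 1"
  using sofa_q_mid[of t] sofa_p_mid[of t] by (auto simp: rate_B_def rate_D_def)

lemmas sofa_contact_rates =
  contact_path_rates[OF sofa_P1 sofa_necessary_conditions beta0_pos beta0_less]

lemma sofa_support_B: "s \<in> {0..pi/2} \<Longrightarrow> t \<in> {0..pi/2} \<Longrightarrow> (sofa_B t - sofa_path s) \<bullet> mu s \<ge> 0"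
  by (rule path_B_support[OF sofa_P1 sofa_necessary_conditions beta0_pos beta0_less]) (use sofa_rates in auto)

text \<open>The path \<open>A\<close> turns in the opposite sense to \<open>B\<close>; its negative satisfies the hypotheses of
  \<open>nu_curve_support\<close>.\<close>

lemma minus_sofa_A_rates:
  "continuous_on {0..pi/2} (\<lambda>s. - sofa_A s)"
  "s \<in> {0<..<pi/2} - {beta0, pi/2 - beta0} \<Longrightarrow>
    ((\<lambda>s. - sofa_A s) has_vector_derivative (- (1 + rate_B beta0 sofa_path s)) *\<^sub>R nu s) (at s)
    \<and> - (1 + rate_B beta0 sofa_path s) \<le> 0"
proof -
  show "continuous_on {0..pi/2} (\<lambda>s. - sofa_A s)"
    by (intro continuous_intros P1_continuous_path_A sofa_P1)
  assume s: "s \<in> {0<..<pi/2} - {beta0, pi/2 - beta0}"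
  show "((\<lambda>s. - sofa_A s) has_vector_derivative (- (1 + rate_B beta0 sofa_path s)) *\<^sub>R nu s) (at s)
    \<and> - (1 + rate_B beta0 sofa_path s) \<le> 0"
    using has_vector_derivative_minus[OF sofa_contact_rates(1)[OF s]] sofa_rates(1)[of s] s
    by (simp add: algebra_simps)
qed

lemma sofa_support_A:
  assumes "s \<in> {0..pi/2}" "t \<in> {0..pi/2}"
  shows "(sofa_A t - sofa_path s) \<bullet> mu s \<le> 1"
proof -
  have "- sofa_A s \<bullet> mu s \<le> - sofa_A t \<bullet> mu s"
    by (rule nu_curve_support[where F="{beta0, pi/2 - beta0}" and r="\<lambda>s. - (1 + rate_B beta0 sofa_path s)"])
       (use assms minus_sofa_A_rates in auto)
  then show ?thesis using path_inner(1)[of sofa_path s] by (simp add: inner_diff_left)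
qed

lemma sofa_A_mono:
  assumes "0 \<le> u" "u \<le> v" "v \<le> pi/2"
  shows "sofa_A v $ 1 \<le> sofa_A u $ 1" "sofa_A u $ 2 \<le> sofa_A v $ 2"
  using nu_curve_monotone[where F="{beta0, pi/2 - beta0}" and Z="\<lambda>s. - sofa_A s", OF _ minus_sofa_A_rates assms]
  by simp_all

lemma sofa_B_mono:
  assumes "0 \<le> u" "u \<le> v" "v \<le> pi/2"
  shows "sofa_B u $ 1 \<le> sofa_B v $ 1" "sofa_B v $ 2 \<le> sofa_B u $ 2"
proof -
  have "(sofa_B has_vector_derivative rate_B beta0 sofa_path s *\<^sub>R nu s) (at s) \<and> rate_B beta0 sofa_path s \<le> 0"
    if "s \<in> {0<..<pi/2} - {beta0, pi/2 - beta0}" for s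
    using sofa_contact_rates(2)[OF that] sofa_rates(2)[of s] that by auto
  from nu_curve_monotone[where F="{beta0, pi/2 - beta0}" and Z="sofa_B", OF _ P1_continuous_path_B[OF sofa_P1] this assms]
  show "sofa_B u $ 1 \<le> sofa_B v $ 1" "sofa_B v $ 2 \<le> sofa_B u $ 2"
    by simp_all
qed

lemma sofa_contact_ends:
  "sofa_A 0 = vector [1, 1/2]" "sofa_A beta0 = vector [1, 1/2]"
  "sofa_A (pi/2) = vector [1 - 2/3 * coef_a1, 1]"
  "sofa_B 0 = vector [0, 1/2]"
  "sofa_B beta0 = vector [1 - cos beta0, 1/2 - sin beta0]"
  "sofa_B (pi/2) = vector [1 - 2/3 * coef_a1, 0]"
  "sofa_C 0 = vector [1 - 2 * coef_a1, 1]"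
  "sofa_D 0 = vector [1 - 2 * coef_a1, 0]"
  "sofa_C (pi/2) = vector [1 - 8/3 * coef_a1, 1/2]"
  "sofa_path (pi/2) = vector [2 * (1 - 4/3 * coef_a1), 0]"
proof -
  show A0: "sofa_A 0 = vector [1, 1/2]" and Ab: "sofa_A beta0 = vector [1, 1/2]"
    using beta0_pos by (simp_all add: sofa_A_phase1)
  show A: "sofa_A (pi/2) = vector [1 - 2/3 * coef_a1, 1]"
    using beta0_pos by (simp add: sofa_A_phase5 plane_eq_iff)
  show "sofa_B 0 = vector [0, 1/2]"
    "sofa_B beta0 = vector [1 - cos beta0, 1/2 - sin beta0]"
    and B: "sofa_B (pi/2) = vector [1 - 2/3 * coef_a1, 0]"
    by (simp_all add: path_B_A A0 Ab A plane_eq_iff)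
  show "sofa_C 0 = vector [1 - 2 * coef_a1, 1]"
    using sofa_contact_flip(1)[of "pi/2"] by (simp add: A plane_eq_iff)
  show "sofa_D 0 = vector [1 - 2 * coef_a1, 0]"
    using sofa_contact_flip(2)[of "pi/2"] by (simp add: B plane_eq_iff)
  show "sofa_C (pi/2) = vector [1 - 8/3 * coef_a1, 1/2]"
    using sofa_contact_flip(1)[of 0] by (simp add: A0 plane_eq_iff)
  show "sofa_path (pi/2) = vector [2 * (1 - 4/3 * coef_a1), 0]"
    using sofa_path_flip[of 0] by (simp add: sofa_path_0 plane_eq_iff)
qed

lemma hall_flip:
  assumes "s \<in> {0..pi/2}"
  shows "(flip P - sofa_path (pi/2 - s)) \<bullet> mu (pi/2 - s) = (P - sofa_path s) \<bullet> nu s"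
    "(flip P - sofa_path (pi/2 - s)) \<bullet> nu (pi/2 - s) = (P - sofa_path s) \<bullet> mu s"
  by (simp_all add: sofa_path_flip[OF assms] inner_plane frame_flip algebra_simps)

lemma sofa_support_D:
  assumes "s \<in> {0..pi/2}" "t \<in> {0..pi/2}"
  shows "(sofa_D t - sofa_path s) \<bullet> nu s \<ge> 0"
proof -
  have "sofa_D t = flip (sofa_B (pi/2 - t))"
    using sofa_contact_flip(2)[of "pi/2 - t"] assms(2) by simp
  then show ?thesis
    using sofa_support_B[of "pi/2 - s" "pi/2 - t"] hall_flip(1)[OF assms(1), of "sofa_D t"] assms
    by simp
qed

lemma in_hall_flip: "s \<in> {0..pi/2} \<Longrightarrow> in_hall sofa_path (pi/2 - s) (flip P) \<longleftrightarrow> in_hall sofa_path s P"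
  by (auto simp: in_hall_def hall_flip)

lemma shape_flip: "flip P \<in> shape_of sofa_path \<longleftrightarrow> P \<in> shape_of sofa_path"
proof -
  have imp: "flip P \<in> shape_of sofa_path" if "P \<in> shape_of sofa_path" for P
  proof -
    have "in_hall sofa_path s (flip P)" if "s \<in> {0..pi/2}" for s
      using in_hall_flip[of "pi/2 - s" P] that \<open>P \<in> _\<close> by (simp add: mem_shape_of)
    then show ?thesis
      using that by (simp add: mem_shape_of sofa_contact_ends)
  qed
  show ?thesis using imp[of P] imp[of "flip P"] by auto
qed

text \<open>The last position of \<open>A\<close> satisfies all outer conditions, and so does every point to the left of and
  below it, because \<open>mu s\<close> has nonnegative components. The three bounds of this kind reduce membership
  in the shape to one outer condition on the right and to the inner condition in the middle.\<close>

lemma outer_right: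
  assumes "P $ 1 \<le> 1 - 2/3 * coef_a1" "P $ 2 \<le> 1" "s \<in> {0..pi/2}"
  shows "(P - sofa_path s) \<bullet> mu s \<le> 1"
proof -
  have "cos s \<ge> 0" "sin s \<ge> 0" using assms(3) by (auto intro!: cos_ge_zero sin_ge_zero)
  then have "(P - sofa_A (pi/2)) \<bullet> mu s \<le> 0"
    using assms by (simp add: sofa_contact_ends inner_plane add_nonpos_nonpos mult_nonpos_nonneg)
  then show ?thesis using sofa_support_A[OF assms(3), of "pi/2"] by (simp add: inner_diff_left)
qed

lemma outer_left:
  assumes "1 - 2 * coef_a1 \<le> P $ 1" "P $ 2 \<le> 1" "s \<in> {0..pi/2}"
  shows "(P - sofa_path s) \<bullet> nu s \<le> 1"
  using outer_right[of "flip P" "pi/2 - s"] assms by (simp add: hall_flip)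

lemma inner_right:
  assumes "1 - 2/3 * coef_a1 \<le> P $ 1" "0 \<le> P $ 2" "s \<in> {0..pi/2}"
  shows "(P - sofa_path s) \<bullet> mu s \<ge> 0"
proof -
  have "cos s \<ge> 0" "sin s \<ge> 0" using assms(3) by (auto intro!: cos_ge_zero sin_ge_zero)
  then have "(P - sofa_B (pi/2)) \<bullet> mu s \<ge> 0"
    using assms by (simp add: sofa_contact_ends inner_plane)
  then show ?thesis using sofa_support_B[OF assms(3), of "pi/2"] by (simp add: inner_diff_left)
qed

lemma sofa_A_range:
  assumes "t \<in> {0..pi/2}"
  shows "1 - 2/3 * coef_a1 \<le> sofa_A t $ 1" "sofa_A t $ 1 \<le> 1"
    "1/2 \<le> sofa_A t $ 2" "sofa_A t $ 2 \<le> 1"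
  using sofa_A_mono[of 0 t] sofa_A_mono[of t "pi/2"] assms by (simp_all add: sofa_contact_ends)

lemma sofa_B_range:
  assumes "t \<in> {0..pi/2}"
  shows "0 \<le> sofa_B t $ 1" "sofa_B t $ 1 \<le> 1 - 2/3 * coef_a1"
    "0 \<le> sofa_B t $ 2" "sofa_B t $ 2 \<le> 1/2"
  using sofa_B_mono[of 0 t] sofa_B_mono[of t "pi/2"] assms by (simp_all add: sofa_contact_ends)

text \<open>Right of the end of \<open>B\<close> no hallway removes anything above the base line, so below \<open>A\<close> everything
  stays.\<close>

lemma right_lobe_in_shape:
  assumes t: "t \<in> {0..pi/2}" and P: "P $ 1 = sofa_A t $ 1" "0 \<le> P $ 2" "P $ 2 \<le> sofa_A t $ 2"
  shows "P \<in> shape_of sofa_path"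
proof -
  note r = sofa_A_range[OF t] and a = coef_a1_facts(5,6)
  have "in_hall sofa_path s P" if s: "s \<in> {0..pi/2}" for s
    unfolding in_hall_def
  proof (intro conjI)
    have "sin s \<ge> 0" using s by (auto intro!: sin_ge_zero)
    then have "(P - sofa_A t) \<bullet> mu s \<le> 0" using P by (simp add: inner_plane mult_nonpos_nonneg)
    then show "(P - sofa_path s) \<bullet> mu s \<le> 1"
      using sofa_support_A[OF s t] by (simp add: inner_diff_left)
    show "(P - sofa_path s) \<bullet> nu s \<le> 1" by (rule outer_left) (use P r a s in auto)
    show "0 \<le> (P - sofa_path s) \<bullet> mu s \<or> 0 \<le> (P - sofa_path s) \<bullet> nu s"
      using inner_right[of P s] P r s by auto
  qed
  then show ?thesis using P r a by (simp add: mem_shape_of sofa_contact_ends)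
qed

lemma middle_in_shape:
  assumes P: "1 - 2 * coef_a1 \<le> P $ 1" "P $ 1 \<le> 1 - 2/3 * coef_a1" "0 \<le> P $ 2" "P $ 2 \<le> 1"
    and inner: "\<And>s. s \<in> {0..pi/2} \<Longrightarrow> (P - sofa_path s) \<bullet> mu s \<ge> 0 \<or> (P - sofa_path s) \<bullet> nu s \<ge> 0"
  shows "P \<in> shape_of sofa_path"
proof -
  have "in_hall sofa_path s P" if s: "s \<in> {0..pi/2}" for s
    using outer_right[of P s] outer_left[of P s] inner[OF s] P s by (simp add: in_hall_def)
  then show ?thesis using P coef_a1_facts(5) by (simp add: mem_shape_of sofa_contact_ends)
qed

text \<open>The removed quadrants extend downwards: what lies above a point outside of them lies outside as well.\<close>

lemma above_B_in_shape:
  assumes t: "t \<in> {0..pi/2}" and P: "P $ 1 = sofa_B t $ 1" "sofa_B t $ 2 \<le> P $ 2" "P $ 2 \<le> 1"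
  shows "P \<in> shape_of sofa_path"
proof (rule middle_in_shape)
  show "1 - 2 * coef_a1 \<le> P $ 1" "P $ 1 \<le> 1 - 2/3 * coef_a1" "0 \<le> P $ 2" "P $ 2 \<le> 1"
    using P sofa_B_range[OF t] coef_a1_facts(5) by auto
  fix s :: real assume s: "s \<in> {0..pi/2}"
  then have "sin s \<ge> 0" by (auto intro!: sin_ge_zero)
  then have "(P - sofa_B t) \<bullet> mu s \<ge> 0" using P by (simp add: inner_plane)
  then show "(P - sofa_path s) \<bullet> mu s \<ge> 0 \<or> (P - sofa_path s) \<bullet> nu s \<ge> 0"
    using sofa_support_B[OF s t] by (simp add: inner_diff_left)
qed

lemma corner_angle:
  "coef_F * cos (3/2 * (t - pi/4)) = coef_F * cos (mid_angle t) * sin t + coef_F * sin (mid_angle t) * cos t"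
  "sqrt 2 * cos (t - pi/4) = sin t + cos t"
proof -
  have "cos (3/2 * (t - pi/4)) = sin (pi/2 + 3/2 * (t - pi/4))" by (simp add: sin_add)
  also have "pi/2 + 3/2 * (t - pi/4) = t + mid_angle t" by (simp add: field_simps)
  also have "sin (t + mid_angle t) = sin t * cos (mid_angle t) + cos t * sin (mid_angle t)" by (rule sin_add)
  finally show "coef_F * cos (3/2 * (t - pi/4)) = coef_F * cos (mid_angle t) * sin t + coef_F * sin (mid_angle t) * cos t"
    by (simp only: distrib_left mult_ac)
  show "sqrt 2 * cos (t - pi/4) = sin t + cos t"
    unfolding cos_diff cos_45 sin_45 by (simp add: field_simps)
qed

text \<open>Measured from time \<open>pi/4\<close>, the corner has height \<open>F cos (3s/2) - sqrt 2 cos s\<close> over the middle line;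
  this is not positive, as \<open>F \<le> sqrt 2\<close> and \<open>cos (3s/2) \<le> cos s\<close> for \<open>\<bar>s\<bar> \<le> pi/4\<close>.\<close>

lemma corner_path_height:
  assumes t: "t \<in> {beta0..pi/2 - beta0}"
  shows "sofa_path t $ 2 = 1/2 + coef_F * cos (3/2 * (t - pi/4)) - sqrt 2 * cos (t - pi/4)"
    "sofa_path t $ 2 \<le> 1/2"
proof -
  define s where "s = t - pi/4"
  show eq: "sofa_path t $ 2 = 1/2 + coef_F * cos (3/2 * (t - pi/4)) - sqrt 2 * cos (t - pi/4)"
    unfolding corner_angle sofa_path_phase(2)[OF t] x6_frame
    by (simp add: kappa6_def algebra_simps)
  have abs: "\<bar>s\<bar> \<le> pi/4" using t beta0_pos by (auto simp: s_def abs_if)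
  have "cos (3/2 * \<bar>s\<bar>) \<le> cos \<bar>s\<bar>"
    using abs by (intro cos_monotone_0_pi_le) auto
  then have "cos (3/2 * s) \<le> cos s" by (simp add: abs_if split: if_splits)
  moreover have "cos s \<ge> 0" using abs by (intro cos_ge_zero) auto
  ultimately have "coef_F * cos (3/2 * s) \<le> sqrt 2 * cos s"
    using coef_F_pos coef_F_le by (meson less_imp_le mult_left_mono mult_right_mono order_trans)
  then show "sofa_path t $ 2 \<le> 1/2" by (simp add: eq s_def)
qed

lemma corner_path_range:
  assumes t: "t \<in> {beta0..pi/2 - beta0}"
  shows "1 - 2 * coef_a1 \<le> sofa_path t $ 1" "sofa_path t $ 1 \<le> 1 - 2/3 * coef_a1" "0 \<le> sofa_path t $ 2"
proof -
  have *: "sofa_path t $ 1 \<le> 1 - 2/3 * coef_a1 \<and> 0 \<le> sofa_path t $ 2" if t: "t \<in> {beta0..pi/2 - beta0}" for t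
  proof -
    have t': "t \<in> {0..pi/2}" using t beta0_pos by auto
    have "cos t \<ge> 0" "sin t \<ge> 0" using t' by (auto intro!: cos_ge_zero sin_ge_zero)
    then have "sofa_p t * cos t \<le> 0" "sofa_p t * sin t \<le> 0"
      using sofa_p_mid(2)[OF t] by (auto simp: mult_nonpos_nonneg)
    moreover have "sofa_B t $ 1 = sofa_path t $ 1 - sofa_p t * sin t"
       "sofa_B t $ 2 = sofa_path t $ 2 + sofa_p t * cos t"
      by (simp_all add: path_B_def path_D_def)
    ultimately show ?thesis using sofa_B_range[OF t'] by linarith
  qed
  have t': "pi/2 - t \<in> {beta0..pi/2 - beta0}" "t \<in> {0..pi/2}" using t beta0_pos by auto
  show "sofa_path t $ 1 \<le> 1 - 2/3 * coef_a1" "0 \<le> sofa_path t $ 2" using *[OF t] by auto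
  show "1 - 2 * coef_a1 \<le> sofa_path t $ 1"
    using *[OF t'(1)] sofa_path_flip[OF t'(2)] by simp
qed

text \<open>At a later time \<open>s\<close> the corner \<open>x t\<close> is seen beyond \<open>B t\<close>, which lies in front of the wall of \<open>B\<close>; at an
  earlier time it is seen beyond \<open>D t\<close>. So it is never in the removed quadrant.\<close>

lemma above_corner_in_shape:
  assumes t: "t \<in> {beta0..pi/2 - beta0}" and P: "P $ 1 = sofa_path t $ 1" "sofa_path t $ 2 \<le> P $ 2" "P $ 2 \<le> 1"
  shows "P \<in> shape_of sofa_path"
proof (rule middle_in_shape)
  show "1 - 2 * coef_a1 \<le> P $ 1" "P $ 1 \<le> 1 - 2/3 * coef_a1" "0 \<le> P $ 2" "P $ 2 \<le> 1"
    using P corner_path_range[OF t] by auto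
  fix s :: real assume s: "s \<in> {0..pi/2}"
  have t': "t \<in> {0..pi/2}" using t beta0_pos by auto
  have sc: "sin s \<ge> 0" "cos s \<ge> 0" using s by (auto intro!: sin_ge_zero cos_ge_zero)
  have up: "(sofa_path t - sofa_path s) \<bullet> mu s \<le> (P - sofa_path s) \<bullet> mu s"
     "(sofa_path t - sofa_path s) \<bullet> nu s \<le> (P - sofa_path s) \<bullet> nu s"
    using P sc by (simp_all add: inner_plane mult_right_mono)
  show "(P - sofa_path s) \<bullet> mu s \<ge> 0 \<or> (P - sofa_path s) \<bullet> nu s \<ge> 0"
  proof (cases "t \<le> s")
    case True
    have "sin (s - t) \<ge> 0" using True s t' by (intro sin_ge_zero) auto
    then have "sofa_p t * sin (s - t) \<le> 0" using sofa_p_mid(2)[OF t] by (simp add: mult_nonpos_nonneg)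
    moreover have "(sofa_B t - sofa_path s) \<bullet> mu s = (sofa_path t - sofa_path s) \<bullet> mu s + sofa_p t * sin (s - t)"
      by (simp add: path_B_def path_D_def inner_add_left inner_diff_left frame_inner)
    ultimately show ?thesis using sofa_support_B[OF s t'] up by linarith
  next
    case False
    have "sin (t - s) \<ge> 0" using False s t' by (intro sin_ge_zero) auto
    then have "sofa_q t * sin (t - s) \<ge> 0" using sofa_q_mid(1)[OF t] by simp
    moreover have "(sofa_D t - sofa_path s) \<bullet> nu s = (sofa_path t - sofa_path s) \<bullet> nu s - sofa_q t * sin (t - s)"
      by (simp add: path_B_def path_D_def inner_diff_left frame_inner)
    ultimately show ?thesis using sofa_support_D[OF s t'] up by linarith
  qed
qed

lemma contact_points_in_shape:
  "t \<in> {0..pi/2} \<Longrightarrow> sofa_A t \<in> shape_of sofa_path"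
  "t \<in> {0..pi/2} \<Longrightarrow> sofa_B t \<in> shape_of sofa_path"
  "t \<in> {0..pi/2} \<Longrightarrow> sofa_C t \<in> shape_of sofa_path"
  "t \<in> {0..pi/2} \<Longrightarrow> sofa_D t \<in> shape_of sofa_path"
  "t \<in> {beta0..pi/2 - beta0} \<Longrightarrow> sofa_path t \<in> shape_of sofa_path"
proof -
  show A: "t \<in> {0..pi/2} \<Longrightarrow> sofa_A t \<in> shape_of sofa_path" for t
    using right_lobe_in_shape[of t "sofa_A t"] sofa_A_range[of t] by simp
  show B: "t \<in> {0..pi/2} \<Longrightarrow> sofa_B t \<in> shape_of sofa_path" for t
    using above_B_in_shape[of t "sofa_B t"] sofa_B_range[of t] by simp
  show "t \<in> {0..pi/2} \<Longrightarrow> sofa_C t \<in> shape_of sofa_path"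
    using A[of "pi/2 - t"] sofa_contact_flip(1)[of "pi/2 - t"] by (simp add: shape_flip)
  show "t \<in> {0..pi/2} \<Longrightarrow> sofa_D t \<in> shape_of sofa_path"
    using B[of "pi/2 - t"] sofa_contact_flip(2)[of "pi/2 - t"] by (simp add: shape_flip)
  show "t \<in> {beta0..pi/2 - beta0} \<Longrightarrow> sofa_path t \<in> shape_of sofa_path"
    using above_corner_in_shape[of t "sofa_path t"] corner_path_height(2)[of t] by simp
qed

section \<open>The contacts of the explicit path\<close>

lemma sofa_unique_tangency: "unique_tangency sofa_path"
  by (rule P1_unique_tangency[OF sofa_P1])

lemma sofa_contact_A: "t \<in> {0<..<pi/2} \<Longrightarrow> Pt_A \<in> Gamma sofa_path t"
  using contact_points_in_shape(1)[of t] path_inner(1,2)[of sofa_path t] sofa_p_le[of t]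
  by (auto simp: Gamma_def wall_A_def inner_diff_left)

lemma sofa_contact_C:
  assumes "t \<in> {0<..<pi/2}"
  shows "Pt_C \<in> Gamma sofa_path t"
proof -
  have "sofa_q t \<ge> -1" using sofa_q_flip[of t] sofa_p_le[of "pi/2 - t"] assms by simp
  then show ?thesis
    using contact_points_in_shape(3)[of t] path_inner(5,6)[of sofa_path t] assms
    by (auto simp: Gamma_def wall_C_def inner_diff_left)
qed

lemma inner_tangencyI:
  assumes corner: "x t \<in> shape_of x"
    and F: "F \<in> {at_left t, at_right t}" and off: "\<forall>\<^sub>F s in F. Z s \<in> inner_off_corner W x s"
    and Z: "continuous_on {0..pi/2} Z" "t \<in> {0<..<pi/2}" "Z t = x t"
  shows "x t \<in> inner_tangency W x t"
proof -
  have "continuous_on {0<..<pi/2} Z"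
    using Z(1) by (rule continuous_on_subset) auto
  then have "(Z \<longlongrightarrow> Z t) (at t)"
    using Z(2) by (simp add: continuous_on_eq_continuous_at isCont_def)
  moreover have "F \<le> at t" using F by (auto intro: at_le)
  ultimately have "(Z \<longlongrightarrow> x t) F" using tendsto_mono Z(3) by metis
  then have "path_meets_corner W x t"
    unfolding path_meets_corner_def using F off by blast
  then show ?thesis using corner by (simp add: inner_tangency_def)
qed

lemma sofa_off_corner_B:
  assumes "beta0 < t" "t < pi/2"
  shows "sofa_B t \<in> inner_off_corner wall_B sofa_path t"
proof -
  have t: "t \<in> {0..pi/2}" using assms beta0_pos by simp
  have "sofa_p t < 0" using sofa_p_neg assms by simp
  then have "sofa_B t \<noteq> sofa_path t"
    using path_inner(4)[of sofa_path t] by auto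
  then show ?thesis
    using contact_points_in_shape(2)[OF t] path_inner(3,4)[of sofa_path t] \<open>sofa_p t < 0\<close>
    by (simp add: inner_off_corner_def wall_B_def inner_diff_left)
qed

lemma sofa_off_corner_D:
  assumes "0 < t" "t < pi/2 - beta0"
  shows "sofa_D t \<in> inner_off_corner wall_D sofa_path t"
proof -
  have t: "t \<in> {0..pi/2}" using assms beta0_pos by simp
  have "sofa_q t > 0" using sofa_q_pos assms by simp
  then have "sofa_D t \<noteq> sofa_path t"
    using path_inner(7)[of sofa_path t] by auto
  then show ?thesis
    using contact_points_in_shape(4)[OF t] path_inner(7,8)[of sofa_path t] \<open>sofa_q t > 0\<close>
    by (simp add: inner_off_corner_def wall_D_def inner_diff_left)
qed

text \<open>At time \<open>beta0\<close> the contact point \<open>B\<close> coincides with the corner and counts as a tangency point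
  because it leaves the corner immediately afterwards.\<close>

lemma sofa_contact_B:
  assumes "beta0 \<le> t" "t < pi/2"
  shows "Pt_B \<in> Gamma sofa_path t"
proof (cases "t = beta0")
  case False
  then show ?thesis using sofa_off_corner_B[of t] assms
    by (auto simp: Gamma_def inner_tangency_def)
next
  case True
  have "sofa_path beta0 \<in> inner_tangency wall_B sofa_path beta0"
  proof (rule inner_tangencyI[where F="at_right beta0" and Z="sofa_B"])
    show "sofa_path beta0 \<in> shape_of sofa_path"
      using beta0_less pi_gt_zero
      by (intro contact_points_in_shape) (unfold atLeastAtMost_iff, linarith)
    have "\<forall>\<^sub>F s in at_right beta0. s \<in> {beta0<..<pi/2}"
      using beta0_less pi_gt_zero by (intro eventually_at_right_real) linarith
    then show "\<forall>\<^sub>F s in at_right beta0. sofa_B s \<in> inner_off_corner wall_B sofa_path s"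
      by eventually_elim (simp add: sofa_off_corner_B)
    show "beta0 \<in> {0<..<pi/2}"
      using beta0_pos beta0_less pi_gt_zero unfolding greaterThanLessThan_iff by linarith
  qed (use P1_continuous_path_B[OF sofa_P1] sofa_p_beta0 in \<open>simp_all add: path_B_def path_D_def\<close>)
  then show ?thesis using True by (auto simp: Gamma_def)
qed

lemma sofa_contact_D:
  assumes "0 < t" "t \<le> pi/2 - beta0"
  shows "Pt_D \<in> Gamma sofa_path t"
proof (cases "t = pi/2 - beta0")
  case False
  then show ?thesis using sofa_off_corner_D[of t] assms
    by (auto simp: Gamma_def inner_tangency_def)
next
  case True
  let ?t = "pi/2 - beta0"
  have "sofa_path ?t \<in> inner_tangency wall_D sofa_path ?t"
  proof (rule inner_tangencyI[where F="at_left ?t" and Z="sofa_D"])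
    show "sofa_path ?t \<in> shape_of sofa_path"
      using beta0_less pi_gt_zero
      by (intro contact_points_in_shape) (unfold atLeastAtMost_iff, linarith)
    have "\<forall>\<^sub>F s in at_left ?t. s \<in> {0<..<?t}"
      using beta0_less pi_gt_zero by (intro eventually_at_left_real) linarith
    then show "\<forall>\<^sub>F s in at_left ?t. sofa_D s \<in> inner_off_corner wall_D sofa_path s"
      by eventually_elim (simp add: sofa_off_corner_D)
    show "?t \<in> {0<..<pi/2}" using beta0_pos beta0_less pi_gt_zero unfolding greaterThanLessThan_iff by linarith
  qed (use P1_continuous_path_D[OF sofa_P1] sofa_q_flip_beta0 in \<open>simp_all add: path_B_def path_D_def\<close>)
  then show ?thesis using True by (auto simp: Gamma_def)
qed

lemma contact_set_eqI:
  assumes "\<And>k. k \<in> {Pt_x, Pt_A, Pt_B, Pt_C, Pt_D} \<Longrightarrow> k \<in> X \<longleftrightarrow> k \<in> Y"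
  shows "X = Y"
proof (rule set_eqI)
  fix k show "k \<in> X \<longleftrightarrow> k \<in> Y" using assms[of k] by (cases k) auto
qed

lemma sofa_Gamma_phase1:
  assumes "0 < t" "t < beta0"
  shows "Gamma sofa_path t = {Pt_A, Pt_C, Pt_D}"
proof -
  have t: "t \<in> {0<..<pi/2}" using assms beta0_less by simp
  have pq: "sofa_p t > 0" "sofa_q t > 0" using sofa_pq_phase1[of t] assms by simp_all
  have "Pt_x \<notin> Gamma sofa_path t"
    using corner_not_in_shape[OF sofa_P1 t] pq by (simp add: Gamma_def)
  moreover have "Pt_B \<notin> Gamma sofa_path t"
    using tangency_B[OF sofa_P1 t] pq by (force simp: Gamma_def)
  moreover have "{Pt_A, Pt_C, Pt_D} \<subseteq> Gamma sofa_path t"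
    using sofa_contact_A[OF t] sofa_contact_C[OF t] sofa_contact_D[of t] assms beta0_less by simp
  ultimately show ?thesis by (intro contact_set_eqI) auto
qed

lemma sofa_Gamma_phase5:
  assumes "pi/2 - beta0 < t" "t < pi/2"
  shows "Gamma sofa_path t = {Pt_A, Pt_B, Pt_C}"
proof -
  have t: "t \<in> {0<..<pi/2}" using assms beta0_less by simp
  have pq: "sofa_p t < 0" "sofa_q t < 0" using sofa_pq_phase5[of t] assms by simp_all
  have "Pt_x \<notin> Gamma sofa_path t"
    using corner_not_in_shape[OF sofa_P1 t] pq by (simp add: Gamma_def)
  moreover have "Pt_D \<notin> Gamma sofa_path t"
    using tangency_D[OF sofa_P1 t] pq by (force simp: Gamma_def)
  moreover have "{Pt_A, Pt_B, Pt_C} \<subseteq> Gamma sofa_path t"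
    using sofa_contact_A[OF t] sofa_contact_C[OF t] sofa_contact_B[of t] assms beta0_less by simp
  ultimately show ?thesis by (intro contact_set_eqI) auto
qed

lemma sofa_Gamma_phase6:
  assumes "beta0 \<le> t" "t \<le> pi/2 - beta0"
  shows "Gamma sofa_path t = {Pt_x, Pt_A, Pt_B, Pt_C, Pt_D}"
proof -
  have t: "t \<in> {0<..<pi/2}" using assms beta0_pos by simp
  have "Pt_x \<in> Gamma sofa_path t"
    using contact_points_in_shape(5)[of t] assms by (simp add: Gamma_def)
  then have "{Pt_x, Pt_A, Pt_B, Pt_C, Pt_D} \<subseteq> Gamma sofa_path t"
    using sofa_contact_A[OF t] sofa_contact_C[OF t] sofa_contact_B[of t] sofa_contact_D[of t] assms t by simp
  then show ?thesis by (intro contact_set_eqI) auto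
qed

lemma sofa_P4: "P4 beta0 sofa_path"
  unfolding P4_def
  using beta0_pos beta0_less sofa_Gamma_phase1 sofa_Gamma_phase6 sofa_Gamma_phase5 by blast

text \<open>The necessary conditions express the acceleration through the velocity, continuously within each
  phase.\<close>

lemma necessary_conditions_C2:
  assumes P1: "P1 x" and N: "necessary_conditions \<beta> x" and b: "0 < \<beta>" "\<beta> < pi/4"
    and t: "t \<in> {0<..<pi/2} - {\<beta>, pi/2 - \<beta>}"
  shows "C2_at x t"
proof -
  define U where "U = {0<..<pi/2} - {\<beta>, pi/2 - \<beta>}"
  have U: "open U" unfolding U_def by (intro open_Diff) auto
  define acc where "acc s = (rate_B \<beta> x s - 2 * (vel x s \<bullet> nu s)) *\<^sub>R mu s
     + (2 * (vel x s \<bullet> mu s) - rate_D \<beta> x s) *\<^sub>R nu s" for s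
  have acc: "(vel x has_vector_derivative acc s) (at s)" if s: "s \<in> U" for s
  proof -
    obtain a where a: "(vel x has_vector_derivative a) (at s)"
      "a \<bullet> mu s = rate_B \<beta> x s - 2 * (vel x s \<bullet> nu s)"
      "a \<bullet> nu s = 2 * (vel x s \<bullet> mu s) - rate_D \<beta> x s"
      using necessary_conditions_acc[OF N b] s unfolding U_def by blast
    have "a = acc s" unfolding acc_def a(2,3)[symmetric] by (rule frame_expand)
    with a(1) show ?thesis by simp
  qed
  have ev: "\<forall>\<^sub>F s in nhds t. s \<in> U" using U t by (intro eventually_nhds_in_open) (auto simp: U_def)
  have vel: "continuous_on U (vel x)"
    using P1_continuous_vel[OF P1] by (rule continuous_on_subset) (auto simp: U_def)
  have cont: "isCont f t" if "open V" "t \<in> V" "continuous_on V g" "\<And>s. s \<in> V \<Longrightarrow> f s = g s"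
    for f g :: "real \<Rightarrow> plane" and V
  proof -
    have "continuous_on V f" using that(3,4) continuous_on_eq by metis
    then show ?thesis using that(1,2) continuous_on_eq_continuous_at by blast
  qed
  \<comment> \<open>within each open phase the rates are continuous functions of the velocity\<close>
  have accc: "isCont acc t"
  proof -
    consider "t < \<beta>" | "\<beta> < t" "t < pi/2 - \<beta>" | "pi/2 - \<beta> < t" using t by force
    then show ?thesis
    proof cases
      case 1
      show ?thesis
      proof (rule cont[of "U \<inter> {..<\<beta>}"])
        show "continuous_on (U \<inter> {..<\<beta>}) (\<lambda>s. (- 1 - 2 * (vel x s \<bullet> nu s)) *\<^sub>R mu s
           + (2 * (vel x s \<bullet> mu s) - 1/2) *\<^sub>R nu s)"
          by (intro continuous_intros continuous_on_subset[OF vel]) auto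
      qed (use U t 1 in \<open>auto simp: U_def acc_def rate_B_def rate_D_def\<close>)
    next
      case 2
      show ?thesis
      proof (rule cont[of "U \<inter> {\<beta><..<pi/2 - \<beta>}"])
        show "continuous_on (U \<inter> {\<beta><..<pi/2 - \<beta>}) (\<lambda>s. ((vel x s \<bullet> nu s - 1) / 2 - 2 * (vel x s \<bullet> nu s)) *\<^sub>R mu s
           + (2 * (vel x s \<bullet> mu s) - (vel x s \<bullet> mu s + 1) / 2) *\<^sub>R nu s)"
          by (intro continuous_intros continuous_on_subset[OF vel]) auto
      qed (use U t 2 in \<open>auto simp: U_def acc_def rate_B_def rate_D_def\<close>)
    next
      case 3
      show ?thesis
      proof (rule cont[of "U \<inter> {pi/2 - \<beta><..}"])
        show "continuous_on (U \<inter> {pi/2 - \<beta><..}) (\<lambda>s. (- 1/2 - 2 * (vel x s \<bullet> nu s)) *\<^sub>R mu s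
           + (2 * (vel x s \<bullet> mu s) - 1) *\<^sub>R nu s)"
          by (intro continuous_intros continuous_on_subset[OF vel]) auto
      qed (use U t 3 b in \<open>auto simp: U_def acc_def rate_B_def rate_D_def\<close>)
    qed
  qed
  show ?thesis
    unfolding C2_at_def
  proof
    show "\<forall>\<^sub>F s in nhds t. x differentiable at s \<and> vel x differentiable at s"
      using ev
    proof eventually_elim
      case (elim s)
      then show ?case
        using acc[OF elim] P1_has_vel[OF P1, of s] differentiableI_vector by (auto simp: U_def)
    qed
    have "\<forall>\<^sub>F s in nhds t. vector_derivative (vel x) (at s) = acc s"
      using ev by eventually_elim (rule vector_derivative_at, rule acc)
    then have "isCont (\<lambda>s. vector_derivative (vel x) (at s)) t = isCont acc t"
      by (rule isCont_cong)
    then show "isCont (\<lambda>s. vector_derivative (vel x) (at s)) t"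
      using accc by simp
  qed
qed

lemma sofa_P5: "P5 beta0 sofa_path"
  unfolding P5_def
proof
  fix t assume t: "t \<in> {0<..<pi/2} - {beta0, pi/2 - beta0}"
  have "Pt_x \<in> Gamma sofa_path t \<longrightarrow> sofa_q t \<ge> 0 \<and> sofa_p t \<le> 0"
  proof
    assume "Pt_x \<in> Gamma sofa_path t"
    then have "t \<in> {beta0..pi/2 - beta0}"
      using sofa_Gamma_phase1[of t] sofa_Gamma_phase5[of t] t by force
    then show "sofa_q t \<ge> 0 \<and> sofa_p t \<le> 0" using sofa_p_mid sofa_q_mid by blast
  qed
  then show "well_behaved_at sofa_path t"
    unfolding well_behaved_at_def
    using sofa_contact_rates[OF t, THEN vector_derivative_at] sofa_rates[of t] t
      necessary_conditions_C2[OF sofa_P1 sofa_necessary_conditions beta0_pos beta0_less t]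
    by (simp add: frame_inner)
qed

lemma sofa_path_assumptions: "path_assumptions beta0 sofa_path"
  unfolding path_assumptions_def rotation_path_def
  using sofa_P1 sofa_P2 sofa_P3 sofa_P4 sofa_P5 sofa_unique_tangency P1_continuous sofa_path_0 by blast

section \<open>Uniqueness of the path\<close>

text \<open>The vector \<open>(P, Q)\<close> rotates with angular speed \<open>k\<close>, so its components in the corotating frame are
  constant.\<close>

lemma oscillator:
  fixes P Q \<phi> :: "real \<Rightarrow> real"
  assumes ab: "a \<le> b" and P: "continuous_on {a..b} P" and Q: "continuous_on {a..b} Q"
    and d: "\<And>s. s \<in> {a<..<b} \<Longrightarrow> (P has_real_derivative - k * Q s) (at s)"
      "\<And>s. s \<in> {a<..<b} \<Longrightarrow> (Q has_real_derivative k * P s) (at s)"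
    and \<phi>: "\<And>s. \<phi> s = k * s + c"
    and t: "t \<in> {a..b}"
  shows "P t = (P a * cos (\<phi> a) + Q a * sin (\<phi> a)) * cos (\<phi> t) - (Q a * cos (\<phi> a) - P a * sin (\<phi> a)) * sin (\<phi> t)"
    and "Q t = (P a * cos (\<phi> a) + Q a * sin (\<phi> a)) * sin (\<phi> t) + (Q a * cos (\<phi> a) - P a * sin (\<phi> a)) * cos (\<phi> t)"
proof -
  have \<phi>_def: "\<phi> = (\<lambda>s. k * s + c)" using \<phi> by auto
  have dphi: "(\<phi> has_real_derivative k) (at s)" for s
    unfolding \<phi>_def by (auto intro!: derivative_eq_intros)
  have cphi: "continuous_on X \<phi>" for X unfolding \<phi>_def by (intro continuous_intros)
  have Pt: "continuous_on {a..t} P" and Qt: "continuous_on {a..t} Q"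
    using t by (auto intro: continuous_on_subset[OF P] continuous_on_subset[OF Q])
  have 1: "P t * cos (\<phi> t) + Q t * sin (\<phi> t) = P a * cos (\<phi> a) + Q a * sin (\<phi> a)"
  proof (rule constant_off_finite[of "{}" a t "\<lambda>s. P s * cos (\<phi> s) + Q s * sin (\<phi> s)"])
    fix s assume "s \<in> {a<..<t} - {}"
    then have s: "s \<in> {a<..<b}" using t by auto
    show "((\<lambda>s. P s * cos (\<phi> s) + Q s * sin (\<phi> s)) has_real_derivative 0) (at s)"
      by (rule derivative_eq_intros d[OF s] dphi refl | simp add: algebra_simps)+
  qed (use t in \<open>auto intro!: continuous_intros Pt Qt cphi\<close>)
  have 2: "Q t * cos (\<phi> t) - P t * sin (\<phi> t) = Q a * cos (\<phi> a) - P a * sin (\<phi> a)"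
  proof (rule constant_off_finite[of "{}" a t "\<lambda>s. Q s * cos (\<phi> s) - P s * sin (\<phi> s)"])
    fix s assume "s \<in> {a<..<t} - {}"
    then have s: "s \<in> {a<..<b}" using t by auto
    show "((\<lambda>s. Q s * cos (\<phi> s) - P s * sin (\<phi> s)) has_real_derivative 0) (at s)"
      by (rule derivative_eq_intros d[OF s] dphi refl | simp add: algebra_simps)+
  qed (use t in \<open>auto intro!: continuous_intros Pt Qt cphi\<close>)
  have sc: "cos (\<phi> t) * cos (\<phi> t) + sin (\<phi> t) * sin (\<phi> t) = 1" by simp
  show "P t = (P a * cos (\<phi> a) + Q a * sin (\<phi> a)) * cos (\<phi> t) - (Q a * cos (\<phi> a) - P a * sin (\<phi> a)) * sin (\<phi> t)"
    unfolding 1[symmetric] 2[symmetric] using sc by algebra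
  show "Q t = (P a * cos (\<phi> a) + Q a * sin (\<phi> a)) * sin (\<phi> t) + (Q a * cos (\<phi> a) - P a * sin (\<phi> a)) * cos (\<phi> t)"
    unfolding 1[symmetric] 2[symmetric] using sc by algebra
qed

lemma convex_hall_outer:
  "convex {P. P$1 \<le> 1 \<and> 0 \<le> P$2 \<and> P$2 \<le> 1
      \<and> (\<forall>t\<in>{0..pi/2}. (P - x t) \<bullet> mu t \<le> 1 \<and> (P - x t) \<bullet> nu t \<le> 1)
      \<and> P$1 \<ge> x (pi/2) $ 1 - 1 \<and> x (pi/2) $ 2 \<le> P$2 \<and> P$2 \<le> x (pi/2) $ 2 + 1}"
proof -
  have le: "convex {P :: plane. P \<bullet> a \<le> c}" for a c
    using convex_halfspace_le[of a c] by (simp add: inner_commute)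
  have ge: "convex {P :: plane. c \<le> P \<bullet> a}" for a c
    using convex_halfspace_ge[of c a] by (simp add: inner_commute)
  have c1: "P $ 1 = P \<bullet> mu 0" and c2: "P $ 2 = P \<bullet> nu 0" for P :: plane
    by (simp_all add: inner_plane)
  have "convex ({P. P \<bullet> mu 0 \<le> 1} \<inter> {P. 0 \<le> P \<bullet> nu 0} \<inter> {P. P \<bullet> nu 0 \<le> 1}
      \<inter> (\<Inter>t\<in>{0..pi/2}. {P. P \<bullet> mu t \<le> 1 + x t \<bullet> mu t} \<inter> {P. P \<bullet> nu t \<le> 1 + x t \<bullet> nu t})
      \<inter> {P. x (pi/2) $ 1 - 1 \<le> P \<bullet> mu 0} \<inter> {P. x (pi/2) $ 2 \<le> P \<bullet> nu 0} \<inter> {P. P \<bullet> nu 0 \<le> x (pi/2) $ 2 + 1})"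
    by (intro convex_Int convex_INT le ge)
  also have "({P. P \<bullet> mu 0 \<le> 1} \<inter> {P. 0 \<le> P \<bullet> nu 0} \<inter> {P. P \<bullet> nu 0 \<le> 1}
      \<inter> (\<Inter>t\<in>{0..pi/2}. {P. P \<bullet> mu t \<le> 1 + x t \<bullet> mu t} \<inter> {P. P \<bullet> nu t \<le> 1 + x t \<bullet> nu t})
      \<inter> {P. x (pi/2) $ 1 - 1 \<le> P \<bullet> mu 0} \<inter> {P. x (pi/2) $ 2 \<le> P \<bullet> nu 0} \<inter> {P. P \<bullet> nu 0 \<le> x (pi/2) $ 2 + 1}) =
    {P. P$1 \<le> 1 \<and> 0 \<le> P$2 \<and> P$2 \<le> 1
      \<and> (\<forall>t\<in>{0..pi/2}. (P - x t) \<bullet> mu t \<le> 1 \<and> (P - x t) \<bullet> nu t \<le> 1)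
      \<and> P$1 \<ge> x (pi/2) $ 1 - 1 \<and> x (pi/2) $ 2 \<le> P$2 \<and> P$2 \<le> x (pi/2) $ 2 + 1}"
    by (auto simp: c1 c2 inner_diff_left algebra_simps simp del: mu_nth nu_nth)
  finally show ?thesis .
qed

text \<open>The outer conditions cut out a convex set, so only the inner conditions remain to be checked.\<close>

lemma shape_convex_combination:
  assumes PQR: "P \<in> shape_of x" "Q \<in> shape_of x" "R \<in> shape_of x"
    and uvw: "0 \<le> u" "0 \<le> v" "0 \<le> w" "u + v + w = 1" and Z: "Z = u *\<^sub>R P + v *\<^sub>R Q + w *\<^sub>R R"
    and inner: "\<And>s. s \<in> {0..pi/2} \<Longrightarrow> (Z - x s) \<bullet> mu s \<ge> 0"
  shows "Z \<in> shape_of x"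
proof -
  let ?H = "{P. P$1 \<le> 1 \<and> 0 \<le> P$2 \<and> P$2 \<le> 1
      \<and> (\<forall>t\<in>{0..pi/2}. (P - x t) \<bullet> mu t \<le> 1 \<and> (P - x t) \<bullet> nu t \<le> 1)
      \<and> P$1 \<ge> x (pi/2) $ 1 - 1 \<and> x (pi/2) $ 2 \<le> P$2 \<and> P$2 \<le> x (pi/2) $ 2 + 1}"
  have "convex hull {P, Q, R} \<subseteq> ?H"
    by (intro hull_minimal convex_hall_outer) (use PQR in \<open>auto simp: mem_shape_of in_hall_def\<close>)
  moreover have "Z \<in> convex hull {P, Q, R}"
    unfolding convex_hull_3 Z using uvw by blast
  ultimately have "Z \<in> ?H" by blast
  then show ?thesis using inner by (simp add: mem_shape_of in_hall_def)
qed

text \<open>A path that satisfies all assumptions of the theorem, with its own critical angle \<open>\<beta>\<close>. In the frame its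
  velocity \<open>(p, q)\<close> is a harmonic oscillator in each phase. The initial conditions and the mirror symmetry
  leave one free parameter, which \<open>p \<beta> = 0\<close> determines.\<close>

context
  fixes \<beta> :: real and y :: "real \<Rightarrow> plane"
  assumes PA: "path_assumptions \<beta> y" and N: "necessary_conditions \<beta> y"
begin

abbreviation (input) "p t \<equiv> vel y t \<bullet> mu t"
abbreviation (input) "q t \<equiv> vel y t \<bullet> nu t"

lemma yP1: "P1 y" and yP2: "P2 y" and yP3: "P3 y" and yP4: "P4 \<beta> y" and yP5: "P5 \<beta> y" and y0: "y 0 = 0"
  using PA by (auto simp: path_assumptions_def rotation_path_def)

lemma yb: "0 < \<beta>" "\<beta> < pi/4"
  using yP4 by (auto simp: P4_def)

lemma candidate_pq_deriv:
  assumes t: "t \<in> {0<..<pi/2} - {\<beta>, pi/2 - \<beta>}"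
  shows "((\<lambda>s. p s) has_real_derivative rate_B \<beta> y t - q t) (at t)"
    "((\<lambda>s. q s) has_real_derivative p t - rate_D \<beta> y t) (at t)"
proof -
  obtain acc where acc: "(vel y has_vector_derivative acc) (at t)"
    "acc \<bullet> mu t = rate_B \<beta> y t - 2 * q t" "acc \<bullet> nu t = 2 * p t - rate_D \<beta> y t"
    using necessary_conditions_acc[OF N yb t] by blast
  show "((\<lambda>s. p s) has_real_derivative rate_B \<beta> y t - q t) (at t)"
    "((\<lambda>s. q s) has_real_derivative p t - rate_D \<beta> y t) (at t)"
    using frame_velocity_deriv[OF acc(1)] acc(2,3) by simp_all
qed

lemma candidate_pq_continuous: "continuous_on {0..pi/2} (\<lambda>s. p s)" "continuous_on {0..pi/2} (\<lambda>s. q s)"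
  by (intro continuous_intros P1_continuous_vel yP1)+

text \<open>The pair \<open>(p - 1/2, q + 1)\<close> rotates with unit speed, and \<open>P3\<close> makes its first component start at \<open>0\<close>.\<close>

lemma candidate_phase1:
  assumes t: "t \<in> {0..\<beta>}"
  shows "p t = 1/2 - (q 0 + 1) * sin t" "q t = (q 0 + 1) * cos t - 1"
proof -
  have p0: "p 0 = 1/2"
    using yP3 by (simp add: P3_def path_A_def plane_eq_iff y0)
  have c: "continuous_on {0..\<beta>} (\<lambda>s. p s - 1/2)" "continuous_on {0..\<beta>} (\<lambda>s. q s + 1)"
    using yb by (auto intro!: continuous_intros continuous_on_subset[OF candidate_pq_continuous(1)]
       continuous_on_subset[OF candidate_pq_continuous(2)])
  have d: "((\<lambda>s. p s - 1/2) has_real_derivative - 1 * (q s + 1)) (at s)"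
     "((\<lambda>s. q s + 1) has_real_derivative 1 * (p s - 1/2)) (at s)" if "s \<in> {0<..<\<beta>}" for s
  proof -
    have s: "s \<in> {0<..<pi/2} - {\<beta>, pi/2 - \<beta>}" using that yb by auto
    have "rate_B \<beta> y s = -1" "rate_D \<beta> y s = 1/2" using that by (simp_all add: rate_B_def rate_D_def)
    with candidate_pq_deriv[OF s] show "((\<lambda>s. p s - 1/2) has_real_derivative - 1 * (q s + 1)) (at s)"
     "((\<lambda>s. q s + 1) has_real_derivative 1 * (p s - 1/2)) (at s)"
      by (auto intro!: derivative_eq_intros)
  qed
  have "0 \<le> \<beta>" using yb by simp
  from oscillator[OF this c d, of "\<lambda>s. s" 0, OF _ _ _ t]
  show "p t = 1/2 - (q 0 + 1) * sin t" "q t = (q 0 + 1) * cos t - 1"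
    by (simp_all add: p0)
qed

lemma candidate_flip:
  assumes "t \<in> {0..pi/2}"
  shows "p (pi/2 - t) = - q t" "q (pi/2 - t) = - p t"
proof -
  have "vel y (pi/2 - t) = vector [vel y t $ 1, - (vel y t $ 2)]"
    using yP2 assms unfolding P2_def matrix2_mult by simp
  then show "p (pi/2 - t) = - q t" "q (pi/2 - t) = - p t"
    by (simp_all add: inner_plane frame_flip algebra_simps)
qed

text \<open>The pair \<open>(p - 1, q + 1)\<close> rotates with speed \<open>1/2\<close>. The mirror symmetry gives \<open>p = - q\<close> at \<open>pi/4\<close>, which
  forces one of the two amplitudes to vanish.\<close>

lemma candidate_phase6:
  assumes t: "t \<in> {\<beta>..pi/2 - \<beta>}"
  shows "(p t - 1) * cos (mid_angle t) + (q t + 1) * sin (mid_angle t) = 0"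
    "(q t + 1) * cos (mid_angle t) - (p t - 1) * sin (mid_angle t) =
       (q \<beta> + 1) * cos (\<beta>/2 + pi/8) - (p \<beta> - 1) * sin (\<beta>/2 + pi/8)"
proof -
  define \<phi> where "\<phi> s = s/2 + pi/8" for s :: real
  have c: "continuous_on {\<beta>..pi/2 - \<beta>} (\<lambda>s. p s - 1)" "continuous_on {\<beta>..pi/2 - \<beta>} (\<lambda>s. q s + 1)"
    using yb by (auto intro!: continuous_intros continuous_on_subset[OF candidate_pq_continuous(1)]
       continuous_on_subset[OF candidate_pq_continuous(2)])
  have d: "((\<lambda>s. p s - 1) has_real_derivative - (1/2) * (q s + 1)) (at s)"
     "((\<lambda>s. q s + 1) has_real_derivative (1/2) * (p s - 1)) (at s)" if "s \<in> {\<beta><..<pi/2 - \<beta>}" for s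
  proof -
    have s: "s \<in> {0<..<pi/2} - {\<beta>, pi/2 - \<beta>}" using that yb by auto
    have "rate_B \<beta> y s = (q s - 1)/2" "rate_D \<beta> y s = (p s + 1)/2" using that by (simp_all add: rate_B_def rate_D_def)
    with candidate_pq_deriv[OF s] show "((\<lambda>s. p s - 1) has_real_derivative - (1/2) * (q s + 1)) (at s)"
     "((\<lambda>s. q s + 1) has_real_derivative (1/2) * (p s - 1)) (at s)"
      by (auto intro!: derivative_eq_intros simp: field_simps)
  qed
  have le: "\<beta> \<le> pi/2 - \<beta>" using yb by simp
  note osc = oscillator[OF le c d, of \<phi> "pi/8"]
  define c1 where "c1 = (p \<beta> - 1) * cos (\<phi> \<beta>) + (q \<beta> + 1) * sin (\<phi> \<beta>)"
  define c2 where "c2 = (q \<beta> + 1) * cos (\<phi> \<beta>) - (p \<beta> - 1) * sin (\<phi> \<beta>)"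
  have sol: "p s - 1 = c1 * cos (\<phi> s) - c2 * sin (\<phi> s)" "q s + 1 = c1 * sin (\<phi> s) + c2 * cos (\<phi> s)"
    if "s \<in> {\<beta>..pi/2 - \<beta>}" for s
    using osc[OF _ _ _ that] by (simp_all add: c1_def c2_def \<phi>_def)
  have m: "pi/4 \<in> {\<beta>..pi/2 - \<beta>}" using yb by simp
  have "pi/2 - pi/4 = pi/4" by simp
  then have pq: "p (pi/4) = - q (pi/4)" using candidate_flip(1)[of "pi/4"] by simp
  have "\<phi> (pi/4) = pi/4" by (simp add: \<phi>_def)
  with sol[OF m] pq have "c1 = 0" by (simp add: cos_45 sin_45 field_simps)
  have sc: "cos (\<phi> t) * cos (\<phi> t) + sin (\<phi> t) * sin (\<phi> t) = 1" by simp
  show "(p t - 1) * cos (mid_angle t) + (q t + 1) * sin (mid_angle t) = 0"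
    using sol[OF t] \<open>c1 = 0\<close> unfolding \<phi>_def[symmetric] by algebra
  show "(q t + 1) * cos (mid_angle t) - (p t - 1) * sin (mid_angle t) =
       (q \<beta> + 1) * cos (\<beta>/2 + pi/8) - (p \<beta> - 1) * sin (\<beta>/2 + pi/8)"
    using sol[OF t] sc unfolding \<phi>_def[symmetric] c2_def[symmetric] by algebra
qed

text \<open>The corner touches the shape throughout the middle phase, so \<open>p \<le> 0\<close> there by good behaviour.\<close>

lemma candidate_p_nonpos: "p \<beta> \<le> 0"
proof -
  have lt: "\<beta> < pi/2 - \<beta>" using yb by simp
  have cl: "closure {\<beta><..<pi/2 - \<beta>} = {\<beta>..pi/2 - \<beta>}" using lt by simp
  show ?thesis
  proof (rule continuous_le_on_closure[of "{\<beta><..<pi/2 - \<beta>}" "\<lambda>s. p s"])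
    show "continuous_on (closure {\<beta><..<pi/2 - \<beta>}) (\<lambda>s. p s)"
      unfolding cl by (rule continuous_on_subset[OF candidate_pq_continuous(1)]) (use yb in auto)
    show "\<beta> \<in> closure {\<beta><..<pi/2 - \<beta>}" unfolding cl using lt by simp
    fix t assume t: "t \<in> {\<beta><..<pi/2 - \<beta>}"
    have "Pt_x \<in> Gamma y t" using yP4 t by (simp add: P4_def)
    moreover have "well_behaved_at y t" using yP5 t yb by (simp add: P5_def)
    ultimately show "p t \<le> 0" by (simp add: well_behaved_at_def)
  qed
qed

lemma candidate_rate_B:
  assumes t: "t \<in> {0<..<pi/2} - {\<beta>, pi/2 - \<beta>}"
  shows "rate_B \<beta> y t \<le> 0"
proof -
  consider "t < \<beta>" | "\<beta> < t" "t < pi/2 - \<beta>" | "pi/2 - \<beta> < t" using t by force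
  then show ?thesis
  proof cases
    case 2
    have "Pt_B \<in> Gamma y t" using yP4 2 by (simp add: P4_def)
    moreover have "well_behaved_at y t" using yP5 t by (simp add: P5_def)
    moreover have "vector_derivative (path_B y) (at t) = rate_B \<beta> y t *\<^sub>R nu t"
      by (rule vector_derivative_at, rule contact_path_rates(2)[OF yP1 N yb t])
    ultimately show ?thesis by (simp add: well_behaved_at_def frame_inner)
  qed (use yb in \<open>simp_all add: rate_B_def\<close>)
qed

lemma candidate_path_A:
  assumes t: "t \<in> {0..\<beta>}"
  shows "path_A y t = vector [1, 1/2]"
proof -
  have "path_A y t $ i = path_A y 0 $ i" for i
  proof (rule constant_off_finite[of "{}" 0 t "\<lambda>s. path_A y s $ i"])
    show "continuous_on {0..t} (\<lambda>s. path_A y s $ i)"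
      by (intro continuous_intros continuous_on_subset[OF P1_continuous_path_A[OF yP1]]) (use t yb in auto)
    fix s assume s: "s \<in> {0<..<t} - {}"
    then have s': "s \<in> {0<..<pi/2} - {\<beta>, pi/2 - \<beta>}" using t yb by auto
    have "rate_B \<beta> y s = -1" using s t by (simp add: rate_B_def)
    then have "(path_A y has_vector_derivative 0) (at s)"
      using contact_path_rates(1)[OF yP1 N yb s'] by simp
    then show "((\<lambda>s. path_A y s $ i) has_real_derivative 0) (at s)"
      using has_real_derivative_nth[of "path_A y" 0 s UNIV i] by simp
  qed (use t in auto)
  then have "path_A y t = path_A y 0" by (simp add: vec_eq_iff)
  then show ?thesis using yP3 by (simp add: P3_def)
qed

text \<open>If \<open>p \<beta> < 0\<close>, then \<open>B \<beta>\<close> is off the corner, and the segment from \<open>B \<beta>\<close> to \<open>y \<beta>\<close> has positive length. During the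
  first phase \<open>B\<close> runs on the unit circle around the fixed contact point \<open>(1, 1/2)\<close>, so shortly before
  \<open>\<beta>\<close> it lies in the triangle of this point, \<open>B \<beta>\<close> and \<open>y \<beta>\<close>, three points of the shape. As \<open>B\<close> never enters a
  removed quadrant, it belongs to the shape: a contact before \<open>\<beta>\<close> that the first phase excludes.\<close>

lemma candidate_p_not_neg: "\<not> p \<beta> < 0"
proof
  assume neg: "p \<beta> < 0"
  define r where "r = - p \<beta>"
  have r: "r > 0" using neg by (simp add: r_def)
  let ?A = "vector [1, 1/2] :: plane"
  have bI: "\<beta> \<in> {0<..<pi/2}" using yb by simp
  have AS: "?A \<in> shape_of y"
  proof -
    have h: "\<beta>/2 \<in> {0<..<pi/2}" "\<beta>/2 \<in> {0..\<beta>}" using yb by auto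
    have "Pt_A \<in> Gamma y (\<beta>/2)" using yP4 yb by (simp add: P4_def)
    then obtain P where P: "P \<in> shape_of y \<inter> wall_A y (\<beta>/2)" by (auto simp: Gamma_def)
    then show ?thesis using contact_A_eq[OF yP1 h(1) P] candidate_path_A[OF h(2)] by simp
  qed
  have G: "Pt_x \<in> Gamma y \<beta>" "Pt_B \<in> Gamma y \<beta>" using yP4 yb by (auto simp: P4_def)
  have xS: "y \<beta> \<in> shape_of y" using G(1) by (simp add: Gamma_def)
  have BS: "path_B y \<beta> \<in> shape_of y"
  proof -
    obtain P where P: "P \<in> inner_tangency wall_B y \<beta>" using G(2) by (auto simp: Gamma_def)
    then have "P \<in> shape_of y" by (auto simp: inner_tangency_def inner_off_corner_def)
    then show ?thesis using tangency_B[OF yP1 bI P] by simp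
  qed
  have Bt: "path_B y t = ?A - mu t" if "t \<in> {0..\<beta>}" for t
    using candidate_path_A[OF that] by (simp add: path_B_A)
  have xb: "y \<beta> = path_B y \<beta> + r *\<^sub>R nu \<beta>" by (simp add: path_B_def r_def)
  have cont_at: "((\<lambda>s. f s) \<longlongrightarrow> f \<beta>) (at_left \<beta>)" if "continuous_on {0..pi/2} f" for f :: "real \<Rightarrow> real"
  proof -
    have "continuous_on {0<..<pi/2} f" using that by (rule continuous_on_subset) auto
    then have "isCont f \<beta>" using bI by (simp add: continuous_on_eq_continuous_at)
    then have "(f \<longlongrightarrow> f \<beta>) (at \<beta>)" by (simp add: isCont_def)
    then show ?thesis by (rule tendsto_mono[rotated]) (simp add: at_le)
  qed
  have "\<forall>\<^sub>F t in at_left \<beta>. p t < 0"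
    using cont_at[OF candidate_pq_continuous(1)] neg by (rule order_tendstoD(2))
  \<comment> \<open>this will make the first barycentric coordinate nonnegative\<close>
  moreover have "\<forall>\<^sub>F t in at_left \<beta>. r * cos (\<beta> - t) - sin (\<beta> - t) > 0"
  proof -
    have "((\<lambda>t. r * cos (\<beta> - t) - sin (\<beta> - t)) \<longlongrightarrow> r * cos (\<beta> - \<beta>) - sin (\<beta> - \<beta>)) (at_left \<beta>)"
      by (rule cont_at) (intro continuous_intros)
    then show ?thesis using r by (intro order_tendstoD(1)) auto
  qed
  moreover have "\<forall>\<^sub>F t in at_left \<beta>. t \<in> {0<..<\<beta>}"
    using yb by (intro eventually_at_left_real) simp
  ultimately have "\<forall>\<^sub>F t in at_left \<beta>. p t < 0 \<and> r * cos (\<beta> - t) - sin (\<beta> - t) > 0 \<and> t \<in> {0<..<\<beta>}"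
    by eventually_elim auto
  then obtain t where t: "p t < 0" "r * cos (\<beta> - t) - sin (\<beta> - t) > 0" "t \<in> {0<..<\<beta>}"
    using eventually_happens'[OF trivial_limit_at_left_real] by blast
  have tI: "t \<in> {0<..<pi/2}" using t yb by auto
  define S where "S = sin (\<beta> - t)"
  define C where "C = cos (\<beta> - t)"
  have S: "S \<ge> 0" unfolding S_def using t yb by (intro sin_ge_zero) auto
  have "path_B y t \<in> shape_of y"
  proof (rule shape_convex_combination[OF BS xS AS, of "C - S/r" "S/r" "1 - C"])
    \<comment> \<open>the barycentric coordinates of \<open>B t\<close>, as \<open>B t = A - mu t\<close> with \<open>mu t = C mu \<beta> - S nu \<beta>\<close>\<close>
    show "0 \<le> C - S/r" "0 \<le> S/r" "0 \<le> 1 - C"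
      using t(2) r S by (simp_all add: C_def S_def field_simps)
    have mu_t: "mu t = C *\<^sub>R mu \<beta> - S *\<^sub>R nu \<beta>"
      by (rule frame_eqI[of _ \<beta>]) (simp_all add: inner_diff_left frame_inner C_def S_def
         cos_diff sin_diff algebra_simps)
    have Bs: "path_B y \<beta> = ?A - mu \<beta>" "path_B y t = ?A - mu t" using Bt yb t by auto
    show "path_B y t = (C - S/r) *\<^sub>R path_B y \<beta> + (S/r) *\<^sub>R y \<beta> + (1 - C) *\<^sub>R ?A"
      unfolding xb Bs mu_t using r by (simp add: algebra_simps)
    show "(path_B y t - y s) \<bullet> mu s \<ge> 0" if "s \<in> {0..pi/2}" for s
      by (rule path_B_support[OF yP1 N yb candidate_rate_B that]) (use tI in auto)
  qed simp
  moreover have "path_B y t \<noteq> y t" using path_inner(4)[of y t] t(1) by auto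
  ultimately have "path_B y t \<in> inner_off_corner wall_B y t"
    using path_inner(3,4)[of y t] t(1) by (simp add: inner_off_corner_def wall_B_def inner_diff_left)
  then have "Pt_B \<in> Gamma y t" by (auto simp: Gamma_def inner_tangency_def)
  then show False using yP4 t(3) by (simp add: P4_def)
qed

text \<open>With \<open>p \<beta> = 0\<close> the two phases meet only if \<open>tan w = 2 tan \<beta>\<close>, where \<open>w = \<beta>/2 + pi/8\<close>. The
  addition theorem for \<open>2 w = \<beta> + pi/4\<close> turns this into the cubic for \<open>tan \<beta>\<close>.\<close>

lemma candidate_beta: "\<beta> = beta0" and candidate_amplitude: "q 0 + 1 = 2 * coef_a1"
proof -
  have p0: "p \<beta> = 0" using candidate_p_nonpos candidate_p_not_neg by simp
  define w where "w = \<beta>/2 + pi/8"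
  define T where "T = tan \<beta>"
  have bI: "\<beta> \<in> {0..\<beta>}" "\<beta> \<in> {\<beta>..pi/2 - \<beta>}" using yb by auto
  have sb: "sin \<beta> > 0" and cb: "cos \<beta> > 0" using yb by (auto intro!: sin_gt_zero cos_gt_zero)
  note half = tan_half_step[OF yb, folded w_def T_def]
  have 1: "(q 0 + 1) * sin \<beta> = 1/2" "q \<beta> + 1 = (q 0 + 1) * cos \<beta>"
    using candidate_phase1[OF bI(1)] p0 by simp_all
  have "sin w * (q \<beta> + 1) = cos w" using candidate_phase6(1)[OF bI(2)] p0 by (simp add: w_def mult.commute)
  then have "sin w * ((q 0 + 1) * cos \<beta>) * sin \<beta> = cos w * sin \<beta>" using 1(2) by simp
  then have "sin w * cos \<beta> * ((q 0 + 1) * sin \<beta>) = cos w * sin \<beta>" by (simp add: mult_ac)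
  then have "sin w * cos \<beta> = 2 * cos w * sin \<beta>" unfolding 1(1) by simp
  then have tw: "tan w = 2 * T" using half(2) cb by (simp add: tan_def T_def field_simps)
  have "4 * T^3 + 3 * T = 1" using half(1) unfolding tw by algebra
  then have "T = T0" by (rule T0_unique)
  have "\<beta> = arctan T" using yb unfolding T_def by (intro arctan_tan[symmetric]) auto
  moreover have "beta0 = arctan T0" by (simp add: beta0_def T0_eq)
  ultimately show b: "\<beta> = beta0" using \<open>T = T0\<close> by simp
  show "q 0 + 1 = 2 * coef_a1"
    using 1(1) sb unfolding b coef_a1_def by (simp add: field_simps)
qed

text \<open>Once \<open>\<beta>\<close> and the amplitude are known, the first phase is determined, the middle phase by its value at
  \<open>beta0\<close>, and the last phase by the mirror symmetry.\<close>

lemma candidate_vel: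
  assumes t: "t \<in> {0..pi/2}"
  shows "vel y t = vel sofa_path t"
proof -
  have ph1: "p t = sofa_p t \<and> q t = sofa_q t" if "t \<in> {0..beta0}" for t
    using candidate_phase1[of t] candidate_beta candidate_amplitude that by (simp add: sofa_pq)
  have ph6: "p t = sofa_p t \<and> q t = sofa_q t" if t: "t \<in> {beta0..pi/2 - beta0}" for t
  proof -
    define w where "w = t/2 + pi/8"
    define w0 where "w0 = beta0/2 + pi/8"
    have "beta0 \<in> {0..beta0}" using beta0_pos by simp
    from ph1[OF this] have e: "p beta0 = 0" "q beta0 = z0/2 - 1"
      using sofa_p_beta0 sofa_pq(4)[of beta0] beta0_pos coef_a1_facts(3) by (simp_all add: mult.assoc)
    have F: "coef_F * sin w0 = 2/3" "coef_F * cos w0 = z0/3" using coef_F_mid_angle by (simp_all add: w0_def)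
    have sc0: "cos w0 * cos w0 + sin w0 * sin w0 = 1" and sc: "cos w * cos w + sin w * sin w = 1" by simp_all
    have "z0/2 * cos w0 + sin w0 = 3/2 * coef_F * (cos w0 * cos w0 + sin w0 * sin w0)"
      using F by algebra
    then have E: "z0/2 * cos w0 + sin w0 = 3/2 * coef_F" using sc0 by simp
    have y6: "(p t - 1) * cos w + (q t + 1) * sin w = 0" "(q t + 1) * cos w - (p t - 1) * sin w = 3/2 * coef_F"
      using candidate_phase6[of t] t candidate_beta e E by (simp_all add: w_def w0_def)
    have "p t - 1 = - (3/2 * coef_F) * sin w"  "q t + 1 = 3/2 * coef_F * cos w"
      using y6 sc by algebra+
    then show ?thesis using t by (simp add: sofa_pq w_def)
  qed
  have "p t = sofa_p t \<and> q t = sofa_q t"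
    using t
  proof (cases rule: phase_cases)
    case 3
    then have "pi/2 - t \<in> {0..beta0}" by auto
    then show ?thesis using ph1[of "pi/2 - t"] candidate_flip[OF t] sofa_vel_flip[OF t] by simp
  qed (use ph1 ph6 in auto)
  then show ?thesis by (intro frame_eqI[of _ t]) auto
qed

lemma candidate_eq_sofa_path:
  assumes t: "t \<in> {0..pi/2}"
  shows "y t = sofa_path t"
proof -
  have "((\<lambda>s. y s - sofa_path s) has_vector_derivative 0) (at s within {0..pi/2})" if "s \<in> {0..pi/2}" for s
    using has_vector_derivative_diff[OF P1_has_vel_within[OF yP1 that] P1_has_vel_within[OF sofa_P1 that]]
    by (simp add: candidate_vel[OF that])
  then obtain c where c: "\<And>s. s \<in> {0..pi/2} \<Longrightarrow> y s - sofa_path s = c"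
    using has_vector_derivative_zero_constant[of "{0..pi/2}" "\<lambda>s. y s - sofa_path s"] by auto
  from c[of 0] have "c = 0" using y0 sofa_path_0 by simp
  then show ?thesis using c[OF t] by simp
qed

end

section \<open>Vertical slices of the ambidextrous shape\<close>

lemma refl_half_nth [simp]: "refl_half P $ 1 = P$1" "refl_half P $ 2 = 1 - P$2"
  by (simp_all add: refl_half_def)

lemma refl_half_invol [simp]: "refl_half (refl_half P) = P"
  by (simp add: plane_eq_iff)

lemma mem_refl_half_image: "P \<in> refl_half ` X \<longleftrightarrow> refl_half P \<in> X"
  by (metis image_iff refl_half_invol)

lemma mem_sofa: "P \<in> sofa \<longleftrightarrow> P \<in> shape_of sofa_path \<and> refl_half P \<in> shape_of sofa_path"
  by (simp add: sofa_def mem_refl_half_image)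

text \<open>The vertical line through \<open>A t\<close> meets the shape below \<open>A t\<close>: there the outer wall at time \<open>t\<close> passes
  through \<open>A t\<close> and cuts off what lies above. The reflected shape gives the lower bound.\<close>

lemma sofa_column_A:
  assumes t: "t \<in> {beta0..pi/2}" and P: "P $ 1 = sofa_A t $ 1"
  shows "P \<in> sofa \<longleftrightarrow> \<bar>P $ 2 - 1/2\<bar> \<le> sofa_A t $ 2 - 1/2"
proof -
  have t': "t \<in> {0..pi/2}" using t beta0_pos by simp
  have s: "sin t > 0" using t beta0_pos by (intro sin_gt_zero) auto
  have up: "Q $ 2 \<le> sofa_A t $ 2" if "Q \<in> shape_of sofa_path" "Q $ 1 = sofa_A t $ 1" for Q
  proof -
    have "(Q - sofa_path t) \<bullet> mu t \<le> 1" using that(1) t' by (simp add: mem_shape_of in_hall_def)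
    then have "(Q - sofa_A t) \<bullet> mu t \<le> 0"
      using path_inner(1)[of sofa_path t] by (simp add: inner_diff_left)
    then have "(Q $ 2 - sofa_A t $ 2) * sin t \<le> 0"
      using that(2) by (simp add: inner_plane)
    then show ?thesis using s by (simp add: mult_le_0_iff)
  qed
  show ?thesis
  proof
    assume "P \<in> sofa"
    then show "\<bar>P $ 2 - 1/2\<bar> \<le> sofa_A t $ 2 - 1/2"
      using up[of P] up[of "refl_half P"] P by (auto simp: mem_sofa abs_if)
  next
    assume "\<bar>P $ 2 - 1/2\<bar> \<le> sofa_A t $ 2 - 1/2"
    then show "P \<in> sofa"
      using right_lobe_in_shape[OF t', of P] right_lobe_in_shape[OF t', of "refl_half P"] P sofa_A_range[OF t']
      by (auto simp: mem_sofa abs_le_iff)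
  qed
qed

text \<open>A point vertically below \<open>B t\<close> lies behind the inner wall of time \<open>t\<close>, and behind the other one too, as
  \<open>B t\<close> itself is not in front of it. So it is in the removed quadrant.\<close>

lemma sofa_column_B:
  assumes t: "t \<in> {beta0..pi/2}" and P: "P $ 1 = sofa_B t $ 1"
  shows "P \<in> sofa \<longleftrightarrow> \<bar>P $ 2 - 1/2\<bar> \<le> 1/2 - sofa_B t $ 2"
proof -
  have t': "t \<in> {0..pi/2}" using t beta0_pos by simp
  have s: "sin t > 0" "cos t \<ge> 0" using t beta0_pos by (auto intro!: sin_gt_zero cos_ge_zero)
  have low: "sofa_B t $ 2 \<le> Q $ 2" if "Q \<in> shape_of sofa_path" "Q $ 1 = sofa_B t $ 1" for Q
  proof (rule ccontr)
    assume "\<not> ?thesis"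
    then have neg: "Q $ 2 - sofa_B t $ 2 < 0" by simp
    have m: "(Q - sofa_path t) \<bullet> mu t = (Q $ 2 - sofa_B t $ 2) * sin t"
    proof -
      have "(Q - sofa_B t) \<bullet> mu t = (Q $ 2 - sofa_B t $ 2) * sin t"
        using that(2) by (simp add: inner_plane)
      then show ?thesis using path_inner(3)[of sofa_path t] by (simp add: inner_diff_left)
    qed
    have n: "(Q - sofa_path t) \<bullet> nu t = (Q $ 2 - sofa_B t $ 2) * cos t + sofa_p t"
    proof -
      have "(Q - sofa_B t) \<bullet> nu t = (Q $ 2 - sofa_B t $ 2) * cos t"
        using that(2) by (simp add: inner_plane)
      then show ?thesis using path_inner(4)[of sofa_path t] by (simp add: inner_diff_left)
    qed
    have "(Q $ 2 - sofa_B t $ 2) * sin t < 0" using neg s by (simp add: mult_neg_pos)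
    moreover have "(Q $ 2 - sofa_B t $ 2) * cos t + sofa_p t < 0"
    proof (cases "t = beta0")
      case True
      then show ?thesis using neg beta0_facts(3) sofa_p_beta0 by (simp add: mult_neg_pos)
    next
      case False
      then have "sofa_p t < 0" using sofa_p_neg[of t] t by simp
      moreover have "(Q $ 2 - sofa_B t $ 2) * cos t \<le> 0"
        using neg s by (simp add: mult_nonpos_nonneg)
      ultimately show ?thesis by linarith
    qed
    moreover have "in_hall sofa_path t Q" using that(1) t' by (simp add: mem_shape_of)
    ultimately show False unfolding in_hall_def m n by linarith
  qed
  show ?thesis
  proof
    assume "P \<in> sofa"
    then show "\<bar>P $ 2 - 1/2\<bar> \<le> 1/2 - sofa_B t $ 2"
      using low[of P] low[of "refl_half P"] P by (auto simp: mem_sofa abs_if)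
  next
    assume "\<bar>P $ 2 - 1/2\<bar> \<le> 1/2 - sofa_B t $ 2"
    then show "P \<in> sofa"
      using above_B_in_shape[OF t', of P] above_B_in_shape[OF t', of "refl_half P"] P sofa_B_range[OF t']
      by (auto simp: mem_sofa abs_le_iff)
  qed
qed

lemma sofa_column_corner:
  assumes t: "t \<in> {beta0..pi/2 - beta0}" and P: "P $ 1 = sofa_path t $ 1"
  shows "P \<in> sofa \<longleftrightarrow> \<bar>P $ 2 - 1/2\<bar> \<le> 1/2 - sofa_path t $ 2"
proof -
  have t': "t \<in> {0..pi/2}" using t beta0_pos by simp
  have s: "sin t > 0" "cos t > 0" using t beta0_pos by (auto intro!: sin_gt_zero cos_gt_zero)
  have low: "sofa_path t $ 2 \<le> Q $ 2" if "Q \<in> shape_of sofa_path" "Q $ 1 = sofa_path t $ 1" for Q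
  proof (rule ccontr)
    assume "\<not> ?thesis"
    then have "(Q $ 2 - sofa_path t $ 2) * sin t < 0" "(Q $ 2 - sofa_path t $ 2) * cos t < 0"
      using s by (auto simp: mult_neg_pos)
    then have "(Q - sofa_path t) \<bullet> mu t < 0" "(Q - sofa_path t) \<bullet> nu t < 0"
      using that(2) by (simp_all add: inner_plane)
    then show False using that(1) t' by (force simp: mem_shape_of in_hall_def)
  qed
  show ?thesis
  proof
    assume "P \<in> sofa"
    then show "\<bar>P $ 2 - 1/2\<bar> \<le> 1/2 - sofa_path t $ 2"
      using low[of P] low[of "refl_half P"] P by (auto simp: mem_sofa abs_if)
  next
    assume "\<bar>P $ 2 - 1/2\<bar> \<le> 1/2 - sofa_path t $ 2"
    then show "P \<in> sofa"
      using above_corner_in_shape[OF t, of P] above_corner_in_shape[OF t, of "refl_half P"] P corner_path_range[OF t]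
      by (auto simp: mem_sofa abs_le_iff)
  qed
qed

lemma flip_refl_half: "refl_half (flip P) = flip (refl_half P)"
  by (simp add: plane_eq_iff)

lemma sofa_flip: "flip P \<in> sofa \<longleftrightarrow> P \<in> sofa"
  by (simp add: mem_sofa flip_refl_half shape_flip)

lemma sofa_path_nth_continuous: "continuous_on {0..pi/2} (\<lambda>t. sofa_path t $ i)"
  by (intro continuous_intros P1_continuous sofa_P1)

lemma sofa_path_pi4: "sofa_path (pi/4) $ 1 = 1 - 4/3 * coef_a1"
proof -
  have "pi/2 - pi/4 = pi/4" by simp
  then show ?thesis using sofa_path_flip[of "pi/4"] by (simp add: plane_eq_iff)
qed

lemma sofa_right_column_cases:
  assumes X: "1 - 4/3 * coef_a1 \<le> X" "X \<le> 1"
  obtains (corner) t where "t \<in> {beta0..pi/4}" "X = sofa_path t $ 1"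
  | (B) t where "t \<in> {beta0..pi/2}" "X = sofa_B t $ 1"
  | (A) t where "t \<in> {beta0..pi/2}" "X = sofa_A t $ 1"
proof -
  have c: "sofa_path beta0 $ 1 = sofa_B beta0 $ 1"
    by (simp add: path_B_def path_D_def sofa_p_beta0)
  have b: "beta0 \<le> pi/4" "beta0 \<le> pi/2" using beta0_less pi_gt_zero by linarith+
  consider "X \<le> sofa_path beta0 $ 1" | "sofa_path beta0 $ 1 \<le> X" "X \<le> 1 - 2/3 * coef_a1" | "1 - 2/3 * coef_a1 \<le> X"
    by linarith
  then show thesis
  proof cases
    case 1
    have "\<exists>t\<ge>beta0. t \<le> pi/4 \<and> sofa_path t $ 1 = X"
      by (rule IVT2') (use 1 X b sofa_path_pi4 beta0_pos in \<open>auto intro: continuous_on_subset[OF sofa_path_nth_continuous]\<close>)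
    then show thesis using corner by force
  next
    case 2
    have "\<exists>t\<ge>beta0. t \<le> pi/2 \<and> sofa_B t $ 1 = X"
      by (rule IVT') (use 2 X b c sofa_contact_ends beta0_pos in
         \<open>auto intro!: continuous_intros continuous_on_subset[OF P1_continuous_path_B[OF sofa_P1]]\<close>)
    then show thesis using B by force
  next
    case 3
    have "\<exists>t\<ge>beta0. t \<le> pi/2 \<and> sofa_A t $ 1 = X"
      by (rule IVT2') (use 3 X b sofa_contact_ends beta0_pos in
         \<open>auto intro!: continuous_intros continuous_on_subset[OF P1_continuous_path_A[OF sofa_P1]]\<close>)
    then show thesis using A by force
  qed
qed

text \<open>The three families of columns cover the right half by the intermediate value theorem, and the mirror
  symmetry \<open>flip\<close> gives the left half.\<close>

lemma sofa_column:
  assumes X: "1 - 8/3 * coef_a1 \<le> X" "X \<le> 1"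
  obtains h where "h \<ge> 0" "\<And>Y. vector [X, Y] \<in> sofa \<longleftrightarrow> \<bar>Y - 1/2\<bar> \<le> h"
proof -
  have right: "\<exists>h\<ge>0. \<forall>Y. vector [X, Y] \<in> sofa \<longleftrightarrow> \<bar>Y - 1/2\<bar> \<le> h" if X: "1 - 4/3 * coef_a1 \<le> X" "X \<le> 1" for X
    using X
  proof (cases rule: sofa_right_column_cases)
    case (corner t)
    then have t: "t \<in> {beta0..pi/2 - beta0}" using beta0_less by auto
    show ?thesis
      using sofa_column_corner[OF t] corner(2) corner_path_height(2)[OF t]
      by (intro exI[of _ "1/2 - sofa_path t $ 2"]) simp
  next
    case (B t)
    then have t: "t \<in> {0..pi/2}" using beta0_pos by auto
    show ?thesis
      using sofa_column_B[OF B(1)] B(2) sofa_B_range[OF t]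
      by (intro exI[of _ "1/2 - sofa_B t $ 2"]) simp
  next
    case (A t)
    then have t: "t \<in> {0..pi/2}" using beta0_pos by auto
    show ?thesis
      using sofa_column_A[OF A(1)] A(2) sofa_A_range[OF t]
      by (intro exI[of _ "sofa_A t $ 2 - 1/2"]) simp
  qed
  show thesis
  proof (cases "1 - 4/3 * coef_a1 \<le> X")
    case True
    then show thesis using right[of X] X that by blast
  next
    case False
    define X' where "X' = 2 * (1 - 4/3 * coef_a1) - X"
    have "1 - 4/3 * coef_a1 \<le> X'" "X' \<le> 1" using False X by (simp_all add: X'_def)
    then obtain h where h: "h \<ge> 0" "\<And>Y. vector [X', Y] \<in> sofa \<longleftrightarrow> \<bar>Y - 1/2\<bar> \<le> h" using right by blast
    have "flip (vector [X, Y]) = vector [X', Y]" for Y by (simp add: plane_eq_iff X'_def)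
    then have "vector [X, Y] \<in> sofa \<longleftrightarrow> \<bar>Y - 1/2\<bar> \<le> h" for Y
      using h(2) sofa_flip[of "vector [X, Y]"] by simp
    then show thesis using h(1) that by blast
  qed
qed

lemma sofa_bounds:
  assumes "P \<in> sofa"
  shows "1 - 8/3 * coef_a1 \<le> P $ 1" "P $ 1 \<le> 1" "0 \<le> P $ 2" "P $ 2 \<le> 1"
  using assms by (simp_all add: mem_sofa mem_shape_of sofa_contact_ends)

lemma midline_in_sofa:
  assumes "1 - 8/3 * coef_a1 \<le> X" "X \<le> 1"
  shows "vector [X, 1/2] \<in> sofa"
  by (rule sofa_column[OF assms]) simp

text \<open>Each column is a segment that meets the middle line, and the part of the middle line between the
  endpoints lies in the shape.\<close>

lemma sofa_connected: "connected sofa"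
proof -
  let ?R = "{1 - 8/3 * coef_a1..1}"
  define M :: "plane set" where "M = (\<lambda>X. vector [X, 1/2]) ` ?R"
  define V :: "real \<Rightarrow> plane set" where "V X = (\<lambda>Y. vector [X, Y]) ` {Y. vector [X, Y] \<in> sofa}" for X
  have M: "connected M" "M \<subseteq> sofa" "vector [1, 1/2] \<in> M"
  proof -
    show "connected M"
      unfolding M_def by (intro connected_continuous_image continuous_intros) simp
    show "M \<subseteq> sofa" using midline_in_sofa by (auto simp: M_def)
    show "vector [1, 1/2] \<in> M" unfolding M_def by (rule imageI) (use coef_a1_facts(2) in simp)
  qed
  have VM: "connected (V X \<union> M)" "V X \<subseteq> sofa" if X: "X \<in> ?R" for X
  proof -
    obtain h where h: "\<And>Y. vector [X, Y] \<in> sofa \<longleftrightarrow> \<bar>Y - 1/2\<bar> \<le> h"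
      using sofa_column[of X] X by auto
    have "{Y. vector [X, Y] \<in> sofa} = {1/2 - h..1/2 + h}"
      unfolding h by (auto simp: abs_le_iff)
    then have "connected (V X)"
      unfolding V_def by (intro connected_continuous_image continuous_intros) simp
    moreover have "vector [X, 1/2] \<in> V X \<inter> M"
      unfolding V_def M_def using X midline_in_sofa[of X] by (intro IntI imageI) auto
    ultimately show "connected (V X \<union> M)" using M(1) by (intro connected_Un) auto
    show "V X \<subseteq> sofa" by (auto simp: V_def)
  qed
  have "sofa = (\<Union>X\<in>?R. V X \<union> M)"
  proof (intro antisym subsetI)
    fix P assume P: "P \<in> sofa"
    have eq: "vector [P$1, P$2] = P" by (simp add: plane_eq_iff)
    have "vector [P$1, P$2] \<in> V (P$1)" unfolding V_def by (intro imageI CollectI) (simp only: eq P)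
    then have "P \<in> V (P$1)" by (simp only: eq)
    then show "P \<in> (\<Union>X\<in>?R. V X \<union> M)" using sofa_bounds(1,2)[OF P] by auto
  qed (use VM(2) M(2) in blast)
  moreover have "connected (\<Union>X\<in>?R. V X \<union> M)"
  proof (rule connected_Union)
    show "\<And>S. S \<in> (\<lambda>X. V X \<union> M) ` ?R \<Longrightarrow> connected S" using VM(1) by blast
    have "vector [1, 1/2] \<in> \<Inter>((\<lambda>X. V X \<union> M) ` ?R)" using M(3) by blast
    then show "\<Inter>((\<lambda>X. V X \<union> M) ` ?R) \<noteq> {}" by blast
  qed
  ultimately show ?thesis by (simp only:)
qed

lemma closed_in_hall: "closed {P. in_hall x t P}"
  unfolding in_hall_def
  by (intro closed_Collect_conj closed_Collect_disj closed_Collect_le continuous_intros)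

lemma closed_shape_of: "closed (shape_of x)"
proof -
  have "shape_of x = {P. P$1 \<le> 1} \<inter> {P. 0 \<le> P$2} \<inter> {P. P$2 \<le> 1} \<inter> (\<Inter>t\<in>{0..pi/2}. {P. in_hall x t P})
     \<inter> {P. P$1 \<ge> x (pi/2) $ 1 - 1} \<inter> {P. x (pi/2) $ 2 \<le> P$2} \<inter> {P. P$2 \<le> x (pi/2) $ 2 + 1}"
    by (auto simp: mem_shape_of)
  also have "closed \<dots>"
    by (intro closed_Int closed_INT ballI closed_in_hall closed_Collect_le continuous_intros)
  finally show ?thesis .
qed

lemma closed_sofa: "closed sofa"
proof -
  have "continuous_on UNIV refl_half" unfolding refl_half_def[abs_def] by (intro continuous_intros)
  then have "closed (shape_of sofa_path \<inter> refl_half -` shape_of sofa_path)"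
    by (intro closed_Int closed_vimage closed_shape_of)
  moreover have "sofa = shape_of sofa_path \<inter> refl_half -` shape_of sofa_path"
    unfolding set_eq_iff Int_iff vimage_eq mem_sofa by blast
  ultimately show ?thesis by (simp only:)
qed

lemma bounded_sofa: "bounded sofa"
proof (rule boundedI)
  fix P assume P: "P \<in> sofa"
  have "norm P \<le> \<bar>P$1\<bar> + \<bar>P$2\<bar>"
    using norm_le_l1_cart[of P] by (simp add: sum_2)
  also have "\<dots> \<le> 3 + 1"
    using sofa_bounds[OF P] coef_a1_facts(2,6) by (intro add_mono) auto
  finally show "norm P \<le> 4" by simp
qed

lemma sofa_planar_shape: "planar_shape sofa"
  unfolding planar_shape_def
proof (intro conjI)
  show "sofa \<noteq> {}" using midline_in_sofa[of 1] coef_a1_facts(2) by force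
  show "compact sofa" using closed_sofa bounded_sofa by (simp add: compact_eq_bounded_closed)
qed (rule sofa_connected)

section \<open>Moving around corners and the endpoints\<close>

text \<open>Keep the hallway fixed and move the shape instead: the inverse of the motion that takes the hallway
  along \<open>x\<close> carries every subset of the shape around the corner.\<close>

lemma moves_around_corner:
  assumes x: "rotation_path x" and K: "K \<subseteq> shape_of x"
  shows "moves_around_right K"
  unfolding moves_around_right_def moves_within_def
proof (intro conjI exI ballI)
  define \<theta> where "\<theta> s = - (pi/2 * s)" for s :: real
  define c :: "real \<Rightarrow> plane" where
    "c s = vector [- (x (pi/2 * s) \<bullet> mu (pi/2 * s)), - (x (pi/2 * s) \<bullet> nu (pi/2 * s))]" for s
  have rig: "rigid (\<theta> s) (c s) P = vector [(P - x (pi/2 * s)) \<bullet> mu (pi/2 * s), (P - x (pi/2 * s)) \<bullet> nu (pi/2 * s)]" for s P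
    by (simp add: plane_eq_iff rigid_def rot_mult \<theta>_def c_def inner_plane algebra_simps)
  show "K \<subseteq> L_horiz" using K by (auto simp: shape_of_def)
  show "continuous_on {0..1} \<theta>" unfolding \<theta>_def by (intro continuous_intros)
  have cx: "continuous_on {0..1} (\<lambda>s. x (pi/2 * s))"
    by (rule continuous_on_compose2[of "{0..pi/2}" x])
       (use x in \<open>auto simp: rotation_path_def intro!: continuous_intros\<close>)
  have l: "continuous_on {0..1} (\<lambda>s. pi/2 * s)" by (intro continuous_intros)
  have "continuous_on {0..1} (\<lambda>s. mu (pi/2 * s))" "continuous_on {0..1} (\<lambda>s. nu (pi/2 * s))"
    by (rule continuous_on_compose2[OF continuous_on_mu[of UNIV] l subset_UNIV]
        continuous_on_compose2[OF continuous_on_nu[of UNIV] l subset_UNIV])+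
  then show "continuous_on {0..1} c" unfolding c_def by (intro continuous_intros cx)
  show "\<theta> 0 = 0" by (simp add: \<theta>_def)
  show "c 0 = 0" using x by (simp add: c_def rotation_path_def inner_plane plane_eq_iff)
  show "rigid (\<theta> s) (c s) ` K \<subseteq> L_hall" if s: "s \<in> {0..1}" for s
  proof
    fix Q assume "Q \<in> rigid (\<theta> s) (c s) ` K"
    then obtain P where P: "P \<in> K" "Q = rigid (\<theta> s) (c s) P" by blast
    have "pi/2 * s \<in> {0..pi/2}" using s mult_left_le[of s "pi/2"] by simp
    then have "P \<in> rigid (pi/2 * s) (x (pi/2 * s)) ` L_hall" using P K by (auto simp: shape_of_def)
    then show "Q \<in> L_hall" unfolding rigid_image_iff P(2) rig .
  qed
  show "rigid (\<theta> 1) (c 1) ` K \<subseteq> L_vert"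
  proof
    fix Q assume "Q \<in> rigid (\<theta> 1) (c 1) ` K"
    then obtain P where P: "P \<in> K" "Q = rigid (\<theta> 1) (c 1) P" by blast
    then have "P \<in> rigid (pi/2) (x (pi/2)) ` L_vert" using K by (auto simp: shape_of_def)
    then show "Q \<in> L_vert" unfolding rigid_image_iff P(2) rig by simp
  qed
qed

text \<open>Conjugating a motion to the right by the reflection gives a motion to the left, with the opposite
  angle and a translation corrected by the axis \<open>y = 1/2\<close>.\<close>

lemma moves_around_left_reflected: "moves_around_right (refl_half ` K) \<Longrightarrow> moves_around_left K"
proof -
  assume right: "moves_around_right (refl_half ` K)"
  define motion :: "(real \<Rightarrow> real) \<Rightarrow> (real \<Rightarrow> plane) \<Rightarrow> bool" where
    "motion \<theta> c \<longleftrightarrow> continuous_on {0..1} \<theta> \<and> continuous_on {0..1} c \<and> \<theta> 0 = 0 \<and> c 0 = 0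
      \<and> (\<forall>s\<in>{0..1}. rigid (\<theta> s) (c s) ` (refl_half ` K) \<subseteq> L_hall)
      \<and> rigid (\<theta> 1) (c 1) ` (refl_half ` K) \<subseteq> L_vert" for \<theta> c
  have K: "refl_half ` K \<subseteq> L_horiz"
    using right unfolding moves_around_right_def moves_within_def by (rule conjunct1)
  have "\<exists>\<theta> c. motion \<theta> c"
    using right unfolding moves_around_right_def moves_within_def motion_def by (rule conjunct2)
  then obtain \<theta> c where "motion \<theta> c" by blast
  then have m: "continuous_on {0..1} \<theta>" "continuous_on {0..1} c"
    "\<theta> 0 = 0" "c 0 = 0" "\<forall>s\<in>{0..1}. rigid (\<theta> s) (c s) ` (refl_half ` K) \<subseteq> L_hall"
    "rigid (\<theta> 1) (c 1) ` (refl_half ` K) \<subseteq> L_vert"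
    unfolding motion_def by simp_all
  define c' :: "real \<Rightarrow> plane" where "c' s = vector [c s $ 1 - sin (\<theta> s), 1 - cos (\<theta> s) - c s $ 2]" for s
  have rig: "rigid (- \<theta> s) (c' s) P = refl_half (rigid (\<theta> s) (c s) (refl_half P))" for s P
    by (simp add: plane_eq_iff rigid_def rot_mult c'_def algebra_simps)
  show "moves_around_left K"
    unfolding moves_around_left_def moves_within_def
  proof (intro conjI exI ballI)
    show "K \<subseteq> refl_half ` L_horiz"
    proof
      fix P assume "P \<in> K"
      then have "refl_half P \<in> L_horiz" using K by blast
      then show "P \<in> refl_half ` L_horiz" by (simp add: mem_refl_half_image)
    qed
    show "continuous_on {0..1} (\<lambda>s. - \<theta> s)" by (intro continuous_intros m(1))
    show "continuous_on {0..1} c'" unfolding c'_def by (intro continuous_intros m(1,2))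
    show "- \<theta> 0 = 0" "c' 0 = 0" using m(3,4) by (simp_all add: c'_def plane_eq_iff)
    have img: "rigid (- \<theta> s) (c' s) ` K \<subseteq> refl_half ` W"
      if "rigid (\<theta> s) (c s) ` (refl_half ` K) \<subseteq> W" for s W
    proof
      fix Q assume "Q \<in> rigid (- \<theta> s) (c' s) ` K"
      then obtain P where P: "P \<in> K" "Q = rigid (- \<theta> s) (c' s) P" by blast
      then have "rigid (\<theta> s) (c s) (refl_half P) \<in> W" using that by blast
      then show "Q \<in> refl_half ` W" unfolding P(2) rig by blast
    qed
    show "rigid (- \<theta> s) (c' s) ` K \<subseteq> refl_half ` L_hall" if "s \<in> {0..1}" for s
      by (rule img) (rule bspec[OF m(5) that])
    show "rigid (- \<theta> 1) (c' 1) ` K \<subseteq> refl_half ` L_vert"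
      by (rule img) (rule m(6))
  qed
qed

lemma sofa_moves: "moves_around_right sofa" "moves_around_left sofa"
proof -
  have r: "rotation_path sofa_path" using sofa_path_assumptions by (simp add: path_assumptions_def)
  show "moves_around_right sofa"
    by (rule moves_around_corner[OF r]) (simp add: sofa_def)
  have "refl_half ` sofa \<subseteq> shape_of sofa_path" by (auto simp: mem_sofa)
  then show "moves_around_left sofa"
    by (intro moves_around_left_reflected moves_around_corner[OF r])
qed

lemma sofa_right_endpoint: "is_right_endpoint sofa (vector [1, 1/2])"
  unfolding is_right_endpoint_def
proof (intro conjI ballI impI)
  show "vector [1, 1/2] \<in> sofa" using midline_in_sofa[of 1] coef_a1_facts(2) by simp
  fix Q assume Q: "Q \<in> sofa" "Q \<noteq> vector [1, 1/2]"
  have "Q $ 1 \<noteq> 1"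
  proof
    assume 1: "Q $ 1 = 1"
    have "beta0 \<in> {beta0..pi/2}" using beta0_less pi_gt_zero unfolding atLeastAtMost_iff by linarith
    then have "\<bar>Q $ 2 - 1/2\<bar> \<le> 0"
      using sofa_column_A[of beta0 Q] Q(1) 1 by (simp add: sofa_contact_ends)
    with 1 Q(2) show False by (simp add: plane_eq_iff)
  qed
  then show "Q $ 1 < vector [1, 1/2] $ 1" using sofa_bounds(2)[OF Q(1)] by simp
qed

lemma sofa_left_endpoint: "is_left_endpoint sofa (vector [1 - 8/3 * coef_a1, 1/2])"
  unfolding is_left_endpoint_def
proof (intro conjI ballI impI)
  show "vector [1 - 8/3 * coef_a1, 1/2] \<in> sofa" using midline_in_sofa coef_a1_facts(2) by simp
  fix Q assume Q: "Q \<in> sofa" "Q \<noteq> vector [1 - 8/3 * coef_a1, 1/2]"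
  have "flip Q \<in> sofa" using Q by (simp add: sofa_flip)
  moreover have "flip Q \<noteq> vector [1, 1/2]" using Q(2) by (auto simp: plane_eq_iff)
  ultimately have "flip Q $ 1 < 1" using sofa_right_endpoint by (auto simp: is_right_endpoint_def)
  then show "vector [1 - 8/3 * coef_a1, 1/2] $ 1 < Q $ 1" by simp
qed

section \<open>Areas by vertical slices\<close>

lemma Basis_plane: "(Basis :: plane set) = {axis 1 1, axis 2 1}"
  unfolding Basis_vec_def by auto (metis exhaust_2)

lemma plane_vector_measurable: "(\<lambda>(x, y). vector [x, y] :: plane) \<in> borel_measurable (lborel \<Otimes>\<^sub>M lborel)"
proof -
  have "(\<lambda>(x, y). vector [x, y] :: plane) = (\<lambda>z. fst z *\<^sub>R vector [1, 0] + snd z *\<^sub>R vector [0, 1])"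
    by (auto simp: fun_eq_iff plane_eq_iff)
  also have "\<dots> \<in> borel_measurable borel"
    by (intro borel_measurable_continuous_onI continuous_intros)
  finally show ?thesis by (simp add: lborel_prod)
qed

text \<open>This transports Fubini's theorem from pairs to vectors.\<close>

lemma lborel_plane: "(lborel :: plane measure) = distr (lborel \<Otimes>\<^sub>M lborel) borel (\<lambda>(x, y). vector [x, y])"
proof (rule lborel_eqI)
  fix l u :: plane
  assume le: "\<And>b. b \<in> Basis \<Longrightarrow> l \<bullet> b \<le> u \<bullet> b"
  have le': "l$1 \<le> u$1" "l$2 \<le> u$2"
    using le[of "axis 1 1"] le[of "axis 2 1"] by (simp_all add: Basis_plane inner_axis)
  have box: "box l u = {P. l$1 < P$1 \<and> P$1 < u$1 \<and> l$2 < P$2 \<and> P$2 < u$2}"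
    by (auto simp: box_def Basis_plane inner_axis)
  have "emeasure (distr (lborel \<Otimes>\<^sub>M lborel) borel (\<lambda>(x, y). vector [x, y])) (box l u)
      = emeasure (lborel \<Otimes>\<^sub>M lborel) ((\<lambda>(x, y). vector [x, y]) -` box l u \<inter> space (lborel \<Otimes>\<^sub>M lborel))"
    by (rule emeasure_distr[OF plane_vector_measurable]) simp
  also have "(\<lambda>(x, y). vector [x, y]) -` box l u \<inter> space (lborel \<Otimes>\<^sub>M lborel) = {l$1<..<u$1} \<times> {l$2<..<u$2}"
    by (auto simp: box space_pair_measure)
  also have "emeasure (lborel \<Otimes>\<^sub>M lborel) \<dots> = emeasure lborel {l$1<..<u$1} * emeasure lborel {l$2<..<u$2}"
    by (rule lborel.emeasure_pair_measure_Times) auto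
  also have "\<dots> = ennreal ((u$1 - l$1) * (u$2 - l$2))"
    using le' by (simp add: ennreal_mult)
  also have "(u$1 - l$1) * (u$2 - l$2) = (\<Prod>b\<in>Basis. (u - l) \<bullet> b)"
  proof -
    have "axis 1 1 \<noteq> (axis 2 1 :: plane)" by (simp add: axis_eq_axis)
    then show ?thesis by (simp add: Basis_plane inner_axis inner_diff_left)
  qed
  finally show "emeasure (distr (lborel \<Otimes>\<^sub>M lborel) borel (\<lambda>(x, y). vector [x, y])) (box l u)
     = ennreal (\<Prod>b\<in>Basis. (u - l) \<bullet> b)" .
qed simp

text \<open>Fubini's theorem: the area is the integral of the lengths of the vertical slices.\<close>

lemma measure_by_columns:
  fixes E :: "plane set"
  assumes E: "closed E" and range: "\<And>P. P \<in> E \<Longrightarrow> P $ 1 \<in> {a..b}"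
    and col: "\<And>x. x \<in> {a..b} \<Longrightarrow> emeasure lborel {y. vector [x, y] \<in> E} = ennreal (len x)"
    and len: "\<And>x. x \<in> {a..b} \<Longrightarrow> 0 \<le> len x" and I: "(len has_integral I) {a..b}"
  shows "measure lebesgue E = I"
proof -
  have Eb: "E \<in> sets borel" using E by (rule borel_closed)
  have "emeasure lborel E = emeasure (lborel \<Otimes>\<^sub>M lborel) ((\<lambda>(x, y). vector [x, y]) -` E \<inter> space (lborel \<Otimes>\<^sub>M lborel))"
    by (subst lborel_plane) (rule emeasure_distr[OF plane_vector_measurable Eb])
  also have "\<dots> = (\<integral>\<^sup>+x. emeasure lborel (Pair x -` ((\<lambda>(x, y). vector [x, y]) -` E \<inter> space (lborel \<Otimes>\<^sub>M lborel))) \<partial>lborel)"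
    by (rule lborel.emeasure_pair_measure_alt) (rule measurable_sets[OF plane_vector_measurable Eb])
  also have "\<dots> = (\<integral>\<^sup>+x. ennreal (len x) * indicator {a..b} x \<partial>lborel)"
  proof (rule nn_integral_cong)
    fix x :: real
    have *: "Pair x -` ((\<lambda>(x, y). vector [x, y]) -` E \<inter> space (lborel \<Otimes>\<^sub>M lborel)) = {y. vector [x, y] \<in> E}"
      by (auto simp: space_pair_measure)
    show "emeasure lborel (Pair x -` ((\<lambda>(x, y). vector [x, y]) -` E \<inter> space (lborel \<Otimes>\<^sub>M lborel)))
        = ennreal (len x) * indicator {a..b} x"
    proof (cases "x \<in> {a..b}")
      case True
      then show ?thesis unfolding * by (simp add: col)
    next
      case False
      have "{y. vector [x, y] \<in> E} = {}" using range[of "vector [x, _]"] False by auto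
      then show ?thesis unfolding * using False by simp
    qed
  qed
  also have "\<dots> = ennreal I"
    by (rule nn_integral_has_integral_lebesgue'[OF len I])
  finally have "emeasure lborel E = ennreal I" .
  moreover have "I \<ge> 0" using has_integral_nonneg[OF I len] by simp
  ultimately show ?thesis using Eb by (simp add: measure_def)
qed

text \<open>The column length is known only along curves \<open>X\<close> in the parameter \<open>t\<close>. Substitution in the absolutely
  convergent integral spares any regularity of the column length itself.\<close>

lemma has_integral_along_path:
  fixes X W f :: "real \<Rightarrow> real"
  assumes ab: "a \<le> b" and X: "\<And>t. t \<in> {a..b} \<Longrightarrow> (X has_real_derivative X' t) (at t)"
    and inj: "inj_on X {a..b}"
    and W: "\<And>t. t \<in> {a..b} \<Longrightarrow> (W has_real_derivative \<bar>X' t\<bar> * f (X t)) (at t)"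
    and f: "\<And>t. t \<in> {a..b} \<Longrightarrow> 0 \<le> f (X t)"
  shows "(f has_integral (W b - W a)) (X ` {a..b})"
proof -
  have I: "((\<lambda>t. \<bar>X' t\<bar> * f (X t)) has_integral (W b - W a)) {a..b}"
    by (rule fundamental_theorem_of_calculus[OF ab])
       (use W in \<open>auto simp flip: has_real_derivative_iff_has_vector_derivative intro: has_field_derivative_at_within\<close>)
  then have "(\<lambda>t. \<bar>X' t\<bar> * f (X t)) absolutely_integrable_on {a..b}"
    using f by (intro nonnegative_absolutely_integrable_1) (auto simp: has_integral_integrable_integral)
  moreover have "integral {a..b} (\<lambda>t. \<bar>X' t\<bar> * f (X t)) = W b - W a"
    using I by (rule integral_unique)
  ultimately have "f absolutely_integrable_on (X ` {a..b}) \<and> integral (X ` {a..b}) f = W b - W a"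
    using has_absolute_integral_change_of_variables_1'[of "{a..b}" X X' f "W b - W a"] X inj
    by (auto intro: has_field_derivative_at_within)
  then show ?thesis
    using has_integral_integral set_lebesgue_integral_eq_integral(1) by metis
qed

lemma increasing_image:
  fixes X :: "real \<Rightarrow> real"
  assumes ab: "a \<le> b" and X: "\<And>t. t \<in> {a..b} \<Longrightarrow> (X has_real_derivative X' t) (at t)"
    and pos: "\<And>t. t \<in> {a<..<b} \<Longrightarrow> X' t > 0"
  shows "inj_on X {a..b}" "X ` {a..b} = {X a..X b}"
proof -
  have c: "continuous_on {u..v} X" if "a \<le> u" "v \<le> b" for u v
    by (rule DERIV_continuous_on[of _ _ X']) (use that X in \<open>auto intro: has_field_derivative_at_within\<close>)
  have mono: "X u < X v" if "a \<le> u" "u < v" "v \<le> b" for u v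
  proof (rule DERIV_pos_imp_increasing_open[OF that(2)])
    show "continuous_on {u..v} X" using that by (intro c) auto
    fix t assume "u < t" "t < v"
    then have "t \<in> {a<..<b}" "t \<in> {a..b}" using that by auto
    then show "\<exists>y. (X has_real_derivative y) (at t) \<and> 0 < y" using X pos by blast
  qed
  show "inj_on X {a..b}"
    by (rule inj_onI) (metis mono atLeastAtMost_iff less_irrefl linorder_less_linear)
  have mono': "X u \<le> X v" if "a \<le> u" "u \<le> v" "v \<le> b" for u v
    using mono[of u v] that by (cases "u = v") auto
  show "X ` {a..b} = {X a..X b}"
  proof (intro antisym subsetI)
    fix y assume "y \<in> {X a..X b}"
    then show "y \<in> X ` {a..b}" using IVT'[of X a y b] c[of a b] ab by auto
  qed (use mono' in auto)
qed

lemma decreasing_image: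
  fixes X :: "real \<Rightarrow> real"
  assumes ab: "a \<le> b" and X: "\<And>t. t \<in> {a..b} \<Longrightarrow> (X has_real_derivative X' t) (at t)"
    and neg: "\<And>t. t \<in> {a<..<b} \<Longrightarrow> X' t < 0"
  shows "inj_on X {a..b}" "X ` {a..b} = {X b..X a}"
proof -
  have m: "inj_on (\<lambda>t. - X t) {a..b}" "(\<lambda>t. - X t) ` {a..b} = {- X a..- X b}"
    by (rule increasing_image[OF ab, of _ "\<lambda>t. - X' t"]; use X neg in \<open>auto intro!: derivative_eq_intros\<close>)+
  from m(1) show "inj_on X {a..b}" by (auto simp: inj_on_def)
  have "X ` {a..b} = uminus ` ((\<lambda>t. - X t) ` {a..b})" by (simp add: image_image)
  also have "\<dots> = {X b..X a}" unfolding m(2) by simp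
  finally show "X ` {a..b} = {X b..X a}" .
qed

definition column_length :: "real \<Rightarrow> real" where
  "column_length X = measure lborel {Y. vector [X, Y] \<in> sofa}"

lemma column_length_eq:
  assumes "\<And>Y. vector [X, Y] \<in> sofa \<longleftrightarrow> \<bar>Y - 1/2\<bar> \<le> h" "h \<ge> 0"
  shows "column_length X = 2 * h" "emeasure lborel {Y. vector [X, Y] \<in> sofa} = ennreal (column_length X)"
proof -
  have "{Y. vector [X, Y] \<in> sofa} = {1/2 - h..1/2 + h}"
    by (auto simp: assms(1) abs_le_iff)
  then show "column_length X = 2 * h" "emeasure lborel {Y. vector [X, Y] \<in> sofa} = ennreal (column_length X)"
    using assms(2) by (simp_all add: column_length_def)
qed

lemma column_length_A:
  assumes "t \<in> {beta0..pi/2}"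
  shows "column_length (sofa_A t $ 1) = 2 * (sofa_A t $ 2 - 1/2)"
  by (rule column_length_eq) (use sofa_column_A[OF assms] sofa_A_range[of t] assms beta0_pos in auto)

lemma column_length_B:
  assumes "t \<in> {beta0..pi/2}"
  shows "column_length (sofa_B t $ 1) = 2 * (1/2 - sofa_B t $ 2)"
  by (rule column_length_eq) (use sofa_column_B[OF assms] sofa_B_range[of t] assms beta0_pos in auto)

lemma column_length_corner:
  assumes "t \<in> {beta0..pi/2 - beta0}"
  shows "column_length (sofa_path t $ 1) = 2 * (1/2 - sofa_path t $ 2)"
  by (rule column_length_eq) (use sofa_column_corner[OF assms] corner_path_height(2)[OF assms] in auto)

lemma column_length_nonneg: "column_length X \<ge> 0"
  by (simp add: column_length_def)

section \<open>Column lengths and their antiderivatives\<close>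

text \<open>The addition theorems turn the integrand along \<open>A\<close> into a sum of cosines; the next lemma does the
  same along \<open>B\<close>. The identities hold for independent \<open>t\<close> and \<open>w\<close>.\<close>

lemma lobe_integrand:
  fixes t w :: real
  shows "1 + cos (2*w) - cos (2*t) - 3/4 * cos (2*t - 2*w) - 1/4 * cos (2*t + 2*w)
     = 4 * (cos w * sin t) * (cos w * sin t - 1/2 * (sin w * cos t))"
proof -
  have "(sin t)^2 = 1 - (cos t)^2" by (rule sin_squared_eq)
  then show ?thesis
    unfolding cos_diff cos_add cos_double_cos sin_double by algebra
qed

lemma notch_integrand:
  fixes t w :: real
  shows "7/8 * cos w - 9/16 * cos (2*t - w) - 5/16 * cos (2*t + w)
     = sin t * (sin t * cos w - 1/2 * (cos t * sin w)) + 3/4 * cos w * (sin t)^2"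
proof -
  have "(sin t)^2 = 1 - (cos t)^2" by (rule sin_squared_eq)
  then show ?thesis
    unfolding cos_diff cos_add cos_double_cos sin_double by algebra
qed

text \<open>The functions \<open>area_A\<close>, \<open>area_B\<close>, \<open>area_corner\<close> and \<open>area_arc\<close> are antiderivatives of the column length times
  the absolute value of the horizontal speed, along \<open>A\<close> and \<open>B\<close> in the middle phase, along the corner (with
  time counted from \<open>pi/4\<close>), and along the arcs of the last phase. They arise from the sums of
  cosines term by term.\<close>

definition area_A :: "real \<Rightarrow> real" where
  "area_A t = 3/8 * coef_F^2 * (t + sin (2 * mid_angle t) - 1/2 * sin (2*t) - 3/4 * sin (2*t - 2 * mid_angle t) - 1/12 * sin (2*t + 2 * mid_angle t))"

definition area_B :: "real \<Rightarrow> real" where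
  "area_B t = area_A t + t - 1/2 * sin (2*t) - 2 * coef_F * (7/4 * sin (mid_angle t) - 3/8 * sin (2*t - mid_angle t) - 1/8 * sin (2*t + mid_angle t))"

definition area_corner :: "real \<Rightarrow> real" where
  "area_corner s = 5/2 * sqrt 2 * coef_F * (2/5 * sin (5/2 * s) + 2 * sin (s/2)) - 3/2 * coef_F^2 * (s + 1/3 * sin (3 * s)) - 2 * s - sin (2 * s)"

lemma area_A_deriv:
  "(area_A has_real_derivative 3/4 * coef_F * cos (mid_angle t) * sin t * (2 * (coef_F * cos (mid_angle t) * sin t - 1/2 * coef_F * sin (mid_angle t) * cos t))) (at t)"
proof -
  have "(area_A has_real_derivative 3/8 * coef_F^2 *
     (1 + cos (2 * mid_angle t) - cos (2*t) - 3/4 * cos (2*t - 2 * mid_angle t) - 1/4 * cos (2*t + 2 * mid_angle t))) (at t)"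
    unfolding area_A_def by (rule derivative_eq_intros refl | simp add: algebra_simps)+
  then show ?thesis
    unfolding lobe_integrand by (simp add: power2_eq_square algebra_simps)
qed

lemma area_B_deriv:
  "(area_B has_real_derivative (sin t - 3/4 * coef_F * cos (mid_angle t) * sin t) * (2 * (sin t - (coef_F * cos (mid_angle t) * sin t - 1/2 * coef_F * sin (mid_angle t) * cos t)))) (at t)"
proof -
  have "(area_B has_real_derivative 3/4 * coef_F * cos (mid_angle t) * sin t * (2 * (coef_F * cos (mid_angle t) * sin t - 1/2 * coef_F * sin (mid_angle t) * cos t))
     + 1 - cos (2*t) - 2 * coef_F * (7/8 * cos (mid_angle t) - 9/16 * cos (2*t - mid_angle t) - 5/16 * cos (2*t + mid_angle t))) (at t)"
    unfolding area_B_def by (rule derivative_eq_intros area_A_deriv refl | simp add: algebra_simps)+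
  then show ?thesis
    unfolding notch_integrand cos_double_sin by (rule DERIV_cong) (simp add: power2_eq_square field_simps)
qed

lemma area_corner_deriv:
  "((\<lambda>t. area_corner (t - pi/4)) has_real_derivative
    (3/2 * (coef_F * cos (3/2 * (t - pi/4))) - sqrt 2 * cos (t - pi/4)) * (2 * (sqrt 2 * cos (t - pi/4) - coef_F * cos (3/2 * (t - pi/4))))) (at t)"
proof -
  define s where "s = t - pi/4"
  have d: "((\<lambda>t. area_corner (t - pi/4)) has_real_derivative
     5/2 * sqrt 2 * coef_F * (cos (5/2 * s) + cos (s/2)) - 3/2 * coef_F^2 * (1 + cos (3 * s)) - (2 + 2 * cos (2 * s))) (at t)"
    unfolding area_corner_def s_def by (rule derivative_eq_intros refl | simp add: algebra_simps)+
  have e1: "cos (5/2 * s) + cos (s/2) = 2 * cos (3/2 * s) * cos s"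
  proof -
    have "5/2 * s = 3/2 * s + s" "s/2 = 3/2 * s - s" by simp_all
    then show ?thesis by (simp only: cos_add cos_diff)
  qed
  have e2: "1 + cos (3 * s) = 2 * (cos (3/2 * s))^2"
    using cos_double_cos[of "3/2 * s"] by simp
  have e3: "2 + 2 * cos (2 * s) = (sqrt 2 * cos s)^2 * 2"
    unfolding cos_double_cos by (simp add: power_mult_distrib)
  show ?thesis
    using d unfolding e1 e2 e3 s_def[symmetric]
    by (rule DERIV_cong) (simp add: power2_eq_square algebra_simps)
qed

lemma phase6_explicit:
  assumes t: "t \<in> {beta0..pi/2 - beta0}"
  shows "sofa_A t $ 1 = coef_F * cos (mid_angle t) * cos t + 1/2 * coef_F * sin (mid_angle t) * sin t + (1 - 4/3 * coef_a1)"
    "sofa_A t $ 2 - 1/2 = coef_F * cos (mid_angle t) * sin t - 1/2 * coef_F * sin (mid_angle t) * cos t"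
    "sofa_B t $ 1 = coef_F * cos (mid_angle t) * cos t + 1/2 * coef_F * sin (mid_angle t) * sin t + (1 - 4/3 * coef_a1) - cos t"
    "1/2 - sofa_B t $ 2 = sin t - (coef_F * cos (mid_angle t) * sin t - 1/2 * coef_F * sin (mid_angle t) * cos t)"
  unfolding path_B_A sofa_A_phase6[OF t] by (simp_all add: kappa6_def)

lemma phase5_explicit:
  assumes t: "t \<in> {pi/2 - beta0..pi/2}"
  shows "sofa_A t $ 1 = 1/2 * cos t + (1 - 2/3 * coef_a1)" "sofa_A t $ 2 - 1/2 = 1/2 * sin t"
    "sofa_B t $ 1 = - 1/2 * cos t + (1 - 2/3 * coef_a1)" "1/2 - sofa_B t $ 2 = 1/2 * sin t"
  unfolding path_B_A sofa_A_phase5[OF t] by simp_all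

lemma mid_angle_positive:
  assumes "t \<in> {beta0..pi/2 - beta0}"
  shows "cos (mid_angle t) > 0" "sin t > 0"
  using assms beta0_pos by (auto intro!: cos_gt_zero sin_gt_zero simp: field_simps)

definition lobe_x where
  "lobe_x t = coef_F * cos (mid_angle t) * cos t + 1/2 * coef_F * sin (mid_angle t) * sin t + (1 - 4/3 * coef_a1)"

lemma lobe_x_deriv: "(lobe_x has_real_derivative - (3/4 * coef_F * cos (mid_angle t) * sin t)) (at t)"
proof -
  have "(lobe_x has_real_derivative
      coef_F * (- sin (mid_angle t) * (1/2)) * cos t + coef_F * cos (mid_angle t) * (- sin t)
       + (1/2 * coef_F * (cos (mid_angle t) * (1/2)) * sin t + 1/2 * coef_F * sin (mid_angle t) * cos t)) (at t)"
    unfolding lobe_x_def by (rule derivative_eq_intros refl | simp add: algebra_simps)+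
  then show ?thesis by (rule DERIV_cong) (simp add: field_simps)
qed

lemma phase6_order: "beta0 \<le> pi/2 - beta0" "beta0 \<le> pi/4" "pi/2 - beta0 \<le> pi/2"
  using beta0_pos beta0_less by simp_all

lemma integral_A6:
  "(column_length has_integral (area_A (pi/2 - beta0) - area_A beta0)) {sofa_A (pi/2 - beta0) $ 1..1}"
proof -
  let ?I = "{beta0..pi/2 - beta0}"
  have pos: "0 < 3/4 * coef_F * cos (mid_angle t) * sin t" if "t \<in> ?I" for t
    using mid_angle_positive[OF that] coef_F_pos by simp
  have x: "sofa_A t $ 1 = lobe_x t" if "t \<in> ?I" for t
    using phase6_explicit(1)[OF that] by (simp add: lobe_x_def)
  note im = decreasing_image[OF phase6_order(1) lobe_x_deriv, unfolded neg_less_0_iff_less]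
  have inj: "inj_on lobe_x ?I" and img: "lobe_x ` ?I = {lobe_x (pi/2 - beta0)..lobe_x beta0}"
    by (rule im, rule pos, simp)+
  have "(column_length has_integral (area_A (pi/2 - beta0) - area_A beta0)) (lobe_x ` ?I)"
  proof (rule has_integral_along_path[OF phase6_order(1) lobe_x_deriv inj _ column_length_nonneg])
    fix t assume t: "t \<in> ?I"
    then have "t \<in> {beta0..pi/2}" using beta0_pos by auto
    from column_length_A[OF this] have "column_length (lobe_x t) = 2 * (coef_F * cos (mid_angle t) * sin t - 1/2 * coef_F * sin (mid_angle t) * cos t)"
      unfolding x[OF t] phase6_explicit(2)[OF t] .
    then show "(area_A has_real_derivative \<bar>- (3/4 * coef_F * cos (mid_angle t) * sin t)\<bar> * column_length (lobe_x t)) (at t)"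
      using area_A_deriv[of t] pos[OF t] by simp
  qed
  moreover have "lobe_x beta0 = 1" "lobe_x (pi/2 - beta0) = sofa_A (pi/2 - beta0) $ 1"
    using x[of beta0] x[of "pi/2 - beta0"] phase6_order sofa_contact_ends(2) by simp_all
  ultimately show ?thesis unfolding img by simp
qed

lemma integral_B6:
  "(column_length has_integral (area_B (pi/2 - beta0) - area_B beta0))
     {sofa_B beta0 $ 1..sofa_B (pi/2 - beta0) $ 1}"
proof -
  let ?I = "{beta0..pi/2 - beta0}"
  let ?X = "\<lambda>t. lobe_x t - cos t"
  have d: "(?X has_real_derivative sin t - 3/4 * coef_F * cos (mid_angle t) * sin t) (at t)" for t
    using DERIV_diff[OF lobe_x_deriv DERIV_cos] by (rule DERIV_cong) simp
  have nn: "0 \<le> sin t - 3/4 * coef_F * cos (mid_angle t) * sin t" "t \<noteq> pi/2 - beta0 \<Longrightarrow> 0 < sin t - 3/4 * coef_F * cos (mid_angle t) * sin t"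
    if t: "t \<in> ?I" for t
  proof -
    have q: "sofa_q t \<le> 1" by (rule sofa_q_mid(2)[OF t])
    have e: "3/4 * coef_F * cos (mid_angle t) = (sofa_q t + 1)/2" unfolding sofa_pq(5)[OF t] by (simp add: field_simps)
    have q2: "sofa_q t \<le> z0/2 - 1"
    proof -
      have "cos (mid_angle t) \<le> cos (mid_angle beta0)"
        using t beta0_pos by (intro cos_monotone_0_pi_le) auto
      then have "coef_F * cos (mid_angle t) \<le> coef_F * cos (mid_angle beta0)" using coef_F_pos by simp
      then show ?thesis unfolding coef_F_mid_angle sofa_pq(5)[OF t] by simp
    qed
    have "0 < (1 - 3/4 * coef_F * cos (mid_angle t)) * sin t"
      unfolding e using q2 z0_facts(6) mid_angle_positive(2)[OF t] by (intro mult_pos_pos) auto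
    then show "0 \<le> sin t - 3/4 * coef_F * cos (mid_angle t) * sin t" "t \<noteq> pi/2 - beta0 \<Longrightarrow> 0 < sin t - 3/4 * coef_F * cos (mid_angle t) * sin t"
      by (simp_all add: left_diff_distrib)
  qed
  have x: "sofa_B t $ 1 = ?X t" if "t \<in> ?I" for t
    using phase6_explicit(3)[OF that] by (simp add: lobe_x_def)
  have inj: "inj_on ?X ?I" and img: "?X ` ?I = {?X beta0..?X (pi/2 - beta0)}"
    by (rule increasing_image[OF phase6_order(1) d], rule nn(2); simp)+
  have "(column_length has_integral (area_B (pi/2 - beta0) - area_B beta0)) (?X ` ?I)"
  proof (rule has_integral_along_path[OF phase6_order(1) d inj _ column_length_nonneg])
    fix t assume t: "t \<in> ?I"
    then have "t \<in> {beta0..pi/2}" using beta0_pos by auto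
    from column_length_B[OF this] have "column_length (?X t) = 2 * (sin t - (coef_F * cos (mid_angle t) * sin t - 1/2 * coef_F * sin (mid_angle t) * cos t))"
      unfolding x[OF t] phase6_explicit(4)[OF t] .
    then show "(area_B has_real_derivative \<bar>sin t - 3/4 * coef_F * cos (mid_angle t) * sin t\<bar> * column_length (?X t)) (at t)"
      using area_B_deriv[of t] nn(1)[OF t] by simp
  qed
  moreover have "?X beta0 = sofa_B beta0 $ 1" "?X (pi/2 - beta0) = sofa_B (pi/2 - beta0) $ 1"
    using x[of beta0] x[of "pi/2 - beta0"] phase6_order by simp_all
  ultimately show ?thesis unfolding img by simp
qed

definition area_arc :: "real \<Rightarrow> real" where
  "area_arc t = 1/4 * (t - sin t * cos t)"

lemma area_arc_deriv: "(area_arc has_real_derivative 1/2 * sin t * sin t) (at t)"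
proof -
  have "(area_arc has_real_derivative 1/4 * (1 - (cos t * cos t - sin t * sin t))) (at t)"
    unfolding area_arc_def by (rule derivative_eq_intros refl | simp add: algebra_simps)+
  moreover have "cos t * cos t = 1 - sin t * sin t"
    using cos_squared_eq[of t] by (simp add: power2_eq_square)
  ultimately show ?thesis by (simp add: field_simps)
qed

lemma integral_A5:
  "(column_length has_integral (area_arc (pi/2) - area_arc (pi/2 - beta0))) {1 - 2/3 * coef_a1..sofa_A (pi/2 - beta0) $ 1}"
proof -
  let ?I = "{pi/2 - beta0..pi/2}"
  let ?X = "\<lambda>t. 1/2 * cos t + (1 - 2/3 * coef_a1)"
  have d: "(?X has_real_derivative - (1/2 * sin t)) (at t)" for t
    by (auto intro!: derivative_eq_intros)
  have pos: "sin t > 0" if "t \<in> ?I" for t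
    using that beta0_pos beta0_less by (intro sin_gt_zero) auto
  have inj: "inj_on ?X ?I" and img: "?X ` ?I = {?X (pi/2)..?X (pi/2 - beta0)}"
    by (rule decreasing_image[OF phase6_order(3) d], use pos in force)+
  have "(column_length has_integral (area_arc (pi/2) - area_arc (pi/2 - beta0))) (?X ` ?I)"
  proof (rule has_integral_along_path[OF phase6_order(3) d inj _ column_length_nonneg])
    fix t assume t: "t \<in> ?I"
    then have "t \<in> {beta0..pi/2}" using phase6_order by auto
    from column_length_A[OF this] have "column_length (?X t) = sin t"
      unfolding phase5_explicit[OF t] by simp
    then show "(area_arc has_real_derivative \<bar>- (1/2 * sin t)\<bar> * column_length (?X t)) (at t)"
      using area_arc_deriv[of t] pos[OF t] by simp
  qed
  moreover have "?X (pi/2 - beta0) = sofa_A (pi/2 - beta0) $ 1"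
    using phase5_explicit(1)[of "pi/2 - beta0"] beta0_pos by simp
  ultimately show ?thesis unfolding img by simp
qed

lemma integral_B5:
  "(column_length has_integral (area_arc (pi/2) - area_arc (pi/2 - beta0))) {sofa_B (pi/2 - beta0) $ 1..1 - 2/3 * coef_a1}"
proof -
  let ?I = "{pi/2 - beta0..pi/2}"
  let ?X = "\<lambda>t. - 1/2 * cos t + (1 - 2/3 * coef_a1)"
  have d: "(?X has_real_derivative 1/2 * sin t) (at t)" for t
    by (auto intro!: derivative_eq_intros)
  have pos: "sin t > 0" if "t \<in> ?I" for t
    using that beta0_pos beta0_less by (intro sin_gt_zero) auto
  have inj: "inj_on ?X ?I" and img: "?X ` ?I = {?X (pi/2 - beta0)..?X (pi/2)}"
    by (rule increasing_image[OF phase6_order(3) d], use pos in force)+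
  have "(column_length has_integral (area_arc (pi/2) - area_arc (pi/2 - beta0))) (?X ` ?I)"
  proof (rule has_integral_along_path[OF phase6_order(3) d inj _ column_length_nonneg])
    fix t assume t: "t \<in> ?I"
    then have "t \<in> {beta0..pi/2}" using phase6_order by auto
    from column_length_B[OF this] have "column_length (?X t) = sin t"
      unfolding phase5_explicit[OF t] by simp
    then show "(area_arc has_real_derivative \<bar>1/2 * sin t\<bar> * column_length (?X t)) (at t)"
      using area_arc_deriv[of t] pos[OF t] by simp
  qed
  moreover have "?X (pi/2 - beta0) = sofa_B (pi/2 - beta0) $ 1"
    using phase5_explicit(3)[of "pi/2 - beta0"] beta0_pos by simp
  ultimately show ?thesis unfolding img by simp
qed

lemma integral_corner:
  "(column_length has_integral (area_corner 0 - area_corner (beta0 - pi/4))) {1 - 4/3 * coef_a1..sofa_B beta0 $ 1}"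
proof -
  let ?I = "{beta0..pi/4}"
  let ?X = "\<lambda>t. x6 t $ 1"
  let ?d = "\<lambda>t. sqrt 2 * cos (t - pi/4) - 3/2 * (coef_F * cos (3/2 * (t - pi/4)))"
  have I: "t \<in> {beta0..pi/2 - beta0}" if "t \<in> ?I" for t using that beta0_less by auto
  have d: "(?X has_real_derivative ?d t) (at t)" for t
  proof -
    have "vel6 t $ 1 = ?d t" unfolding corner_angle vel6_def by (simp add: field_simps)
    then show ?thesis using has_real_derivative_nth[OF x6_deriv, of 1 t UNIV] by simp
  qed
  have nn: "?d t \<le> 0" "beta0 < t \<Longrightarrow> ?d t < 0" if t: "t \<in> ?I" for t
  proof -
    have sc: "sin t > 0" "cos t > 0" using t beta0_pos by (auto intro!: sin_gt_zero cos_gt_zero)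
    \<comment> \<open>the horizontal velocity of the corner, which is not positive by the signs of both components\<close>
    have eq: "?d t = sofa_p t * cos t - sofa_q t * sin t"
      unfolding corner_angle sofa_pq(2)[OF I[OF t]] sofa_pq(5)[OF I[OF t]] by (simp add: field_simps)
    have "sofa_q t * sin t \<ge> 0" using sofa_q_mid(1)[OF I[OF t]] sc by simp
    moreover have "sofa_p t * cos t \<le> 0" using sofa_p_mid(2)[OF I[OF t]] sc by (simp add: mult_nonpos_nonneg)
    moreover have "beta0 < t \<Longrightarrow> sofa_p t * cos t < 0" using sofa_p_mid(3)[OF I[OF t]] sc by (simp add: mult_neg_pos)
    ultimately show "?d t \<le> 0" "beta0 < t \<Longrightarrow> ?d t < 0" unfolding eq by linarith+
  qed
  have x: "sofa_path t $ 1 = ?X t" if "t \<in> ?I" for t using sofa_path_phase(2)[OF I[OF that]] by simp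
  have inj: "inj_on ?X ?I" and img: "?X ` ?I = {?X (pi/4)..?X beta0}"
    by (rule decreasing_image[OF phase6_order(2) d], rule nn(2); simp)+
  have "(column_length has_integral (area_corner (pi/4 - pi/4) - area_corner (beta0 - pi/4))) (?X ` ?I)"
  proof (rule has_integral_along_path[OF phase6_order(2) d inj _ column_length_nonneg])
    fix t assume t: "t \<in> ?I"
    have "column_length (?X t) = 2 * (sqrt 2 * cos (t - pi/4) - coef_F * cos (3/2 * (t - pi/4)))"
      using column_length_corner[OF I[OF t]] unfolding x[OF t] corner_path_height(1)[OF I[OF t]] by simp
    moreover have "\<bar>?d t\<bar> = 3/2 * (coef_F * cos (3/2 * (t - pi/4))) - sqrt 2 * cos (t - pi/4)"
      using nn(1)[OF t] by linarith
    ultimately show "((\<lambda>t. area_corner (t - pi/4)) has_real_derivative \<bar>?d t\<bar> * column_length (?X t)) (at t)"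
      using area_corner_deriv[of t] by simp
  qed
  moreover have "?X (pi/4) = 1 - 4/3 * coef_a1" "?X beta0 = sofa_B beta0 $ 1"
  proof -
    show "?X (pi/4) = 1 - 4/3 * coef_a1" using x[of "pi/4"] sofa_path_pi4 phase6_order by simp
    have "?X beta0 = sofa_path beta0 $ 1" using x[of beta0] phase6_order by simp
    then show "?X beta0 = sofa_B beta0 $ 1" by (simp add: path_B_def path_D_def sofa_p_beta0)
  qed
  ultimately show ?thesis unfolding img by simp
qed

text \<open>The right half consists of five parts, from the axis outwards: along the corner curve, along \<open>B\<close> in
  the middle and in the last phase, and along \<open>A\<close> in the last and in the middle phase.\<close>

definition half_area :: real where
  "half_area = (area_corner 0 - area_corner (beta0 - pi/4)) + (area_B (pi/2 - beta0) - area_B beta0)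
     + (area_arc (pi/2) - area_arc (pi/2 - beta0)) + (area_arc (pi/2) - area_arc (pi/2 - beta0))
     + (area_A (pi/2 - beta0) - area_A beta0)"

lemma integral_right: "(column_length has_integral half_area) {1 - 4/3 * coef_a1..1}"
proof -
  have o: "1 - 4/3 * coef_a1 \<le> sofa_B beta0 $ 1"
    "sofa_B beta0 $ 1 \<le> sofa_B (pi/2 - beta0) $ 1"
    "sofa_B (pi/2 - beta0) $ 1 \<le> 1 - 2/3 * coef_a1"
    "1 - 2/3 * coef_a1 \<le> sofa_A (pi/2 - beta0) $ 1"
    "sofa_A (pi/2 - beta0) $ 1 \<le> 1"
  proof -
    have r: "beta0 \<in> {0..pi/2}" "pi/2 - beta0 \<in> {0..pi/2}"
      using beta0_pos phase6_order by (auto intro: order_trans)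
    show "1 - 4/3 * coef_a1 \<le> sofa_B beta0 $ 1"
      using sofa_B_range(1)[OF r(1)] coef_a1_facts(5) by simp
    show "sofa_B beta0 $ 1 \<le> sofa_B (pi/2 - beta0) $ 1"
      by (rule sofa_B_mono) (use r phase6_order in auto)
  qed (use sofa_B_range sofa_A_range beta0_pos phase6_order in auto)
  show ?thesis
    unfolding half_area_def
    by (rule has_integral_combine[OF _ o(5) _ integral_A6] has_integral_combine[OF _ o(4) _ integral_A5]
          has_integral_combine[OF _ o(3) _ integral_B5] has_integral_combine[OF o(1) o(2) integral_corner integral_B6]
        | use o in linarith)+
qed

lemma column_length_flip: "column_length (2 * (1 - 4/3 * coef_a1) - X) = column_length X"
proof -
  have "vector [2 * (1 - 4/3 * coef_a1) - X, Y] = flip (vector [X, Y])" for Y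
    by (simp add: plane_eq_iff)
  then have "vector [2 * (1 - 4/3 * coef_a1) - X, Y] \<in> sofa \<longleftrightarrow> vector [X, Y] \<in> sofa" for Y
    by (simp only: sofa_flip)
  then show ?thesis by (simp only: column_length_def)
qed

lemma integral_column_length: "(column_length has_integral (2 * half_area)) {1 - 8/3 * coef_a1..1}"
proof -
  have i: "(column_length has_integral half_area) (cbox (1 - 4/3 * coef_a1) 1)"
    using integral_right by simp
  have "((\<lambda>X. column_length ((-1) *\<^sub>R X + 2 * (1 - 4/3 * coef_a1))) has_integral (1 / \<bar>-1\<bar> ^ DIM(real)) *\<^sub>R half_area)
     ((\<lambda>X. (1/(-1)) *\<^sub>R X + - ((1/(-1)) *\<^sub>R (2 * (1 - 4/3 * coef_a1)))) ` cbox (1 - 4/3 * coef_a1) 1)"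
    by (rule has_integral_affinity[OF i]) simp
  moreover have "(\<lambda>X. (1/(-1)) *\<^sub>R X + - ((1/(-1)) *\<^sub>R (2 * (1 - 4/3 * coef_a1)))) ` cbox (1 - 4/3 * coef_a1) 1
     = {1 - 8/3 * coef_a1..1 - 4/3 * coef_a1}"
  proof -
    have "(\<lambda>X. (1/(-1)) *\<^sub>R X + - ((1/(-1)) *\<^sub>R (2 * (1 - 4/3 * coef_a1)))) = (\<lambda>X. 2 * (1 - 4/3 * coef_a1) - X)"
      by (simp add: fun_eq_iff)
    then show ?thesis using coef_a1_facts(2) by simp
  qed
  moreover have "(\<lambda>X. column_length ((-1) *\<^sub>R X + 2 * (1 - 4/3 * coef_a1))) = column_length"
    using column_length_flip by (simp add: fun_eq_iff algebra_simps)
  ultimately have "(column_length has_integral half_area) {1 - 8/3 * coef_a1..1 - 4/3 * coef_a1}" by simp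
  from has_integral_combine[OF _ _ this integral_right] show ?thesis
    using coef_a1_facts(2) by simp
qed

lemma measure_sofa: "measure lebesgue sofa = 2 * half_area"
proof (rule measure_by_columns[OF closed_sofa _ _ column_length_nonneg integral_column_length])
  show "P $ 1 \<in> {1 - 8/3 * coef_a1..1}" if "P \<in> sofa" for P using sofa_bounds[OF that] by simp
  fix X assume X: "X \<in> {1 - 8/3 * coef_a1..1}"
  obtain h where h: "h \<ge> 0" "\<And>Y. vector [X, Y] \<in> sofa \<longleftrightarrow> \<bar>Y - 1/2\<bar> \<le> h"
    using sofa_column[of X] X by auto
  show "emeasure lborel {Y. vector [X, Y] \<in> sofa} = ennreal (column_length X)"
    by (rule column_length_eq(2)[OF h(2,1)])
qed

section \<open>Evaluation of the area\<close>

lemma area_A_at: "area_A (pi/4 + s) = 3/8 * coef_F^2 * (pi/4 + s + cos s - 1/2 * cos (2 * s) - 3/4 * sin s + 1/12 * sin (3 * s))"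
proof -
  have a: "2 * mid_angle (pi/4 + s) = pi/2 + s" "2 * (pi/4 + s) = pi/2 + 2 * s"
    "(pi/2 + 2 * s) - (pi/2 + s) = s" "(pi/2 + 2 * s) + (pi/2 + s) = pi + 3 * s"
    by (simp_all add: field_simps)
  have "sin (pi/2 + s) = cos s" "sin (pi/2 + 2 * s) = cos (2 * s)" "sin (pi + 3 * s) = - sin (3 * s)"
    by (simp_all add: sin_add)
  then show ?thesis unfolding area_A_def a by simp
qed

lemma area_B_at:
  "area_B (pi/4 + s) = area_A (pi/4 + s) + pi/4 + s - 1/2 * cos (2 * s)
     - sqrt 2 * coef_F * (7/4 * (cos (s/2) + sin (s/2)) - 3/8 * (cos (3/2 * s) + sin (3/2 * s)) - 1/8 * (cos (5/2 * s) - sin (5/2 * s)))"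
proof -
  have a: "mid_angle (pi/4 + s) = pi/4 + s/2" "2 * (pi/4 + s) = pi/2 + 2 * s"
    "(pi/2 + 2 * s) - (pi/4 + s/2) = pi/4 + 3/2 * s" "(pi/2 + 2 * s) + (pi/4 + s/2) = pi/2 + (pi/4 + 5/2 * s)"
    by (simp_all add: field_simps)
  have quarter: "sin (pi/2 + x) = cos x" for x :: real by (simp add: sin_add)
  have q: "sin (pi/4 + x) = sqrt 2 / 2 * (cos x + sin x)" "sin (pi/2 + (pi/4 + x)) = sqrt 2 / 2 * (cos x - sin x)" for x
    unfolding quarter by (simp_all add: sin_add cos_add sin_45 cos_45 algebra_simps)
  have "sin (pi/2 + 2 * s) = cos (2 * s)" by (simp add: sin_add)
  then show ?thesis unfolding area_B_def a q by (simp add: algebra_simps)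
qed

text \<open>The times \<open>beta0\<close> and \<open>pi/2 - beta0\<close> are symmetric about \<open>pi/4\<close>, so only the odd parts survive; the terms
  linear in \<open>\<theta>\<close> cancel, and \<open>beta0 / 2\<close> stems from the arcs.\<close>

lemma half_area_trig:
  fixes \<theta> :: real
  defines "\<theta> \<equiv> pi/4 - beta0"
  shows "half_area = beta0/2 + sin beta0 * cos beta0 / 2 - sin (2 * \<theta>)
    - 3/8 * coef_F^2 * (3 * sin \<theta> + sin (3 * \<theta>))
    + sqrt 2 * coef_F * (3/2 * sin (\<theta>/2) + 3/4 * sin (3/2 * \<theta>) + 3/4 * sin (5/2 * \<theta>))"
proof -
  have e: "pi/2 - beta0 = pi/4 + \<theta>" "beta0 = pi/4 + (- \<theta>)" "beta0 - pi/4 = - \<theta>"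
    by (simp_all add: \<theta>_def)
  have A: "area_A (pi/2 - beta0) - area_A beta0 = 3/8 * coef_F^2 * (2 * \<theta> - 3/2 * sin \<theta> + 1/6 * sin (3 * \<theta>))"
    unfolding e(1) by (subst e(2)) (simp only: area_A_at, simp add: algebra_simps)
  have B: "area_B (pi/2 - beta0) - area_B beta0 = (area_A (pi/2 - beta0) - area_A beta0) + 2 * \<theta>
     - sqrt 2 * coef_F * (7/2 * sin (\<theta>/2) - 3/4 * sin (3/2 * \<theta>) + 1/4 * sin (5/2 * \<theta>))"
    unfolding e(1) by (subst (1 2) e(2)) (simp only: area_B_at, simp add: algebra_simps)
  have C: "area_corner 0 - area_corner (beta0 - pi/4) = area_corner \<theta>"
    unfolding e(3) area_corner_def by (simp add: field_simps)
  have D: "area_arc (pi/2) - area_arc (pi/2 - beta0) = beta0/4 + sin beta0 * cos beta0 / 4"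
  proof -
    have "sin (pi/2 - beta0) = cos beta0" "cos (pi/2 - beta0) = sin beta0"
      by (simp_all add: sin_diff cos_diff)
    then show ?thesis unfolding area_arc_def by (simp only:) (simp add: algebra_simps)
  qed
  show ?thesis
    unfolding half_area_def A B C D unfolding area_corner_def by (simp add: field_simps)
qed

text \<open>The numbers \<open>sin \<theta>\<close>, \<open>cos \<theta>\<close> and the sine and cosine of \<open>2 * beta0\<close> are rational in \<open>z0\<close>, and so is
  \<open>sqrt 2 * coef_F * sin (\<theta>/2)\<close>; what remains is an identity modulo the cubic of \<open>z0\<close>.\<close>

lemma half_area_eq: "half_area = beta0/2 + 2 * T0^2 + 1/2"
proof -
  define \<theta> where "\<theta> = pi/4 - beta0"
  define S where "S = sin \<theta>"
  define C where "C = cos \<theta>"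
  define z where "z = z0"
  define w where "w = mid_angle beta0"
  have z: "z^3 = 3 * z^2 + 4" "z > 0" "T0 = 1/z" using z0_facts by (simp_all add: z_def)
  have F: "coef_F * sin w = 2/3" "coef_F * cos w = z/3" "coef_F^2 = (4 + z^2)/9"
    using coef_F_mid_angle coef_F_sq by (simp_all add: z_def w_def)
  have angle: "\<theta> = pi/2 - 2 * w" "\<theta>/2 = pi/4 - w"
    by (simp_all add: \<theta>_def w_def field_simps)
  have "S = (cos w)^2 - (sin w)^2" "C = 2 * sin w * cos w"
    unfolding S_def C_def angle(1) by (simp_all add: sin_diff cos_diff cos_double sin_double)
  then have "coef_F^2 * S = (coef_F * cos w)^2 - (coef_F * sin w)^2" "coef_F^2 * C = 2 * (coef_F * sin w) * (coef_F * cos w)"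
    by algebra+
  then have SC: "(4 + z^2) * S = z^2 - 4" "(4 + z^2) * C = 4 * z"
    unfolding F by (simp_all add: field_simps power2_eq_square)
  have pos: "4 + z^2 > 0" "1 + z^2 > 0" by (simp_all add: add_pos_nonneg)
  have SC': "S = (z^2 - 4) / (4 + z^2)" "C = 4 * z / (4 + z^2)"
    using SC pos by (simp_all add: field_simps)
  have sig: "sqrt 2 * coef_F * sin (\<theta>/2) = (z - 2)/3"
  proof -
    have e: "sin (\<theta>/2) = sqrt 2 / 2 * (cos w - sin w)"
      unfolding angle(2) sin_diff sin_45 cos_45 by (simp add: algebra_simps)
    have "sqrt 2 * coef_F * sin (\<theta>/2) = coef_F * cos w - coef_F * sin w"
      unfolding e by (simp add: field_simps)
    then show ?thesis unfolding F by simp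
  qed
  have double: "cos (2 * h) = 2 * (cos h)^2 - 1" "sin (2 * h) = 2 * sin h * cos h" for h :: real
    by (simp_all add: cos_double_cos sin_double)
  have s2: "(sin h)^2 = 1 - (cos h)^2" for h :: real by (rule sin_squared_eq)
  have half: "C = 2 * (cos (\<theta>/2))^2 - 1" "S = 2 * sin (\<theta>/2) * cos (\<theta>/2)"
    using double[of "\<theta>/2"] by (simp_all add: C_def S_def)
  have m3: "sin (3/2 * \<theta>) = sin (\<theta>/2) * (1 + 2 * C)"
  proof -
    have "sin (3/2 * \<theta>) = sin (\<theta>/2 + \<theta>)" by (simp add: field_simps)
    also have "\<dots> = sin (\<theta>/2) * C + cos (\<theta>/2) * S" unfolding sin_add C_def S_def by simp
    finally show ?thesis unfolding half by algebra
  qed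
  have m5: "sin (5/2 * \<theta>) = sin (\<theta>/2) * (4 * C^2 + 2 * C - 1)"
  proof -
    have "sin (5/2 * \<theta>) = sin (\<theta>/2 + 2 * \<theta>)" by (simp add: field_simps)
    also have "\<dots> = sin (\<theta>/2) * (2 * C^2 - 1) + cos (\<theta>/2) * (2 * S * C)"
      unfolding sin_add double C_def S_def by simp
    finally show ?thesis unfolding half by algebra
  qed
  have t3: "sin (3 * \<theta>) = 3 * S - 4 * S^3"
  proof -
    have "sin (3 * \<theta>) = sin (\<theta> + 2 * \<theta>)" by simp
    also have "\<dots> = S * (2 * C^2 - 1) + C * (2 * S * C)" unfolding sin_add double C_def S_def by simp
    also have "\<dots> = 3 * S - 4 * S^3" using s2[of \<theta>] unfolding S_def[symmetric] C_def[symmetric] by algebra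
    finally show ?thesis .
  qed
  have beta: "sin beta0 * cos beta0 = z / (1 + z^2)" "sin (2 * \<theta>) = (z^2 - 1) / (1 + z^2)"
  proof -
    have r: "sqrt (1 + z^2) * sqrt (1 + z^2) = 1 + z^2" using pos by simp
    show "sin beta0 * cos beta0 = z / (1 + z^2)"
      unfolding sin_cos_beta0 z_def[symmetric] times_divide_times_eq r by simp
    have "2 * \<theta> = pi/2 - 2 * beta0" by (simp add: \<theta>_def)
    then have "sin (2 * \<theta>) = cos (2 * beta0)" by (simp add: sin_diff)
    also have "\<dots> = cos beta0 * cos beta0 - sin beta0 * sin beta0"
      by (simp add: cos_double power2_eq_square)
    also have "\<dots> = (z^2 - 1) / (1 + z^2)"
      unfolding sin_cos_beta0 z_def[symmetric] times_divide_times_eq r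
      by (simp add: power2_eq_square diff_divide_distrib)
    finally show "sin (2 * \<theta>) = (z^2 - 1) / (1 + z^2)" .
  qed
  have "sqrt 2 * coef_F * (3/2 * sin (\<theta>/2) + 3/4 * sin (3/2 * \<theta>) + 3/4 * sin (5/2 * \<theta>))
     = sqrt 2 * coef_F * sin (\<theta>/2) * (3/2 + 3 * C + 3 * C^2)"
    unfolding m3 m5 by (simp add: field_simps)
  then have "half_area = beta0/2 + z / (1 + z^2) / 2 - (z^2 - 1) / (1 + z^2)
      - 3/8 * ((4 + z^2)/9) * (6 * S - 4 * S^3) + (z - 2)/3 * (3/2 + 3 * C + 3 * C^2)"
    using half_area_trig unfolding \<theta>_def[symmetric] beta F(3) t3 sig S_def[symmetric]
    by (simp add: algebra_simps)
  moreover have "z / (1 + z^2) / 2 - (z^2 - 1) / (1 + z^2)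
      - 3/8 * ((4 + z^2)/9) * (6 * S - 4 * S^3) + (z - 2)/3 * (3/2 + 3 * C + 3 * C^2) = 2 * (1/z)^2 + 1/2"
  proof -
    \<comment> \<open>the quotients become variables bound by polynomial equations\<close>
    define u where "u = 1 / (1 + z^2)"
    define v where "v = 1 / (4 + z^2)"
    define y where "y = 1 / z"
    have uvy: "u * (1 + z^2) = 1" "v * (4 + z^2) = 1" "y * z = 1"
      using pos z(2) by (simp_all add: u_def v_def y_def)
    have S: "S = (z^2 - 4) * v" and C: "C = 4 * z * v" by (simp_all add: SC' v_def)
    have "z * u / 2 - (z^2 - 1) * u - 3/8 * ((4 + z^2)/9) * (6 * S - 4 * S^3) + (z - 2)/3 * (3/2 + 3 * C + 3 * C^2)
      = 2 * y^2 + 1/2"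
      using uvy z(1) unfolding S C by algebra
    then show ?thesis by (simp add: u_def y_def)
  qed
  ultimately show ?thesis unfolding z(3) by linarith
qed

text \<open>With \<open>r\<close>, \<open>s\<close> the cube roots in \<open>T0\<close>, the radicals here are \<open>r^2\<close> and \<open>s^2\<close>, and \<open>r s = 1\<close>.\<close>

lemma area_closed_form:
  "2 * half_area = root 3 (3 + 2 * sqrt 2) + root 3 (3 - 2 * sqrt 2) - 1 + beta0"
proof -
  define r where "r = root 3 (sqrt 2 + 1)"
  define s where "s = root 3 (sqrt 2 - 1)"
  have rs: "r * s = 1" by (simp add: r_def s_def root3_sqrt2_prod)
  have "(r^2)^3 = 3 + 2 * sqrt 2"
  proof -
    have "(r^2)^3 = (r^3)^2" by (simp flip: power_mult add: mult.commute)
    also have "\<dots> = 3 + 2 * sqrt 2" by (simp add: r_def power2_eq_square algebra_simps)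
    finally show ?thesis .
  qed
  then have r2: "root 3 (3 + 2 * sqrt 2) = r^2" by (rule root3_eqI)
  have "(s^2)^3 = 3 - 2 * sqrt 2"
  proof -
    have "(s^2)^3 = (s^3)^2" by (simp flip: power_mult add: mult.commute)
    also have "\<dots> = 3 - 2 * sqrt 2" by (simp add: s_def power2_eq_square algebra_simps)
    finally show ?thesis .
  qed
  then have s2: "root 3 (3 - 2 * sqrt 2) = s^2" by (rule root3_eqI)
  have "T0 = 1/2 * (r - s)" by (simp add: T0_eq r_def s_def)
  then have "4 * T0^2 = r^2 + s^2 - 2" using rs by algebra
  then show ?thesis unfolding half_area_eq r2 s2 by simp
qed

theorem theorem5:
  shows "coef_a1 = 1/4 * sqrt (4 + root 3 (71 + 8 * sqrt 2) + root 3 (71 - 8 * sqrt 2))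
    \<and> (planar_shape sofa \<and> moves_around_left sofa \<and> moves_around_right sofa)
    \<and> (path_assumptions beta0 sofa_path \<and> necessary_conditions beta0 sofa_path
        \<and> (\<forall>\<beta> y. path_assumptions \<beta> y \<and> necessary_conditions \<beta> y
              \<longrightarrow> (\<forall>t\<in>{0..pi/2}. y t = sofa_path t)))
    \<and> measure lebesgue sofa =
        root 3 (3 + 2 * sqrt 2) + root 3 (3 - 2 * sqrt 2) - 1
          + arctan (1/2 * (root 3 (sqrt 2 + 1) - root 3 (sqrt 2 - 1)))
    \<and> (is_right_endpoint sofa (path_A sofa_path 0)
        \<and> is_left_endpoint sofa (path_C sofa_path (pi/2))
        \<and> dist (path_C sofa_path (pi/2)) (path_A sofa_path 0) =
            2/3 * sqrt (4 + root 3 (71 + 8 * sqrt 2) + root 3 (71 - 8 * sqrt 2)))"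
proof (intro conjI)
  show a1: "coef_a1 = 1/4 * sqrt (4 + root 3 (71 + 8 * sqrt 2) + root 3 (71 - 8 * sqrt 2))"
    by (rule coef_a1_closed_form)
  show "planar_shape sofa" by (rule sofa_planar_shape)
  show "moves_around_left sofa" by (rule sofa_moves)
  show "moves_around_right sofa" by (rule sofa_moves)
  show "path_assumptions beta0 sofa_path" by (rule sofa_path_assumptions)
  show "necessary_conditions beta0 sofa_path" by (rule sofa_necessary_conditions)
  show "\<forall>\<beta> y. path_assumptions \<beta> y \<and> necessary_conditions \<beta> y \<longrightarrow> (\<forall>t\<in>{0..pi/2}. y t = sofa_path t)"
    using candidate_eq_sofa_path by blast
  show "measure lebesgue sofa =
        root 3 (3 + 2 * sqrt 2) + root 3 (3 - 2 * sqrt 2) - 1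
          + arctan (1/2 * (root 3 (sqrt 2 + 1) - root 3 (sqrt 2 - 1)))"
    unfolding measure_sofa area_closed_form beta0_def by (rule refl)
  show "is_right_endpoint sofa (path_A sofa_path 0)"
    unfolding sofa_contact_ends by (rule sofa_right_endpoint)
  show "is_left_endpoint sofa (path_C sofa_path (pi/2))"
    unfolding sofa_contact_ends by (rule sofa_left_endpoint)
  have "dist (path_C sofa_path (pi/2)) (path_A sofa_path 0) = 8/3 * coef_a1"
    using coef_a1_facts(2) by (simp add: sofa_contact_ends dist_norm norm_vec_def L2_set_def sum_2)
  also have "\<dots> = 2/3 * sqrt (4 + root 3 (71 + 8 * sqrt 2) + root 3 (71 - 8 * sqrt 2))"
    unfolding a1 by simp
  finally show "dist (path_C sofa_path (pi/2)) (path_A sofa_path 0) =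
            2/3 * sqrt (4 + root 3 (71 + 8 * sqrt 2) + root 3 (71 - 8 * sqrt 2))" .
qed

end
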